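(* Let $G$ be either the first Grigorchuk group or a torsion GGS group. Then there exist infinitely many distinct tree-equivalence classes of weakly maximal subgroups of $G$, each of them containing infinitely many weakly maximal subgroups of $G$ with a block structure.
   Context: Trees and groups. The $d$-regular rooted tree $T$ is the set of finite words over $\{0,\dots,d-1\}$; $\operatorname{Aut}(T)$ is the group of automorphisms fixing the root. $T_v$ is the subtree of descendants of $v$ (identified with $T$). For an automorphism $g$ fixing the first level we write $g=(g_0,\dots,g_{d-1})$ if $g(iw)=i\,g_i(w)$. The first Grigorchuk group is the subgroup $\langle a,b,c,d\rangle$ of the automorphism group of the $2$-regular rooted tree, where $a$ exchanges the two first-level subtrees rigidly ($a(0w)=1w$, $a(1w)=0w$) and $b=(a,c)$, $c=(a,d)$, $d=(1,b)$. Let $p$ be a prime and $\mathbf e=(e_0,\dots,e_{p-2})\in\mathbf F_p^{p-1}\setminus\{0\}$; the GGS group with defining vector $\mathbf e$ is the subgroup $\langle a,b\rangle$ of the automorphism group of the $p$-regular rooted tree, where $a$ permutes the first-level subtrees rigidly by a $p$-cycle ($a(iw)=(i+1\bmod p)w$) and $b=(a^{e_0},\dots,a^{e_{p-2}},b)$. A group is torsion if all its elements have finite order. Subgroups. For $G\leq\operatorname{Aut}(T)$, $\operatorname{Rist}_G(v)$ is the subgroup of elements of $G$ acting trivially outside $T_v$. A subgroup is weakly maximal if it is maximal among the subgroups of infinite index of $G$. For $H\le G$, the non-rigidity tree $\operatorname{NR}(H)$ is the subgraph of $T$ spanned by all vertices $v$ such that $\operatorname{Rist}_H(v)$ has infinite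 index in $\operatorname{Rist}_G(v)$. Two weakly maximal subgroups $W_1,W_2$ of $G$ are tree-equivalent if there is an automorphism of $T$ sending $\operatorname{NR}(W_1)$ to $\operatorname{NR}(W_2)$. Block structure. For a vertex $v$ let $\pi_v$ denote the restriction homomorphism from $\operatorname{Stab}_{\operatorname{Aut}(T)}(v)$ to $\operatorname{Aut}(T_v)$. Two vertices are incomparable if neither is a descendant of the other. For a finite set $V$ of pairwise incomparable vertices, $\operatorname{SRist}_G(V)=G\cap\prod_{v\in V}\operatorname{Rist}_{\operatorname{Aut}(T)}(v)$. A diagonal block subgroup with supporting vertex set $V$ is a subgroup $H\le\operatorname{SRist}_G(V)$ such that for all $v\in V$: $\pi_v(H)$ has finite index in $\pi_v(\operatorname{Stab}_G(v))$, and $\pi_v$ is injective on $H$. A block subgroup of $G$ is a subgroup $H=H_1\cdots H_b$ where $V=\bigsqcup_{i=1}^bV_i$ is a finite set of pairwise incomparable vertices partitioned into non-empty subsets and each $H_i$ is a diagonal block subgroup with supporting vertex set $V_i$. A subgroup of $G$ has a block structure if it contains a block subgroup of $G$ as a finite index subgroup. *)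

theory Defs
  imports "HOL-Algebra.Bij" "HOL-Algebra.Generated_Groups" "HOL-Library.Sublist"
    "HOL-Library.Disjoint_Sets" "HOL-Computational_Algebra.Primes"
begin

section \<open>The regular rooted tree and its automorphism group\<close>

definition tree :: "nat \<Rightarrow> nat list set" where
  "tree d = lists {..<d}"

definition adjacent :: "nat list \<Rightarrow> nat list \<Rightarrow> bool" where
  "adjacent u v \<longleftrightarrow> (\<exists>i. v = u @ [i] \<or> u = v @ [i])"

definition tree_automorphisms :: "nat \<Rightarrow> (nat list \<Rightarrow> nat list) set" where
  "tree_automorphisms d =
     {f \<in> Bij (tree d). f [] = [] \<and>
        (\<forall>u\<in>tree d. \<forall>v\<in>tree d. adjacent (f u) (f v) \<longleftrightarrow> adjacent u v)}"

text \<open>As in \<^const>\<open>BijGroup\<close>, automorphisms are functions that are \<^const>\<open>undefined\<close> off the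
  tree, and the product is composition, acting on the left.\<close>

definition AutT :: "nat \<Rightarrow> (nat list \<Rightarrow> nat list) monoid" where
  "AutT d = (BijGroup (tree d))\<lparr>carrier := tree_automorphisms d\<rparr>"

text \<open>The groups below are subsets of the carrier of \<^term>\<open>AutT d\<close>, so they all share its
  multiplication.\<close>

definition subgroup_of :: "nat \<Rightarrow> (nat list \<Rightarrow> nat list) set \<Rightarrow> (nat list \<Rightarrow> nat list) set \<Rightarrow> bool" where
  "subgroup_of d G H \<longleftrightarrow> subgroup H (AutT d) \<and> H \<subseteq> G"

definition finite_index :: "nat \<Rightarrow> (nat list \<Rightarrow> nat list) set \<Rightarrow> (nat list \<Rightarrow> nat list) set \<Rightarrow> bool" where
  "finite_index d K H \<longleftrightarrow> finite (rcosets\<^bsub>(AutT d)\<lparr>carrier := K\<rparr>\<^esub> H)"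

definition torsion :: "nat \<Rightarrow> (nat list \<Rightarrow> nat list) set \<Rightarrow> bool" where
  "torsion d G \<longleftrightarrow> (\<forall>g\<in>G. \<exists>n::nat. n > 0 \<and> g [^]\<^bsub>AutT d\<^esub> n = \<one>\<^bsub>AutT d\<^esub>)"


section \<open>The first Grigorchuk group and the GGS groups\<close>

fun rooted_cycle :: "nat \<Rightarrow> nat list \<Rightarrow> nat list" where
  "rooted_cycle p [] = []"
| "rooted_cycle p (i # w) = ((i + 1) mod p) # w"

fun grig_b :: "nat list \<Rightarrow> nat list"
  and grig_c :: "nat list \<Rightarrow> nat list"
  and grig_d :: "nat list \<Rightarrow> nat list" where
  "grig_b [] = []"
| "grig_b (i # w) = i # (if i = 0 then rooted_cycle 2 w else grig_c w)"
| "grig_c [] = []"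
| "grig_c (i # w) = i # (if i = 0 then rooted_cycle 2 w else grig_d w)"
| "grig_d [] = []"
| "grig_d (i # w) = i # (if i = 0 then w else grig_b w)"

definition grigorchuk_group :: "(nat list \<Rightarrow> nat list) set" where
  "grigorchuk_group =
     generate (AutT 2)
       ((\<lambda>f. restrict f (tree 2)) ` {rooted_cycle 2, grig_b, grig_c, grig_d})"

text \<open>Elements of the field with \<open>p\<close> elements are given by their representatives in
  \<open>{0..<p}\<close>; only the values of \<open>e\<close> at \<open>0, \<dots>, p - 2\<close> are relevant.\<close>

definition defining_vector :: "nat \<Rightarrow> (nat \<Rightarrow> nat) \<Rightarrow> bool" where
  "defining_vector p e \<longleftrightarrow> (\<forall>i<p - 1. e i < p) \<and> (\<exists>i<p - 1. e i \<noteq> 0)"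

fun ggs_b :: "nat \<Rightarrow> (nat \<Rightarrow> nat) \<Rightarrow> nat list \<Rightarrow> nat list" where
  "ggs_b p e [] = []"
| "ggs_b p e (i # w) = i # (if i < p - 1 then (rooted_cycle p ^^ e i) w else ggs_b p e w)"

definition GGS_group :: "nat \<Rightarrow> (nat \<Rightarrow> nat) \<Rightarrow> (nat list \<Rightarrow> nat list) set" where
  "GGS_group p e =
     generate (AutT p) ((\<lambda>f. restrict f (tree p)) ` {rooted_cycle p, ggs_b p e})"


section \<open>Rigid stabilizers and weakly maximal subgroups\<close>

definition Stab :: "(nat list \<Rightarrow> nat list) set \<Rightarrow> nat list \<Rightarrow> (nat list \<Rightarrow> nat list) set" where
  "Stab G v = {g \<in> G. g v = v}"

definition Rist :: "nat \<Rightarrow> (nat list \<Rightarrow> nat list) set \<Rightarrow> nat list \<Rightarrow> (nat list \<Rightarrow> nat list) set" where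
  "Rist d G v = {g \<in> G. \<forall>w\<in>tree d. \<not> prefix v w \<longrightarrow> g w = w}"

definition weakly_maximal :: "nat \<Rightarrow> (nat list \<Rightarrow> nat list) set \<Rightarrow> (nat list \<Rightarrow> nat list) set \<Rightarrow> bool" where
  "weakly_maximal d G W \<longleftrightarrow>
     subgroup_of d G W \<and> \<not> finite_index d G W \<and>
     (\<forall>H. subgroup_of d G H \<and> \<not> finite_index d G H \<and> W \<subseteq> H \<longrightarrow> H = W)"

text \<open>The non-rigidity tree is an induced subgraph, hence is determined by its vertex set; a tree
  automorphism maps one such subgraph onto another iff it does so for the vertex sets.\<close>

definition NR :: "nat \<Rightarrow> (nat list \<Rightarrow> nat list) set \<Rightarrow> (nat list \<Rightarrow> nat list) set \<Rightarrow> nat list set" where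
  "NR d G H = {v \<in> tree d. \<not> finite_index d (Rist d G v) (Rist d H v)}"

definition tree_equivalence ::
  "nat \<Rightarrow> (nat list \<Rightarrow> nat list) set \<Rightarrow>
     ((nat list \<Rightarrow> nat list) set \<times> (nat list \<Rightarrow> nat list) set) set" where
  "tree_equivalence d G =
     {(W1, W2). weakly_maximal d G W1 \<and> weakly_maximal d G W2 \<and>
        (\<exists>f\<in>tree_automorphisms d. f ` NR d G W1 = NR d G W2)}"


section \<open>Block structure\<close>

text \<open>The subtree of descendants of \<open>v\<close> is identified with the whole tree via \<open>v @ w \<mapsto> w\<close>.\<close>

definition restr :: "nat \<Rightarrow> nat list \<Rightarrow> (nat list \<Rightarrow> nat list) \<Rightarrow> nat list \<Rightarrow> nat list" where
  "restr d v g = (\<lambda>w\<in>tree d. drop (length v) (g (v @ w)))"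

definition incomparable_vertices :: "nat \<Rightarrow> nat list set \<Rightarrow> bool" where
  "incomparable_vertices d V \<longleftrightarrow>
     finite V \<and> V \<subseteq> tree d \<and> pairwise (\<lambda>u v. \<not> prefix u v \<and> \<not> prefix v u) V"

definition product_of_subgroups ::
  "nat \<Rightarrow> (nat list \<Rightarrow> nat list) set list \<Rightarrow> (nat list \<Rightarrow> nat list) set" where
  "product_of_subgroups d Hs = foldr (set_mult (AutT d)) Hs {\<one>\<^bsub>AutT d\<^esub>}"

text \<open>Rigid stabilizers of incomparable vertices commute, so the enumeration \<open>vs\<close> of \<open>V\<close> is
  immaterial.\<close>

definition SRist :: "nat \<Rightarrow> (nat list \<Rightarrow> nat list) set \<Rightarrow> nat list set \<Rightarrow> (nat list \<Rightarrow> nat list) set" where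
  "SRist d G V =
     {g \<in> G. \<exists>vs. distinct vs \<and> set vs = V \<and>
        g \<in> product_of_subgroups d (map (Rist d (tree_automorphisms d)) vs)}"

definition diagonal_block_subgroup ::
  "nat \<Rightarrow> (nat list \<Rightarrow> nat list) set \<Rightarrow> nat list set \<Rightarrow> (nat list \<Rightarrow> nat list) set \<Rightarrow> bool" where
  "diagonal_block_subgroup d G V H \<longleftrightarrow>
     incomparable_vertices d V \<and> subgroup_of d (SRist d G V) H \<and>
     (\<forall>v\<in>V. finite_index d (restr d v ` Stab G v) (restr d v ` H) \<and> inj_on (restr d v) H)"

definition block_subgroup ::
  "nat \<Rightarrow> (nat list \<Rightarrow> nat list) set \<Rightarrow> (nat list \<Rightarrow> nat list) set \<Rightarrow> bool" where
  "block_subgroup d G H \<longleftrightarrow>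
     subgroup_of d G H \<and>
     (\<exists>(b::nat) Vs Hs.
        incomparable_vertices d (\<Union>i<b. Vs i) \<and> disjoint_family_on Vs {..<b} \<and>
        (\<forall>i<b. Vs i \<noteq> {} \<and> diagonal_block_subgroup d G (Vs i) (Hs i)) \<and>
        H = product_of_subgroups d (map Hs [0..<b]))"

definition has_block_structure ::
  "nat \<Rightarrow> (nat list \<Rightarrow> nat list) set \<Rightarrow> (nat list \<Rightarrow> nat list) set \<Rightarrow> bool" where
  "has_block_structure d G H \<longleftrightarrow>
     subgroup_of d G H \<and> (\<exists>B. block_subgroup d G B \<and> B \<subseteq> H \<and> finite_index d H B)"

end

theory Submission
  imports Defs
begin

text \<open>Both kinds of groups are regular branch over \<open>K = \<gamma>\<^sub>3(G)\<close>, the subgroup \<open>\<gamma>\<^sub>4(G)\<close> has finite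
  index, and some vertex \<open>x\<close> satisfies \<open>\<pi>\<^sub>x(Stab\<^sub>K(x)) = G\<close>. Let \<open>v \<noteq> w\<close> be vertices of the same level,
  \<open>p = v x\<close>, \<open>q = w x\<close> and \<open>\<kappa> \<in> K\<close>, and let \<open>D\<close> consist of the \<open>g \<in> G\<close> fixing \<open>p\<close> and \<open>q\<close> whose sections
  satisfy \<open>g\<^sub>q = \<kappa> g\<^sub>p \<kappa>\<^sup>-\<^sup>1\<close>. By the choice of \<open>x\<close> every element of \<open>G\<close> is the section at \<open>p\<close> of an
  element of \<open>D\<close>. So if a subgroup \<open>H\<close> with \<open>D \<le> H \<le> G\<close> contains an element outside \<open>D\<close> that fixes
  \<open>p\<close> and \<open>q\<close>, then the elements of \<open>H\<close> supported below \<open>p\<close> form a nontrivial subgroup normalized by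
  all of \<open>G\<close>; it then contains \<open>\<gamma>\<^sub>4(G)\<close> below every vertex of some level, and \<open>H\<close> has finite index.
  Hence \<open>D\<close> has finite index in every subgroup of infinite index above it, a maximal one of these is
  weakly maximal and has a block structure (a twisted diagonal on \<open>{p, q}\<close>, and \<open>K\<close> below the other
  vertices of that level), and its non-rigidity tree consists of the vertices comparable with \<open>p\<close> or
  \<open>q\<close>. The level of \<open>p\<close> is an invariant of the tree-equivalence class, while different \<open>\<kappa>\<close> give
  different subgroups in the same class. For GGS groups, torsion enters through the sum of the defining
  vector, which must vanish modulo \<open>p\<close>; this makes \<open>\<gamma>\<^sub>3(G)\<close> branching.\<close>

section \<open>Commutators and the lower central series\<close>

text \<open>What is recovered below \<open>p\<close> is \<open>[G, K]\<close> and not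
  \<open>K\<close>: nested commutators \<open>[[k, y], k']\<close> localize a nontrivial
  \<open>y\<close> below a vertex, and if \<open>k\<close> has section \<open>g\<close> at
  \<open>x0\<close> while \<open>k'\<close> is a copy of \<open>m\<close> at \<open>x0\<close>,
  there remains a copy of \<open>[g, m]\<close>. This is why gamma_4 must have finite index; it has,
  because generators of finite order make every lower central quotient finite. The detour from
  \<open>v\<close> to \<open>p = v x0\<close> lets \<open>D\<close> project onto all of
  \<open>G\<close> at \<open>p\<close>; a diagonal copy of \<open>K\<close> alone would only give
  invariance under \<open>K\<close>. Twists are told apart because no nontrivial automorphism
  centralizes \<open>K\<close>. For GGS groups a sum \<sigma> that is nonzero modulo
  \<open>p\<close> would give \<open>a^\<sigma> b\<close> infinite order; sum zero also excludes
  constant defining vectors, so that quotients of sections produce nontrivial powers of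
  \<open>a\<close>.\<close>

context group
begin

definition commutator :: "'a \<Rightarrow> 'a \<Rightarrow> 'a" where
  "commutator x y = x \<otimes> y \<otimes> inv x \<otimes> inv y"

lemma commutator_closed [simp]:
  "x \<in> carrier G \<Longrightarrow> y \<in> carrier G \<Longrightarrow> commutator x y \<in> carrier G"
  by (simp add: commutator_def)

lemma mult_inv_cancel [simp]:
  "x \<in> carrier G \<Longrightarrow> y \<in> carrier G \<Longrightarrow> x \<otimes> (inv x \<otimes> y) = y"
  "x \<in> carrier G \<Longrightarrow> y \<in> carrier G \<Longrightarrow> inv x \<otimes> (x \<otimes> y) = y"
  by (simp_all add: m_assoc [symmetric])

lemmas word_simps = commutator_def m_assoc inv_mult_group

lemma commutator_mult_left:
  "x \<in> carrier G \<Longrightarrow> y \<in> carrier G \<Longrightarrow> z \<in> carrier G \<Longrightarrow>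
     commutator (x \<otimes> y) z = (x \<otimes> commutator y z \<otimes> inv x) \<otimes> commutator x z"
  by (simp add: word_simps)

lemma commutator_mult_right:
  "x \<in> carrier G \<Longrightarrow> y \<in> carrier G \<Longrightarrow> z \<in> carrier G \<Longrightarrow>
     commutator x (y \<otimes> z) = commutator x y \<otimes> (y \<otimes> commutator x z \<otimes> inv y)"
  by (simp add: word_simps)

lemma commutator_inv_left:
  "x \<in> carrier G \<Longrightarrow> z \<in> carrier G \<Longrightarrow>
     commutator (inv x) z = inv x \<otimes> inv (commutator x z) \<otimes> x"
  by (simp add: word_simps)

lemma inv_commutator:
  "x \<in> carrier G \<Longrightarrow> y \<in> carrier G \<Longrightarrow> inv (commutator x y) = commutator y x"
  by (simp add: word_simps)

lemma commutator_conj_left: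
  "g \<in> carrier G \<Longrightarrow> x \<in> carrier G \<Longrightarrow> y \<in> carrier G \<Longrightarrow>
     commutator (g \<otimes> x \<otimes> inv g) y = g \<otimes> commutator x (inv g \<otimes> y \<otimes> g) \<otimes> inv g"
  by (simp add: word_simps)

lemma commutator_mult_swap:
  "x \<in> carrier G \<Longrightarrow> y \<in> carrier G \<Longrightarrow> commutator x y \<otimes> y \<otimes> x = x \<otimes> y"
  by (simp add: word_simps)

lemma commutator_trivial:
  "x \<in> carrier G \<Longrightarrow> y \<in> carrier G \<Longrightarrow> x \<otimes> y = y \<otimes> x \<Longrightarrow> commutator x y = \<one>"
  by (simp add: commutator_def) (simp add: m_assoc)

lemma commute_inv:
  assumes "x \<in> carrier G" "y \<in> carrier G" "x \<otimes> y = y \<otimes> x"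
  shows "x \<otimes> inv y = inv y \<otimes> x"
proof -
  have "x \<otimes> inv y = inv y \<otimes> (y \<otimes> x) \<otimes> inv y"
    using assms by (simp add: m_assoc)
  also have "\<dots> = inv y \<otimes> (x \<otimes> y) \<otimes> inv y"
    using assms(3) by simp
  finally show ?thesis
    using assms(1,2) by (simp add: m_assoc)
qed

lemma r_coset_eq_iff:
  assumes N: "subgroup N G" and "x \<in> carrier G" "y \<in> carrier G"
  shows "N #> x = N #> y \<longleftrightarrow> x \<otimes> inv y \<in> N"
proof
  assume "N #> x = N #> y"
  moreover have "x \<in> N #> x"
    using N assms by (simp add: rcos_self)
  ultimately obtain n where n: "n \<in> N" "x = n \<otimes> y"
    by (auto simp: r_coset_def)
  then have "n \<in> carrier G"
    using subgroup.mem_carrier [OF N] by simp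
  with n assms show "x \<otimes> inv y \<in> N"
    by (simp add: m_assoc)
next
  assume xy: "x \<otimes> inv y \<in> N"
  have "x = (x \<otimes> inv y) \<otimes> y"
    using assms by (simp add: m_assoc)
  then have "x \<in> N #> y"
    using xy by (auto simp: r_coset_def)
  then show "N #> x = N #> y"
    using repr_independence [OF _ \<open>y \<in> carrier G\<close> N] by simp
qed

text \<open>Each fibre of \<open>f\<close> lies in one coset, so there are at most as many cosets as
  values. \<open>finite_cosets_level\<close> applies this to the action on a level paired with
  cosets of sections.\<close>

lemma finite_cosets_invariant:
  assumes "subgroup N G" "L \<subseteq> carrier G" "finite (f ` L)"
    and "\<And>x y. x \<in> L \<Longrightarrow> y \<in> L \<Longrightarrow> f x = f y \<Longrightarrow> x \<otimes> inv y \<in> N"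
  shows "finite ((\<lambda>x. N #> x) ` L)"
proof -
  have eq: "N #> x = N #> y" if "x \<in> L" "y \<in> L" "f x = f y" for x y
    using that assms r_coset_eq_iff by blast
  have "(\<lambda>x. N #> x) ` L \<subseteq> (\<lambda>z. N #> (SOME x. x \<in> L \<and> f x = z)) ` (f ` L)"
  proof (clarify)
    fix x assume x: "x \<in> L"
    let ?y = "SOME y. y \<in> L \<and> f y = f x"
    have "?y \<in> L \<and> f ?y = f x"
      by (rule someI [of _ x]) (use x in simp)
    then have "N #> x = N #> ?y"
      using eq x by metis
    then show "N #> x \<in> (\<lambda>z. N #> (SOME x. x \<in> L \<and> f x = z)) ` (f ` L)"
      using x by blast
  qed
  then show ?thesis
    using assms(3) finite_surj by blast
qed

lemma infinite_cosets:
  assumes "subgroup N G" "L \<subseteq> carrier G" "infinite I"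
    and "\<And>i. i \<in> I \<Longrightarrow> h i \<in> L"
    and "\<And>i j. i \<in> I \<Longrightarrow> j \<in> I \<Longrightarrow> h i \<otimes> inv (h j) \<in> N \<Longrightarrow> i = j"
  shows "infinite ((\<lambda>x. N #> x) ` L)"
proof -
  have "inj_on (\<lambda>i. N #> h i) I"
    using assms by (auto intro!: inj_onI) (metis r_coset_eq_iff subsetD)
  then have "infinite ((\<lambda>i. N #> h i) ` I)"
    using assms(3) finite_imageD by blast
  moreover have "(\<lambda>i. N #> h i) ` I \<subseteq> (\<lambda>x. N #> x) ` L"
    using assms(4) by auto
  ultimately show ?thesis
    using infinite_super by blast
qed

lemma finite_cosets_iff:
  assumes "subgroup N G" "L \<subseteq> carrier G"
  shows "finite ((\<lambda>x. N #> x) ` L) \<longleftrightarrow> (\<exists>F\<subseteq>L. finite F \<and> (\<forall>x\<in>L. \<exists>f\<in>F. x \<otimes> inv f \<in> N))"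
proof
  assume "finite ((\<lambda>x. N #> x) ` L)"
  then obtain F where F: "F \<subseteq> L" "finite F" "(\<lambda>x. N #> x) ` L = (\<lambda>x. N #> x) ` F"
    using finite_subset_image by (metis order_refl)
  have "\<exists>f\<in>F. x \<otimes> inv f \<in> N" if x: "x \<in> L" for x
  proof -
    obtain f where "f \<in> F" "N #> x = N #> f"
      using F(3) x by blast
    then show ?thesis
      using F(1) x assms r_coset_eq_iff [of N x f] by blast
  qed
  then show "\<exists>F\<subseteq>L. finite F \<and> (\<forall>x\<in>L. \<exists>f\<in>F. x \<otimes> inv f \<in> N)"
    using F by blast
next
  assume "\<exists>F\<subseteq>L. finite F \<and> (\<forall>x\<in>L. \<exists>f\<in>F. x \<otimes> inv f \<in> N)"
  then obtain F where F: "F \<subseteq> L" "finite F" "\<And>x. x \<in> L \<Longrightarrow> \<exists>f\<in>F. x \<otimes> inv f \<in> N"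
    by blast
  have "(\<lambda>x. N #> x) ` L \<subseteq> (\<lambda>x. N #> x) ` F"
  proof clarify
    fix x assume x: "x \<in> L"
    then obtain f where f: "f \<in> F" "x \<otimes> inv f \<in> N"
      using F(3) by blast
    have "x \<in> carrier G" "f \<in> carrier G"
      using x f(1) F(1) assms(2) by auto
    then have "N #> x = N #> f"
      using f(2) r_coset_eq_iff [OF assms(1)] by simp
    then show "N #> x \<in> (\<lambda>x. N #> x) ` F"
      using f(1) by blast
  qed
  then show "finite ((\<lambda>x. N #> x) ` L)"
    using F(2) finite_surj by blast
qed

lemma finite_cosets_trans:
  assumes N: "subgroup N G" and B: "subgroup B G" and C: "C \<subseteq> carrier G" and "B \<subseteq> C"
    and fN: "finite ((\<lambda>x. N #> x) ` B)" and fB: "finite ((\<lambda>x. B #> x) ` C)"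
    and C_mult: "\<And>x y. x \<in> B \<Longrightarrow> y \<in> C \<Longrightarrow> x \<otimes> y \<in> C"
  shows "finite ((\<lambda>x. N #> x) ` C)"
proof -
  have BG: "B \<subseteq> carrier G"
    using B subgroup.subset by blast
  obtain R where R: "R \<subseteq> C" "finite R" "\<And>x. x \<in> C \<Longrightarrow> \<exists>r\<in>R. x \<otimes> inv r \<in> B"
    using fB finite_cosets_iff [OF B C] by blast
  obtain F where F: "F \<subseteq> B" "finite F" "\<And>x. x \<in> B \<Longrightarrow> \<exists>f\<in>F. x \<otimes> inv f \<in> N"
    using fN finite_cosets_iff [OF N BG] by blast
  let ?P = "(\<lambda>(f, r). f \<otimes> r) ` (F \<times> R)"
  have "\<exists>p\<in>?P. x \<otimes> inv p \<in> N" if x: "x \<in> C" for x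
  proof -
    obtain r where r: "r \<in> R" "x \<otimes> inv r \<in> B"
      using R x by blast
    obtain f where f: "f \<in> F" "(x \<otimes> inv r) \<otimes> inv f \<in> N"
      using F r by blast
    have "x \<in> carrier G" "r \<in> carrier G" "f \<in> carrier G"
      using x r f R F C BG by auto
    then have "x \<otimes> inv (f \<otimes> r) = (x \<otimes> inv r) \<otimes> inv f"
      by (simp add: inv_mult_group m_assoc)
    then have "x \<otimes> inv (f \<otimes> r) \<in> N" "f \<otimes> r \<in> ?P"
      using f r by auto
    then show ?thesis ..
  qed
  moreover have "?P \<subseteq> C" "finite ?P"
    using F(2) R(2) by (auto intro!: C_mult dest: subsetD [OF F(1)] subsetD [OF R(1)])
  ultimately show ?thesis
    using finite_cosets_iff [OF N C] by blast
qed

end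

section \<open>Normal subgroups and commutators inside a fixed subgroup \<open>G\<close>\<close>

locale subgroup_pair = group A for A :: "('a, 'b) monoid_scheme" (structure) +
  fixes G :: "'a set"
  assumes subgroup_G: "subgroup G A"
begin

lemma mem_carrier: "x \<in> G \<Longrightarrow> x \<in> carrier A"
  using subgroup.mem_carrier [OF subgroup_G] .

lemma G_simps [simp]:
  "x \<in> G \<Longrightarrow> y \<in> G \<Longrightarrow> x \<otimes> y \<in> G"
  "x \<in> G \<Longrightarrow> inv x \<in> G"
  "\<one> \<in> G"
  using subgroup.m_closed [OF subgroup_G] subgroup.m_inv_closed [OF subgroup_G]
    subgroup.one_closed [OF subgroup_G] by auto

lemma commutator_in_G [simp]: "x \<in> G \<Longrightarrow> y \<in> G \<Longrightarrow> commutator x y \<in> G"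
  by (simp add: commutator_def)

lemma nat_pow_in_G [simp]: "x \<in> G \<Longrightarrow> x [^] (n::nat) \<in> G"
  by (induction n) auto

lemma int_pow_in_G [simp]: "x \<in> G \<Longrightarrow> x [^] (n::int) \<in> G"
  using subgroup_int_pow_closed [OF subgroup_G] .

text \<open>Normality in \<open>G\<close> is stated inside the ambient group, so that products,
  inverses and cosets of all subgroups are taken in \<open>A\<close> and never in a group with
  changed carrier.\<close>

definition nsub :: "'a set \<Rightarrow> bool" where
  "nsub N \<longleftrightarrow> subgroup N A \<and> N \<subseteq> G \<and> (\<forall>g\<in>G. \<forall>n\<in>N. g \<otimes> n \<otimes> inv g \<in> N)"

lemma nsub_simps:
  assumes "nsub N"
  shows "subgroup N A" "x \<in> N \<Longrightarrow> x \<in> G" "x \<in> N \<Longrightarrow> x \<in> carrier A" "\<one> \<in> N"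
    "x \<in> N \<Longrightarrow> y \<in> N \<Longrightarrow> x \<otimes> y \<in> N" "x \<in> N \<Longrightarrow> inv x \<in> N"
    "g \<in> G \<Longrightarrow> x \<in> N \<Longrightarrow> g \<otimes> x \<otimes> inv g \<in> N"
    "g \<in> G \<Longrightarrow> x \<in> N \<Longrightarrow> inv g \<otimes> x \<otimes> g \<in> N"
proof -
  show "subgroup N A" "x \<in> N \<Longrightarrow> x \<in> G" "g \<in> G \<Longrightarrow> x \<in> N \<Longrightarrow> g \<otimes> x \<otimes> inv g \<in> N"
    using assms by (auto simp: nsub_def)
  then show "x \<in> N \<Longrightarrow> x \<in> carrier A" "\<one> \<in> N"
    "x \<in> N \<Longrightarrow> y \<in> N \<Longrightarrow> x \<otimes> y \<in> N" "x \<in> N \<Longrightarrow> inv x \<in> N"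
    using subgroup.mem_carrier subgroup.one_closed subgroup.m_closed subgroup.m_inv_closed
    by metis+
  assume "g \<in> G" "x \<in> N"
  then have "inv g \<otimes> x \<otimes> inv (inv g) \<in> N"
    using assms unfolding nsub_def by (meson G_simps(2))
  then show "inv g \<otimes> x \<otimes> g \<in> N"
    using \<open>g \<in> G\<close> by (simp add: mem_carrier)
qed

lemma nsub_G: "nsub G"
  using subgroup_G by (auto simp: nsub_def)

text \<open>By \<open>commutator_mult_left\<close> the commutator of a product is a conjugate of one
  commutator times another, and \<open>N\<close> absorbs conjugation. Besides extending from
  generators, this later passes from a power of a generator to the generator itself.\<close>

lemma subgroup_centralizer_mod:
  assumes N: "nsub N" and X: "X \<subseteq> G"
  shows "subgroup {x \<in> G. \<forall>y\<in>X. commutator x y \<in> N} A"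
proof (rule subgroupI)
  show "{x \<in> G. \<forall>y\<in>X. commutator x y \<in> N} \<subseteq> carrier A"
    using mem_carrier by blast
  have "commutator \<one> y \<in> N" if "y \<in> X" for y
    using X that nsub_simps(4) [OF N] mem_carrier by (simp add: commutator_def subset_iff)
  then have "\<one> \<in> {x \<in> G. \<forall>y\<in>X. commutator x y \<in> N}"
    by simp
  then show "{x \<in> G. \<forall>y\<in>X. commutator x y \<in> N} \<noteq> {}"
    by blast
next
  fix x assume x: "x \<in> {x \<in> G. \<forall>y\<in>X. commutator x y \<in> N}"
  have "commutator (inv x) y \<in> N" if y: "y \<in> X" for y
  proof -
    have "commutator (inv x) y = inv x \<otimes> inv (commutator x y) \<otimes> x"
      using x y X by (simp add: commutator_inv_left mem_carrier subset_iff)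
    then show ?thesis
      using x y by (simp add: nsub_simps [OF N])
  qed
  then show "inv x \<in> {x \<in> G. \<forall>y\<in>X. commutator x y \<in> N}"
    using x by simp
next
  fix x x' assume x: "x \<in> {x \<in> G. \<forall>y\<in>X. commutator x y \<in> N}"
    "x' \<in> {x \<in> G. \<forall>y\<in>X. commutator x y \<in> N}"
  have "commutator (x \<otimes> x') y \<in> N" if y: "y \<in> X" for y
  proof -
    have "commutator (x \<otimes> x') y = (x \<otimes> commutator x' y \<otimes> inv x) \<otimes> commutator x y"
      using x y X by (simp add: commutator_mult_left mem_carrier subset_iff)
    then show ?thesis
      using x y by (simp add: nsub_simps [OF N])
  qed
  then show "x \<otimes> x' \<in> {x \<in> G. \<forall>y\<in>X. commutator x y \<in> N}"
    using x by simp
qed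

lemma nsub_centralizer_mod:
  assumes N: "nsub N" and X: "X \<subseteq> G" and conj: "\<And>g x. g \<in> G \<Longrightarrow> x \<in> X \<Longrightarrow> g \<otimes> x \<otimes> inv g \<in> X"
  shows "nsub {x \<in> G. \<forall>y\<in>X. commutator x y \<in> N}"
  unfolding nsub_def
proof (intro conjI ballI)
  fix g x assume g: "g \<in> G" and x: "x \<in> {x \<in> G. \<forall>y\<in>X. commutator x y \<in> N}"
  have "commutator (g \<otimes> x \<otimes> inv g) y \<in> N" if y: "y \<in> X" for y
  proof -
    have "inv g \<otimes> y \<otimes> g \<in> X"
      using conj [of "inv g" y] g y by (simp add: mem_carrier)
    then have "g \<otimes> commutator x (inv g \<otimes> y \<otimes> g) \<otimes> inv g \<in> N"
      using x g nsub_simps(7) [OF N g] by simp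
    moreover have "y \<in> G"
      using X y by blast
    ultimately show ?thesis
      using g x by (simp add: commutator_conj_left mem_carrier)
  qed
  then show "g \<otimes> x \<otimes> inv g \<in> {x \<in> G. \<forall>y\<in>X. commutator x y \<in> N}"
    using g x by simp
qed (use subgroup_centralizer_mod [OF N X] in auto)

text \<open>\<open>subgroup_centralizer_mod\<close> is applied twice: with \<open>T\<close> as the
  test set, then, after swapping the entries, with the whole subgroup generated by
  \<open>S\<close>.\<close>

lemma commutator_generate:
  assumes N: "nsub N" and S: "S \<subseteq> G" and T: "T \<subseteq> G"
    and comm: "\<And>s t. s \<in> S \<Longrightarrow> t \<in> T \<Longrightarrow> commutator s t \<in> N"
    and x: "x \<in> generate A S" and y: "y \<in> generate A T"
  shows "commutator x y \<in> N"
proof -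
  have swap: "commutator u v \<in> N \<Longrightarrow> u \<in> G \<Longrightarrow> v \<in> G \<Longrightarrow> commutator v u \<in> N" for u v
    using nsub_simps(6) [OF N] inv_commutator [of u v] mem_carrier by metis
  have xG: "generate A S \<subseteq> G"
    using generate_subgroup_incl [OF S subgroup_G] .
  have 1: "generate A S \<subseteq> {x \<in> G. \<forall>t\<in>T. commutator x t \<in> N}"
    using S comm by (intro generate_subgroup_incl subgroup_centralizer_mod N T) auto
  have "generate A T \<subseteq> {y \<in> G. \<forall>x\<in>generate A S. commutator y x \<in> N}"
  proof (intro generate_subgroup_incl subgroup_centralizer_mod N xG S subgroup_G)
    show "T \<subseteq> {y \<in> G. \<forall>x\<in>generate A S. commutator y x \<in> N}"
    proof (clarify, intro conjI ballI)
      fix y assume y: "y \<in> T"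
      then show "y \<in> G"
        using T by blast
      fix x assume "x \<in> generate A S"
      then have "x \<in> G" "commutator x y \<in> N"
        using 1 y by blast+
      then show "commutator y x \<in> N"
        using swap \<open>y \<in> G\<close> by simp
    qed
  qed
  then show ?thesis
    using x y swap xG by blast
qed

definition gcomm :: "'a set \<Rightarrow> 'a set" where
  "gcomm N = generate A {commutator x n | x n. x \<in> G \<and> n \<in> N}"

lemma commutator_in_gcomm: "x \<in> G \<Longrightarrow> n \<in> N \<Longrightarrow> commutator x n \<in> gcomm N"
  unfolding gcomm_def by (rule generate.incl) blast

lemma gcomm_least:
  assumes "subgroup M A" "\<And>x n. x \<in> G \<Longrightarrow> n \<in> N \<Longrightarrow> commutator x n \<in> M"
  shows "gcomm N \<subseteq> M"
  unfolding gcomm_def using assms by (intro generate_subgroup_incl) auto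

lemma commutator_in_nsub:
  assumes N: "nsub N" and "x \<in> G" "n \<in> N"
  shows "commutator x n \<in> N" "commutator n x \<in> N"
proof -
  have 1: "x \<otimes> n \<otimes> inv x \<in> N" "inv n \<in> N"
    using assms nsub_simps [OF N] by auto
  then show "commutator x n \<in> N"
    unfolding commutator_def using nsub_simps(5) [OF N] by blast
  then show "commutator n x \<in> N"
    using inv_commutator [of x n] nsub_simps [OF N] assms mem_carrier by metis
qed

lemma gcomm_subset: "nsub N \<Longrightarrow> gcomm N \<subseteq> N"
  by (rule gcomm_least) (simp_all add: nsub_simps(1) commutator_in_nsub(1))

text \<open>Conjugating generators is avoided: \<open>g h g^-1 = [g, h] h\<close>, and
  \<open>[g, h]\<close> is itself a generator because \<open>h\<close> already lies in
  \<open>N\<close>.\<close>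

lemma nsub_gcomm:
  assumes N: "nsub N"
  shows "nsub (gcomm N)"
proof -
  have gen: "{commutator x n | x n. x \<in> G \<and> n \<in> N} \<subseteq> carrier A"
    using mem_carrier nsub_simps [OF N] by auto
  have sub: "subgroup (gcomm N) A"
    unfolding gcomm_def using gen by (rule generate_is_subgroup)
  have "g \<otimes> h \<otimes> inv g \<in> gcomm N" if g: "g \<in> G" and h: "h \<in> gcomm N" for g h
  proof -
    have hN: "h \<in> N"
      using h gcomm_subset [OF N] by blast
    have "g \<otimes> h \<otimes> inv g = commutator g h \<otimes> h"
      using g hN nsub_simps [OF N] by (simp add: word_simps mem_carrier)
    then show ?thesis
      using h commutator_in_gcomm [OF g hN] subgroup.m_closed [OF sub] by simp
  qed
  then show ?thesis
    using sub gcomm_subset [OF N] nsub_simps(2) [OF N] unfolding nsub_def by blast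
qed

text \<open>\<open>lcs n\<close> is the term \<open>\<gamma>\<^bsub>n + 1\<^esub>(G)\<close> of the lower central series.\<close>

primrec lcs :: "nat \<Rightarrow> 'a set" where
  "lcs 0 = G"
| "lcs (Suc n) = gcomm (lcs n)"

lemma generate_superset: "T \<subseteq> generate A T"
  by (auto intro: generate.incl)

lemma nsub_lcs: "nsub (lcs n)"
  by (induction n) (simp_all add: nsub_G nsub_gcomm)

lemma lcs_Suc_subset: "lcs (Suc n) \<subseteq> lcs n"
  by (simp add: gcomm_subset nsub_lcs)

lemma commutator_in_lcs: "x \<in> G \<Longrightarrow> n \<in> lcs m \<Longrightarrow> commutator x n \<in> lcs (Suc m)"
  by (simp add: commutator_in_gcomm)

text \<open>The hypothesis makes each \<open>commutator s t\<close> central modulo \<open>N\<close>,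
  since it commutes with all generators. The centre \<open>?Z\<close> modulo \<open>N\<close> is
  normal, so it contains all commutators, and \<open>[G, ?Z]\<close> lies in
  \<open>N\<close>.\<close>

lemma lcs_2_subset:
  assumes gen: "G = generate A T" and N: "nsub N"
    and comm: "\<And>r s t. r \<in> T \<Longrightarrow> s \<in> T \<Longrightarrow> t \<in> T \<Longrightarrow> commutator r (commutator s t) \<in> N"
  shows "lcs 2 \<subseteq> N"
proof -
  have TG: "T \<subseteq> G"
    by (subst gen) (rule generate_superset)
  let ?Z = "{x \<in> G. \<forall>y\<in>G. commutator x y \<in> N}"
  have Z: "nsub ?Z"
    by (rule nsub_centralizer_mod [OF N]) auto
  have "commutator s t \<in> ?Z" if st: "s \<in> T" "t \<in> T" for s t
  proof -
    have "commutator (commutator s t) y \<in> N" if "y \<in> G" for y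
    proof (rule commutator_generate [OF N, of "{commutator s t}" T])
      show "commutator x r \<in> N" if "x \<in> {commutator s t}" "r \<in> T" for x r
        using comm [of r s t] that st inv_commutator [of r "commutator s t"]
          nsub_simps(6) [OF N] mem_carrier TG by (metis commutator_in_G singletonD subsetD)
      show "{commutator s t} \<subseteq> G"
        using st TG by (simp add: subset_iff)
      show "y \<in> generate A T"
        using that gen by simp
    qed (use TG in \<open>auto intro: generate.incl\<close>)
    moreover have "commutator s t \<in> G"
      using st TG by (simp add: subset_iff)
    ultimately show ?thesis
      by blast
  qed
  then have "commutator x y \<in> ?Z" if "x \<in> G" "y \<in> G" for x y
    by (rule commutator_generate [OF Z TG TG]) (use that in \<open>simp_all only: gen [symmetric]\<close>)
  then have "lcs 1 \<subseteq> ?Z"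
    unfolding One_nat_def lcs.simps by (intro gcomm_least nsub_simps(1) [OF Z]) blast
  moreover have "commutator x n \<in> N" if "x \<in> G" "n \<in> ?Z" for x n
    using that inv_commutator [of n x] nsub_simps(6) [OF N] mem_carrier by (metis (lifting) mem_Collect_eq)
  ultimately have "gcomm (lcs 1) \<subseteq> N"
    using nsub_simps(1) [OF N] by (intro gcomm_least) auto
  then show ?thesis
    by (simp add: numeral_2_eq_2)
qed

text \<open>The elements of \<open>S\<close> are adjoined one at a time. Each is central and of
  finite order modulo \<open>N\<close>, so each step multiplies the index by at most that
  order.\<close>

lemma finite_cosets_abelian_extension:
  assumes N: "nsub N" and L: "nsub L" and NL: "N \<subseteq> L"
    and central: "\<And>x y. x \<in> G \<Longrightarrow> y \<in> L \<Longrightarrow> commutator x y \<in> N"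
    and "finite S" and S: "S \<subseteq> L" and tors: "\<And>s. s \<in> S \<Longrightarrow> \<exists>m>0. s [^] (m::nat) \<in> N"
  shows "finite ((\<lambda>x. N #> x) ` generate A (S \<union> N))"
  using \<open>finite S\<close> S tors
proof (induction S)
  case empty
  have "finite ((\<lambda>x. N #> x) ` N)"
    using nsub_simps [OF N]
    by (intro finite_cosets_invariant [where f = "\<lambda>_. ()"]) auto
  moreover have "generate A N \<subseteq> N"
    using nsub_simps [OF N] by (intro generate_subgroup_incl) auto
  ultimately have "finite ((\<lambda>x. N #> x) ` generate A N)"
    by (meson finite_subset image_mono)
  then show ?case
    by simp
next
  case (insert s S)
  define B where "B = generate A (S \<union> N)"
  define C where "C = generate A (insert s S \<union> N)"
  have LA: "L \<subseteq> carrier A"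
    using nsub_simps(3) [OF L] by blast
  have B: "subgroup B A"
    unfolding B_def using insert NL LA by (intro generate_is_subgroup) auto
  have C: "subgroup C A"
    unfolding C_def using insert NL LA by (intro generate_is_subgroup) auto
  have "B \<subseteq> L"
    unfolding B_def using insert NL by (intro generate_subgroup_incl nsub_simps(1) [OF L]) auto
  have BG: "x \<in> B \<Longrightarrow> x \<in> carrier A" for x
    using \<open>B \<subseteq> L\<close> LA by blast
  have "B \<subseteq> C"
    unfolding B_def C_def by (rule mono_generate) auto
  have NB: "N \<subseteq> B"
    unfolding B_def using generate_superset [of "S \<union> N"] by simp
  have s: "s \<in> G" "s \<in> carrier A"
    using insert(4) nsub_simps(2) [OF L] mem_carrier by auto
  have move: "s [^] j \<otimes> b = (commutator (s [^] j) b \<otimes> b) \<otimes> s [^] j"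
    "commutator (s [^] j) b \<otimes> b \<in> B" if "b \<in> B" for b and j :: int
  proof -
    show "s [^] j \<otimes> b = (commutator (s [^] j) b \<otimes> b) \<otimes> s [^] j"
      using s that BG commutator_mult_swap [of "s [^] j" b] by simp
    have "commutator (s [^] j) b \<in> N"
      using s that \<open>B \<subseteq> L\<close> central [of "s [^] j" b] by auto
    then show "commutator (s [^] j) b \<otimes> b \<in> B"
      using that NB subgroup.m_closed [OF B] by blast
  qed
  \<comment> \<open>Commutators with powers of \<open>s\<close> lie in \<open>N\<close>, which is
    inside \<open>B\<close>, so these powers can be collected on the right.\<close>
  have C_form: "C \<subseteq> {b \<otimes> s [^] j | b (j::int). b \<in> B}" (is "_ \<subseteq> ?D")
    unfolding C_def
  proof (rule generate_subgroup_incl)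
    show "subgroup ?D A"
    proof (rule subgroupI)
      show "?D \<subseteq> carrier A"
        using BG s by auto
      show "?D \<noteq> {}"
        using NB nsub_simps(4) [OF N] by blast
    next
      fix x assume "x \<in> ?D"
      then obtain b and j :: int where x: "x = b \<otimes> s [^] j" "b \<in> B"
        by blast
      then have "inv x = s [^] (- j) \<otimes> inv b" "inv b \<in> B"
        using s BG subgroup.m_inv_closed [OF B] by (simp_all add: inv_mult_group int_pow_neg)
      then have "inv x = (commutator (s [^] (- j)) (inv b) \<otimes> inv b) \<otimes> s [^] (- j)"
        "commutator (s [^] (- j)) (inv b) \<otimes> inv b \<in> B"
        using move by auto
      then show "inv x \<in> ?D"
        by blast
    next
      fix x y assume "x \<in> ?D" "y \<in> ?D"
      then obtain b b' and j j' :: int where x: "x = b \<otimes> s [^] j" "b \<in> B" and y: "y = b' \<otimes> s [^] j'" "b' \<in> B"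
        by blast
      let ?c = "commutator (s [^] j) b' \<otimes> b'"
      have c: "?c \<in> B" "s [^] j \<otimes> b' = ?c \<otimes> s [^] j"
        using move y by auto
      have "x \<otimes> y = b \<otimes> (s [^] j \<otimes> b') \<otimes> s [^] j'"
        using x y s BG by (simp add: m_assoc)
      also have "\<dots> = (b \<otimes> ?c) \<otimes> (s [^] j \<otimes> s [^] j')"
        unfolding c(2) using c(1) x y s BG by (simp add: m_assoc)
      also have "\<dots> = (b \<otimes> ?c) \<otimes> s [^] (j + j')"
        using s by (simp add: int_pow_mult)
      finally show "x \<otimes> y \<in> ?D"
        using x c(1) subgroup.m_closed [OF B] by blast
    qed
    have "s = \<one> \<otimes> s [^] (1::int)"
      using s by (simp add: int_pow_1)
    then have "s \<in> ?D"
      using NB nsub_simps(4) [OF N] by blast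
    moreover have "b \<in> ?D" if "b \<in> B" for b
    proof -
      have "b = b \<otimes> s [^] (0::int)"
        using that BG by simp
      then show ?thesis
        using that by blast
    qed
    moreover have "S \<union> N \<subseteq> B"
      unfolding B_def using generate_superset [of "S \<union> N"] by simp
    ultimately show "insert s S \<union> N \<subseteq> ?D"
      by blast
  qed
  obtain m where m: "m > 0" "s [^] (m::nat) \<in> N"
    using insert(5) by blast
  have fB: "finite ((\<lambda>x. B #> x) ` C)"
  proof -
    let ?F = "(\<lambda>r::nat. s [^] r) ` {..<m}"
    have "\<exists>f\<in>?F. x \<otimes> inv f \<in> B" if xC: "x \<in> C" for x
    proof -
      obtain b and j :: int where x: "x = b \<otimes> s [^] j" "b \<in> B"
        using C_form xC by blast
      let ?r = "nat (j mod int m)"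
      have r: "int ?r = j mod int m" "?r < m"
        using m by (auto simp: nat_less_iff)
      have "j = int m * (j div int m) + int ?r"
        using r(1) by simp
      then have "s [^] j = s [^] (int m * (j div int m)) \<otimes> s [^] (int ?r)"
        using s by (metis int_pow_mult)
      moreover have "s [^] (int m * (j div int m)) = (s [^] m) [^] (j div int m)"
        using s by (metis int_pow_pow int_pow_int)
      moreover have "(s [^] m) [^] (j div int m) \<in> N"
        using m subgroup_int_pow_closed [OF nsub_simps(1) [OF N]] by blast
      ultimately obtain n where n: "n \<in> N" "s [^] j = n \<otimes> s [^] ?r"
        using int_pow_int by metis
      have "x \<otimes> inv (s [^] ?r) = b \<otimes> n"
        using x n s BG NB by (simp add: m_assoc subset_iff)
      then have "x \<otimes> inv (s [^] ?r) \<in> B"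
        using x n NB subgroup.m_closed [OF B] by auto
      then show ?thesis
        using r(2) by blast
    qed
    moreover have "?F \<subseteq> C"
    proof -
      have "s \<in> C"
        unfolding C_def using generate_superset [of "insert s S \<union> N"] by simp
      then show ?thesis
        using subgroup_int_pow_closed [OF C] int_pow_int by (metis image_subsetI)
    qed
    ultimately show ?thesis
      using finite_cosets_iff [OF B subgroup.subset [OF C]] by blast
  qed
  have fN: "finite ((\<lambda>x. N #> x) ` B)"
    unfolding B_def using insert by auto
  show ?case
    unfolding C_def [symmetric]
    using finite_cosets_trans [OF nsub_simps(1) [OF N] B subgroup.subset [OF C] \<open>B \<subseteq> C\<close> fN fB]
      subgroup.m_closed [OF C] \<open>B \<subseteq> C\<close> by blast
qed

text \<open>Modulo the next term, \<open>lcs (Suc n)\<close> is generated by the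
  \<open>[t, s]\<close> with \<open>t\<close> in \<open>T\<close> and \<open>s\<close> among the
  elements chosen for \<open>lcs n\<close>. There \<open>[t^k, s]\<close> agrees with
  \<open>[t, s]^k\<close>, so the order of \<open>t\<close> kills \<open>[t, s]\<close>: torsion is
  inherited from \<open>T\<close> at every stage.\<close>

lemma lcs_generators:
  assumes gen: "G = generate A T" and "finite T"
    and tors: "\<And>t. t \<in> T \<Longrightarrow> \<exists>m>0. t [^] (m::nat) = \<one>"
  shows "\<exists>S\<subseteq>lcs n. finite S \<and> (\<forall>s\<in>S. \<exists>m>0. s [^] (m::nat) \<in> lcs (Suc n)) \<and>
           lcs n \<subseteq> generate A (S \<union> lcs (Suc n))"
proof (induction n)
  case 0
  have TG: "T \<subseteq> G"
    by (subst gen) (rule generate_superset)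
  have "lcs 0 \<subseteq> generate A (T \<union> lcs (Suc 0))"
    unfolding lcs.simps(1) by (rule ord_eq_le_trans [OF gen mono_generate]) blast
  moreover have "\<forall>s\<in>T. \<exists>m>0. s [^] (m::nat) \<in> lcs (Suc 0)"
    using tors nsub_simps(4) [OF nsub_lcs] by metis
  ultimately show ?case
    using TG \<open>finite T\<close> by (metis lcs.simps(1))
next
  case (Suc n)
  have TG: "T \<subseteq> G"
    by (subst gen) (rule generate_superset)
  let ?N = "lcs (Suc (Suc n))"
  obtain S where S: "S \<subseteq> lcs n" "finite S" "lcs n \<subseteq> generate A (S \<union> lcs (Suc n))"
    using Suc by blast
  let ?S = "(\<lambda>(t, s). commutator t s) ` (T \<times> S)"
  let ?R = "generate A (?S \<union> ?N)"
  have SL: "?S \<subseteq> lcs (Suc n)"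
    using S(1) TG by (auto simp del: lcs.simps intro!: commutator_in_lcs)
  have gL: "?S \<union> ?N \<subseteq> lcs (Suc n)"
    using SL lcs_Suc_subset by blast
  have RL: "?R \<subseteq> lcs (Suc n)"
    by (rule generate_subgroup_incl [OF gL nsub_simps(1) [OF nsub_lcs]])
  have R: "subgroup ?R A"
    using gL nsub_simps(3) [OF nsub_lcs] by (intro generate_is_subgroup) blast
  have NR: "?N \<subseteq> ?R"
    using generate_superset [of "?S \<union> ?N"] by simp
  \<comment> \<open>\<open>?R\<close> lies between two consecutive terms, so \<open>[g, r]\<close>
    falls into \<open>?N\<close>; any subgroup in this range is normal.\<close>
  have conj: "g \<otimes> r \<otimes> inv g \<in> ?R" if "g \<in> G" "r \<in> ?R" for g r
  proof -
    have "commutator g r \<in> ?R"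
      using that RL NR commutator_in_lcs by blast
    then have "commutator g r \<otimes> r \<in> ?R"
      using that subgroup.m_closed [OF R] by blast
    moreover have "commutator g r \<otimes> r = g \<otimes> r \<otimes> inv g"
      using mem_carrier [OF that(1)] subgroup.mem_carrier [OF R that(2)] by (simp add: word_simps)
    ultimately show ?thesis
      by simp
  qed
  have nR: "nsub ?R"
    using R conj RL nsub_simps(2) [OF nsub_lcs] unfolding nsub_def by blast
  have "commutator t y \<in> ?R" if t: "t \<in> T" and y: "y \<in> S \<union> lcs (Suc n)" for t y
    using y
  proof
    assume "y \<in> S"
    then have "commutator t y \<in> ?S \<union> ?N"
      using t by force
    then show ?thesis
      by (rule generate.incl)
  next
    assume "y \<in> lcs (Suc n)"
    then show ?thesis
      using t TG NR commutator_in_lcs by blast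
  qed
  moreover have "S \<union> lcs (Suc n) \<subseteq> G"
    using S nsub_simps(2) [OF nsub_lcs] by blast
  ultimately have "commutator x y \<in> ?R" if "x \<in> G" "y \<in> lcs n" for x y
    using commutator_generate [OF nR TG] that gen S(3) by blast
  then have "lcs (Suc n) \<subseteq> ?R"
    using gcomm_least [OF R] by simp
  moreover have "\<exists>m>0. u [^] (m::nat) \<in> ?N" if u: "u \<in> ?S" for u
  proof -
    obtain t s where ts: "t \<in> T" "s \<in> S" "u = commutator t s"
      using u by auto
    obtain m where m: "m > 0" "t [^] (m::nat) = \<one>"
      using tors ts by blast
    have tG: "t \<in> G" "s \<in> lcs n" "t \<in> carrier A" "s \<in> carrier A"
      using ts TG S mem_carrier nsub_simps(3) [OF nsub_lcs] by auto
    have uG: "u \<in> lcs (Suc n)" "u \<in> carrier A"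
      using ts tG commutator_in_lcs by auto
    \<comment> \<open>\<open>z\<close> collects the error terms: every rearrangement of
      \<open>[t^(k+1), s]\<close> costs a commutator involving \<open>u\<close>, and these lie in
      \<open>?N\<close>.\<close>
    have "\<exists>z\<in>?N. u [^] k = z \<otimes> commutator (t [^] k) s" for k :: nat
    proof (induction k)
      case 0
      have "commutator \<one> s = \<one>"
        using tG by (simp add: commutator_def)
      then show ?case
        by (intro bexI [of _ \<one>]) (simp_all add: nsub_simps(4) [OF nsub_lcs] del: lcs.simps)
    next
      case (Suc k)
      then obtain z where z: "z \<in> ?N" "u [^] k = z \<otimes> commutator (t [^] k) s"
        by blast
      let ?w = "commutator (t [^] k) s"
      have tk: "t [^] k \<in> G" "?w \<in> carrier A" "z \<in> carrier A"
        using tG nsub_simps(3) [OF nsub_lcs z(1)] by simp_all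
      have c: "commutator (t [^] k) u \<in> ?N"
        using tk uG commutator_in_lcs by blast
      have "commutator (t [^] Suc k) s = t [^] k \<otimes> u \<otimes> inv (t [^] k) \<otimes> ?w"
        using tG ts(3) by (simp add: commutator_mult_left)
      also have "\<dots> = commutator (t [^] k) u \<otimes> u \<otimes> ?w"
        using tG uG by (simp add: word_simps)
      also have "\<dots> = commutator (t [^] k) u \<otimes> commutator u ?w \<otimes> ?w \<otimes> u"
        using tG uG tk by (simp add: word_simps)
      also have "\<dots> = commutator (t [^] k) u \<otimes> commutator u ?w \<otimes> inv z \<otimes> u [^] Suc k"
        using tG uG tk z(2) by (simp add: m_assoc)
      finally have eq: "commutator (t [^] Suc k) s =
        (commutator (t [^] k) u \<otimes> commutator u ?w \<otimes> inv z) \<otimes> u [^] Suc k" .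
      have "?w \<in> lcs (Suc n)"
        using tk tG commutator_in_lcs by blast
      then have e: "commutator u ?w \<in> ?N"
        using commutator_in_lcs uG nsub_simps(2) [OF nsub_lcs] by blast
      have cz: "commutator (t [^] k) u \<otimes> commutator u ?w \<otimes> inv z \<in> ?N" (is "?c \<in> _")
        by (intro nsub_simps(5) [OF nsub_lcs] nsub_simps(6) [OF nsub_lcs] c e z(1))
      then have "u [^] Suc k = inv ?c \<otimes> commutator (t [^] Suc k) s"
        unfolding eq using uG nsub_simps(3) [OF nsub_lcs cz] by (simp del: nat_pow_Suc)
      then show ?case
        using nsub_simps(6) [OF nsub_lcs cz] by blast
    qed
    from this [of m] obtain z where z: "z \<in> ?N" "u [^] m = z \<otimes> commutator \<one> s"
      unfolding m(2) by blast
    then have "u [^] m \<in> ?N"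
      using nsub_simps(3) [OF nsub_lcs z(1)] tG(4) by (simp add: commutator_def)
    then show ?thesis
      using m by blast
  qed
  ultimately show ?case
    using SL \<open>finite T\<close> \<open>finite S\<close> by (intro exI [of _ ?S]) auto
qed

lemma finite_cosets_lcs:
  assumes gen: "G = generate A T" and "finite T"
    and tors: "\<And>t. t \<in> T \<Longrightarrow> \<exists>m>0. t [^] (m::nat) = \<one>"
  shows "finite ((\<lambda>x. lcs n #> x) ` G)"
proof (induction n)
  case 0
  show ?case
    by (rule finite_cosets_invariant [where f = "\<lambda>_. ()"]) (auto simp: subgroup_G mem_carrier)
next
  case (Suc n)
  obtain S where S: "S \<subseteq> lcs n" "finite S" "\<And>s. s \<in> S \<Longrightarrow> \<exists>m>0. s [^] (m::nat) \<in> lcs (Suc n)"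
    "lcs n \<subseteq> generate A (S \<union> lcs (Suc n))"
    using lcs_generators [OF assms] by metis
  have "finite ((\<lambda>x. lcs (Suc n) #> x) ` generate A (S \<union> lcs (Suc n)))"
    using S lcs_Suc_subset commutator_in_lcs
    by (intro finite_cosets_abelian_extension [OF nsub_lcs nsub_lcs]) auto
  then have fN: "finite ((\<lambda>x. lcs (Suc n) #> x) ` lcs n)"
    using S(4) by (meson finite_subset image_mono)
  show ?case
    by (rule finite_cosets_trans [OF nsub_simps(1) [OF nsub_lcs] nsub_simps(1) [OF nsub_lcs] _ _ fN Suc])
      (use mem_carrier nsub_simps(2) [OF nsub_lcs] in auto)
qed

end

section \<open>Automorphisms and their sections\<close>

lemma tree_simps [simp]:
  "[] \<in> tree d"
  "i # w \<in> tree d \<longleftrightarrow> i < d \<and> w \<in> tree d"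
  "u @ w \<in> tree d \<longleftrightarrow> u \<in> tree d \<and> w \<in> tree d"
  by (auto simp: tree_def)

lemma replicate_in_tree [simp]: "i < d \<Longrightarrow> replicate n i \<in> tree d"
  by (induction n) auto

lemma tree_automorphism_apply:
  assumes "f \<in> tree_automorphisms d"
  shows "f \<in> Bij (tree d)" "f [] = []" "inj_on f (tree d)" "u \<in> tree d \<Longrightarrow> f u \<in> tree d"
    "u \<in> tree d \<Longrightarrow> v \<in> tree d \<Longrightarrow> adjacent (f u) (f v) \<longleftrightarrow> adjacent u v"
  using assms by (auto simp: tree_automorphisms_def Bij_def bij_betw_def)

text \<open>Adjacency alone would allow a child to be sent to the parent of the image. By induction
  that parent is the image of the word one letter shorter, so injectivity forbids it.\<close>

lemma tree_automorphism_snoc: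
  assumes f: "f \<in> tree_automorphisms d" and "u \<in> tree d" "i < d"
  shows "\<exists>j<d. f (u @ [i]) = f u @ [j]"
  using assms(2,3)
proof (induction u arbitrary: i rule: rev_induct)
  case Nil
  have "adjacent (f []) (f [i])"
    using Nil tree_automorphism_apply(5) [OF f, of "[]" "[i]"] by (simp add: adjacent_def)
  then obtain j where "f [i] = [j]"
    using tree_automorphism_apply(2) [OF f] by (auto simp: adjacent_def)
  moreover have "f [i] \<in> tree d"
    using Nil tree_automorphism_apply(4) [OF f] by simp
  ultimately show ?case
    using tree_automorphism_apply(2) [OF f] by auto
next
  case (snoc k u)
  have in_tree: "u @ [k] \<in> tree d" "(u @ [k]) @ [i] \<in> tree d"
    using snoc.prems by auto
  have "adjacent (u @ [k]) ((u @ [k]) @ [i])"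
    unfolding adjacent_def by blast
  then have adj: "adjacent (f (u @ [k])) (f ((u @ [k]) @ [i]))"
    using tree_automorphism_apply(5) [OF f in_tree] by simp
  obtain j where j: "f (u @ [k]) = f u @ [j]"
    using snoc by auto
  have "f ((u @ [k]) @ [i]) \<noteq> f u"
    using tree_automorphism_apply(3) [OF f] in_tree snoc.prems
    by (auto dest!: inj_onD)
  then obtain l where l: "f ((u @ [k]) @ [i]) = f (u @ [k]) @ [l]"
    using adj j by (auto simp: adjacent_def)
  moreover have "f ((u @ [k]) @ [i]) \<in> tree d"
    using in_tree tree_automorphism_apply(4) [OF f] by blast
  ultimately show ?case
    by auto
qed

text \<open>Preserving children gives both directions of adjacency: if \<open>f v\<close> is a child
  of \<open>f u\<close>, the parent \<open>w\<close> of \<open>v\<close> satisfies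
  \<open>f w = f u\<close>, hence \<open>w = u\<close>.\<close>

lemma tree_automorphismI:
  assumes "f \<in> extensional (tree d)" "bij_betw f (tree d) (tree d)" "f [] = []"
    and snoc: "\<And>u i. u \<in> tree d \<Longrightarrow> i < d \<Longrightarrow> \<exists>j. f (u @ [i]) = f u @ [j]"
  shows "f \<in> tree_automorphisms d"
proof -
  have inj: "f u = f v \<Longrightarrow> u \<in> tree d \<Longrightarrow> v \<in> tree d \<Longrightarrow> u = v" for u v
    using assms(2) by (auto simp: bij_betw_def inj_on_def)
  have "\<exists>j. v = u @ [j]" if "f v = f u @ [i]" "u \<in> tree d" "v \<in> tree d" for u v i
  proof (cases v rule: rev_cases)
    case Nil
    then show ?thesis
      using that assms(3) by auto
  next
    case (snoc w k)
    then have "w \<in> tree d" "k < d"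
      using that by auto
    then obtain j where "f v = f w @ [j]"
      using assms(4) snoc by blast
    then have "f w = f u"
      using that by simp
    then show ?thesis
      using inj \<open>w \<in> tree d\<close> that snoc by blast
  qed
  moreover have "\<exists>j. f v = f u @ [j]" if "v = u @ [i]" "u \<in> tree d" "v \<in> tree d" for u v i
    using that snoc by auto
  ultimately have "adjacent (f u) (f v) \<longleftrightarrow> adjacent u v" if "u \<in> tree d" "v \<in> tree d" for u v
    unfolding adjacent_def using that by meson
  then show ?thesis
    using assms by (auto simp: tree_automorphisms_def Bij_def)
qed

lemma subgroup_tree_automorphisms: "subgroup (tree_automorphisms d) (BijGroup (tree d))"
proof (rule group.subgroupI [OF group_BijGroup])
  show "tree_automorphisms d \<subseteq> carrier (BijGroup (tree d))"
    by (auto simp: tree_automorphisms_def BijGroup_def)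
  have "(\<lambda>w\<in>tree d. w) \<in> tree_automorphisms d"
    by (rule tree_automorphismI) (auto simp: bij_betw_def inj_on_def)
  then show "tree_automorphisms d \<noteq> {}"
    by blast
next
  fix f assume f: "f \<in> tree_automorphisms d"
  define g where "g = (\<lambda>w\<in>tree d. inv_into (tree d) f w)"
  have B: "f \<in> Bij (tree d)"
    using f tree_automorphism_apply by blast
  then have g: "inv\<^bsub>BijGroup (tree d)\<^esub> f = g"
    unfolding g_def by (rule inv_BijGroup)
  have gB: "g \<in> Bij (tree d)"
    unfolding g_def using B by (rule restrict_inv_into_Bij)
  have fg: "f (g w) = w" "g w \<in> tree d" if "w \<in> tree d" for w
    using that B by (auto simp: g_def Bij_def bij_betw_def f_inv_into_f inv_into_into)
  have "g [] = []"
    using fg [of "[]"] tree_automorphism_apply(2,3) [OF f] by (metis inj_onD tree_simps(1))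
  moreover have "adjacent (g u) (g v) \<longleftrightarrow> adjacent u v" if "u \<in> tree d" "v \<in> tree d" for u v
    using tree_automorphism_apply(5) [OF f fg(2) [OF that(1)] fg(2) [OF that(2)]] fg(1) that by simp
  ultimately show "inv\<^bsub>BijGroup (tree d)\<^esub> f \<in> tree_automorphisms d"
    unfolding g using gB by (simp add: tree_automorphisms_def)
next
  fix f g assume f: "f \<in> tree_automorphisms d" and g: "g \<in> tree_automorphisms d"
  have B: "f \<in> Bij (tree d)" "g \<in> Bij (tree d)"
    using f g tree_automorphism_apply by blast+
  have "compose (tree d) f g \<in> tree_automorphisms d"
    using tree_automorphism_apply [OF f] tree_automorphism_apply [OF g] compose_Bij [OF B]
    by (simp add: tree_automorphisms_def compose_def)
  then show "f \<otimes>\<^bsub>BijGroup (tree d)\<^esub> g \<in> tree_automorphisms d"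
    using B by (simp add: BijGroup_def)
qed

lemma group_AutT: "group (AutT d)"
  unfolding AutT_def by (rule subgroup.subgroup_is_group [OF subgroup_tree_automorphisms group_BijGroup])

lemma carrier_AutT: "carrier (AutT d) = tree_automorphisms d"
  by (simp add: AutT_def)

text \<open>The right inverse of \<open>restr d v\<close>; it embeds Aut(T) as the rigid stabilizer
  of \<open>v\<close>.\<close>

definition ins :: "nat \<Rightarrow> nat list \<Rightarrow> (nat list \<Rightarrow> nat list) \<Rightarrow> nat list \<Rightarrow> nat list" where
  "ins d v g = (\<lambda>w\<in>tree d. if prefix v w then v @ g (drop (length v) w) else w)"

section \<open>Calculus of sections and inserted automorphisms\<close>

locale regular_tree =
  fixes d :: nat and A (structure)
  assumes A_def: "A = AutT d"
begin

sublocale group A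
  unfolding A_def by (rule group_AutT)

abbreviation "T \<equiv> tree d"
abbreviation "sec \<equiv> restr d"
abbreviation "inj_at \<equiv> ins d"

lemma carrier_iff: "g \<in> carrier A \<longleftrightarrow> g \<in> tree_automorphisms d"
  by (simp add: A_def carrier_AutT)

lemma apply_in_tree [simp]: "g \<in> carrier A \<Longrightarrow> w \<in> T \<Longrightarrow> g w \<in> T"
  by (simp add: carrier_iff tree_automorphism_apply)

lemma apply_Nil [simp]: "g \<in> carrier A \<Longrightarrow> g [] = []"
  by (simp add: carrier_iff tree_automorphism_apply)

lemma apply_inj: "g \<in> carrier A \<Longrightarrow> u \<in> T \<Longrightarrow> v \<in> T \<Longrightarrow> g u = g v \<longleftrightarrow> u = v"
  using tree_automorphism_apply(3) [of g d] by (auto simp: carrier_iff inj_on_def)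

lemma apply_mult [simp]:
  assumes "g \<in> carrier A" "h \<in> carrier A" "w \<in> T"
  shows "(g \<otimes> h) w = g (h w)"
proof -
  have "g \<in> Bij T" "h \<in> Bij T"
    using assms tree_automorphism_apply(1) by (auto simp: carrier_iff)
  then show ?thesis
    using assms(3) by (simp add: A_def AutT_def BijGroup_def compose_def)
qed

lemma apply_one [simp]: "w \<in> T \<Longrightarrow> \<one> w = w"
  by (simp add: A_def AutT_def BijGroup_def)

lemma aut_eqI:
  assumes "g \<in> carrier A" "h \<in> carrier A" "\<And>w. w \<in> T \<Longrightarrow> g w = h w"
  shows "g = h"
  using assms tree_automorphism_apply(1) [of _ d]
  by (auto simp: carrier_iff Bij_def intro: extensionalityI)

lemma apply_inv [simp]:
  assumes "g \<in> carrier A" "w \<in> T"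
  shows "(inv g) (g w) = w" "g ((inv g) w) = w"
  using assms apply_mult [of "inv g" g w] apply_mult [of g "inv g" w] by auto

lemma inv_fixes: "g \<in> carrier A \<Longrightarrow> w \<in> T \<Longrightarrow> g w = w \<Longrightarrow> (inv g) w = w"
  using apply_inv(1) [of g w] by simp

lemma length_apply [simp]:
  assumes "g \<in> carrier A" "w \<in> T"
  shows "length (g w) = length w"
  using assms(2)
proof (induction w rule: rev_induct)
  case Nil
  then show ?case
    using assms by simp
next
  case (snoc i w)
  then obtain j where "g (w @ [i]) = g w @ [j]"
    using assms(1) tree_automorphism_snoc [of g d w i] by (auto simp: carrier_iff)
  then show ?case
    using snoc by simp
qed

lemma prefix_apply:
  assumes "g \<in> carrier A" "v \<in> T" "w \<in> T"
  shows "prefix (g v) (g (v @ w))"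
  using assms(3)
proof (induction w rule: rev_induct)
  case Nil
  then show ?case
    by simp
next
  case (snoc i w)
  then obtain j where "g ((v @ w) @ [i]) = g (v @ w) @ [j]"
    using assms tree_automorphism_snoc [of g d "v @ w" i] by (auto simp: carrier_iff)
  then show ?case
    using snoc by simp
qed

text \<open>\<open>g\<close> preserves lengths, so dropping \<open>length v\<close> letters removes
  exactly \<open>g v\<close>, also when \<open>g\<close> moves \<open>v\<close>. Thus
  \<open>restr\<close> yields the section of any automorphism, and \<open>sec_mult\<close> is a
  cocycle rule.\<close>

lemma apply_append:
  assumes "g \<in> carrier A" "v \<in> T" "w \<in> T"
  shows "g (v @ w) = g v @ sec v g w"
  using prefix_apply [OF assms] assms by (auto simp: restr_def prefix_def)

lemma sec_apply_in_tree: "g \<in> carrier A \<Longrightarrow> v \<in> T \<Longrightarrow> w \<in> T \<Longrightarrow> sec v g w \<in> T"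
  using apply_append [of g v w] apply_in_tree [of g "v @ w"] by simp

lemma prefix_apply_iff:
  assumes "g \<in> carrier A" "u \<in> T" "v \<in> T"
  shows "prefix (g u) (g v) \<longleftrightarrow> prefix u v"
proof
  assume "prefix u v"
  then show "prefix (g u) (g v)"
    using assms prefix_apply [of g u] by (auto elim!: prefixE)
next
  assume *: "prefix (g u) (g v)"
  then obtain w where w: "g v = g u @ w"
    by (auto elim: prefixE)
  then have "w \<in> T"
    using assms apply_in_tree [of g v] by simp
  then have "prefix ((inv g) (g u)) ((inv g) (g v))"
    unfolding w using assms prefix_apply [of "inv g" "g u" w] by simp
  then show "prefix u v"
    using assms by simp
qed

lemma ins_apply: "v \<in> T \<Longrightarrow> w \<in> T \<Longrightarrow> inj_at v g (v @ w) = v @ g w"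
  by (simp add: ins_def)

lemma ins_apply_off: "w \<in> T \<Longrightarrow> \<not> prefix v w \<Longrightarrow> inj_at v g w = w"
  by (simp add: ins_def)

lemma ins_cases:
  assumes "w \<in> T"
  obtains w' where "w = v @ w'" "w' \<in> T" | "\<not> prefix v w" "w \<in> T"
proof (cases "prefix v w")
  case True
  then show ?thesis
    using assms that(1) by (auto elim!: prefixE)
next
  case False
  then show ?thesis
    using assms that(2) by blast
qed

lemma ins_apply_self [simp]: "g \<in> carrier A \<Longrightarrow> v \<in> T \<Longrightarrow> inj_at v g v = v"
  by (simp add: ins_def)

lemma ins_apply_cancel:
  assumes "v \<in> T" "w \<in> T" "\<And>w. w \<in> T \<Longrightarrow> h w \<in> T" "\<And>w. w \<in> T \<Longrightarrow> g (h w) = w"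
  shows "inj_at v g (inj_at v h w) = w" "inj_at v h w \<in> T"
  using assms by (auto simp: ins_def elim!: prefixE)

lemma ins_closed [simp]:
  assumes "g \<in> carrier A" "v \<in> T"
  shows "inj_at v g \<in> carrier A"
  unfolding carrier_iff
proof (rule tree_automorphismI)
  show "inj_at v g \<in> extensional T"
    by (simp add: ins_def)
  show "bij_betw (inj_at v g) T T"
    by (rule bij_betwI [where g = "inj_at v (inv g)"])
      (use assms ins_apply_cancel [of v _ "inv g" g] ins_apply_cancel [of v _ g "inv g"] in auto)
  show "inj_at v g [] = []"
    using assms by (auto simp: ins_def)
next
  fix u i assume u: "u \<in> T" "i < d"
  show "\<exists>j. inj_at v g (u @ [i]) = inj_at v g u @ [j]"
  proof (cases "prefix v u")
    case True
    then obtain w where w: "u = v @ w"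
      by (auto elim: prefixE)
    then have "\<exists>j<d. g (w @ [i]) = g w @ [j]"
      using u assms tree_automorphism_snoc [of g d w i] by (auto simp: carrier_iff)
    then show ?thesis
      using w u assms ins_apply [of v w g] ins_apply [of v "w @ [i]" g] by auto
  next
    case False
    \<comment> \<open>The boundary case: \<open>u\<close> lies outside the subtree, but its child
      may be the root \<open>v\<close> of it, which the inserted automorphism fixes.\<close>
    show ?thesis
    proof (cases "v = u @ [i]")
      case True
      then show ?thesis
        using False u assms ins_apply_off [of u v g] by simp
    next
      case F: False
      then have "\<not> prefix v (u @ [i])"
        using False by auto
      then show ?thesis
        using False u ins_apply_off [of _ v g] by simp
    qed
  qed
qed

lemma sec_closed [simp]:
  assumes "g \<in> carrier A" "v \<in> T"
  shows "sec v g \<in> carrier A"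
  unfolding carrier_iff
proof (rule tree_automorphismI)
  show "sec v g \<in> extensional T"
    by (simp add: restr_def)
  have in_tree: "sec v g w \<in> T" "sec (g v) (inv g) w \<in> T" if "w \<in> T" for w
    using assms that sec_apply_in_tree by auto
  have 1: "sec (g v) (inv g) (sec v g w) = w" if "w \<in> T" for w
  proof -
    have "v @ w = (inv g) (g v @ sec v g w)"
      using assms that apply_append [of g v w] apply_inv(1) [of g "v @ w"] by simp
    also have "\<dots> = v @ sec (g v) (inv g) (sec v g w)"
      using assms that in_tree apply_append [of "inv g" "g v" "sec v g w"] by simp
    finally show ?thesis
      by simp
  qed
  have 2: "sec v g (sec (g v) (inv g) w) = w" if "w \<in> T" for w
  proof -
    have "g v @ w = g ((inv g) (g v @ w))"
      using assms that by simp
    also have "\<dots> = g (v @ sec (g v) (inv g) w)"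
      using assms that apply_append [of "inv g" "g v" w] by simp
    also have "\<dots> = g v @ sec v g (sec (g v) (inv g) w)"
      using assms that in_tree apply_append by simp
    finally show ?thesis
      by simp
  qed
  show "bij_betw (sec v g) T T"
    by (rule bij_betwI [where g = "sec (g v) (inv g)"]) (use in_tree 1 2 in auto)
  show "sec v g [] = []"
    using apply_append [OF assms, of "[]"] by simp
next
  fix u i assume u: "u \<in> T" "i < d"
  then have "v @ u \<in> T"
    using assms by simp
  then obtain j where "g ((v @ u) @ [i]) = g (v @ u) @ [j]"
    using assms u tree_automorphism_snoc [of g d "v @ u" i] by (auto simp: carrier_iff)
  then have "g v @ sec v g (u @ [i]) = g v @ sec v g u @ [j]"
    using assms u apply_append [of g v u] apply_append [of g v "u @ [i]"] by simp
  then show "\<exists>j. sec v g (u @ [i]) = sec v g u @ [j]"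
    by simp
qed

lemma sec_eqI:
  assumes "g \<in> carrier A" "v \<in> T" "h \<in> carrier A" "\<And>w. w \<in> T \<Longrightarrow> g (v @ w) = g v @ h w"
  shows "sec v g = h"
  using assms apply_append [of g v] by (intro aut_eqI) auto

lemma sec_Nil [simp]: "g \<in> carrier A \<Longrightarrow> sec [] g = g"
  by (rule sec_eqI) auto

lemma sec_one [simp]: "v \<in> T \<Longrightarrow> sec v \<one> = \<one>"
  by (rule sec_eqI) auto

lemma sec_mult [simp]:
  assumes "g \<in> carrier A" "h \<in> carrier A" "v \<in> T"
  shows "sec v (g \<otimes> h) = sec (h v) g \<otimes> sec v h"
  using assms apply_append [of h v] apply_append [of g "h v"]
  by (intro sec_eqI) (auto simp: sec_apply_in_tree)

lemma sec_inv:
  assumes "g \<in> carrier A" "v \<in> T"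
  shows "sec (g v) (inv g) = inv (sec v g)"
proof -
  have "sec (g v) (inv g) \<otimes> sec v g = sec v (inv g \<otimes> g)"
    using assms by (intro sec_mult [symmetric]) auto
  then show ?thesis
    using assms by (intro inv_equality [symmetric]) auto
qed

lemma sec_inv_fixed: "g \<in> carrier A \<Longrightarrow> v \<in> T \<Longrightarrow> g v = v \<Longrightarrow> sec v (inv g) = inv (sec v g)"
  using sec_inv [of g v] by simp

lemma sec_append:
  assumes "g \<in> carrier A" "u \<in> T" "v \<in> T"
  shows "sec (u @ v) g = sec v (sec u g)"
  using assms apply_append [of g u] apply_append [of "sec u g" v]
  by (intro sec_eqI) auto

lemma ins_sec [simp]:
  assumes "g \<in> carrier A" "v \<in> T"
  shows "sec v (inj_at v g) = g"
  using assms by (intro sec_eqI) (auto simp: ins_apply)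

lemma ins_one [simp]: "v \<in> T \<Longrightarrow> inj_at v \<one> = \<one>"
proof (rule aut_eqI)
  assume v: "v \<in> T"
  fix w assume "w \<in> T"
  then show "inj_at v \<one> w = \<one> w"
  proof (cases rule: ins_cases [of w v])
    case (1 w')
    then show ?thesis
      using v by (simp add: ins_apply)
  next
    case 2
    then show ?thesis
      by (simp add: ins_apply_off)
  qed
qed auto

lemma ins_mult:
  assumes "g \<in> carrier A" "h \<in> carrier A" "v \<in> T"
  shows "inj_at v (g \<otimes> h) = inj_at v g \<otimes> inj_at v h"
proof (rule aut_eqI)
  fix w assume "w \<in> T"
  then show "inj_at v (g \<otimes> h) w = (inj_at v g \<otimes> inj_at v h) w"
  proof (cases rule: ins_cases [of w v])
    case (1 w')
    then show ?thesis
      using assms by (simp add: ins_apply)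
  next
    case 2
    then show ?thesis
      using assms by (simp add: ins_apply_off)
  qed
qed (use assms in auto)

lemma ins_inv:
  assumes "g \<in> carrier A" "v \<in> T"
  shows "inj_at v (inv g) = inv (inj_at v g)"
  using assms ins_mult [of "inv g" g v] by (intro inv_equality [symmetric]) auto

lemma ins_inject:
  assumes "g \<in> carrier A" "h \<in> carrier A" "v \<in> T" "inj_at v g = inj_at v h"
  shows "g = h"
  using ins_sec assms by metis

lemma ins_append:
  assumes "g \<in> carrier A" "u \<in> T" "v \<in> T"
  shows "inj_at (u @ v) g = inj_at u (inj_at v g)"
proof (rule aut_eqI)
  fix w assume w: "w \<in> T"
  then show "inj_at (u @ v) g w = inj_at u (inj_at v g) w"
  proof (cases rule: ins_cases [of w u])
    case (1 w')
    have "inj_at (u @ v) g (u @ w') = inj_at u (inj_at v g) (u @ w')"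
      using 1(2)
    proof (cases rule: ins_cases [of w' v])
      case (1 w'')
      then show ?thesis
        using assms ins_apply [of "u @ v" w'' g] by (simp add: ins_apply)
    next
      case 2
      then show ?thesis
        using assms 1 by (simp add: ins_apply ins_apply_off)
    qed
    then show ?thesis
      using 1 by simp
  next
    case 2
    then have "\<not> prefix (u @ v) w"
      using append_prefixD by blast
    then show ?thesis
      using 2 w by (simp add: ins_apply_off)
  qed
qed (use assms in auto)

text \<open>\<open>x\<close> maps the cone of \<open>v\<close> onto that of \<open>x v\<close>,
  acting there through its section, and preserves the complement. Most later normality and transport
  arguments are instances of this formula.\<close>

lemma conj_ins:
  assumes "x \<in> carrier A" "g \<in> carrier A" "v \<in> T"
  shows "x \<otimes> inj_at v g \<otimes> inv x = inj_at (x v) (sec v x \<otimes> g \<otimes> inv (sec v x))"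
proof -
  let ?h = "sec v x \<otimes> g \<otimes> inv (sec v x)"
  have "x \<otimes> inj_at v g = inj_at (x v) ?h \<otimes> x"
  proof (rule aut_eqI)
    fix w assume w: "w \<in> T"
    show "(x \<otimes> inj_at v g) w = (inj_at (x v) ?h \<otimes> x) w"
    proof (cases "prefix v w")
      case True
      then obtain u where "w = v @ u" "u \<in> T"
        using w by (auto elim!: prefixE)
      then show ?thesis
        using assms by (simp add: ins_apply apply_append)
    next
      case False
      then show ?thesis
        using assms w prefix_apply_iff [of x v w] by (simp add: ins_apply_off)
    qed
  qed (use assms in auto)
  then show ?thesis
    using assms by (simp add: m_assoc)
qed

lemma ins_fixes_incomparable:
  assumes "u \<in> T" "\<not> prefix v u"
  shows "inj_at v g u = u"
  using assms ins_apply_off by blast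

lemma ins_apply_incomparable:
  assumes "u \<in> T" "w \<in> T" "\<not> prefix v u" "\<not> prefix u v"
  shows "inj_at v g (u @ w) = u @ w"
proof -
  have "\<not> prefix v (u @ w)"
    using assms(3,4) prefix_same_cases [of v "u @ w" u] by auto
  then show ?thesis
    using assms ins_apply_off [of "u @ w" v g] by simp
qed

lemma sec_ins_incomparable:
  assumes "g \<in> carrier A" "u \<in> T" "v \<in> T" "\<not> prefix v u" "\<not> prefix u v"
  shows "sec u (inj_at v g) = \<one>"
  using assms ins_fixes_incomparable ins_apply_incomparable by (intro sec_eqI) auto

lemma ins_commute:
  assumes "g \<in> carrier A" "h \<in> carrier A" "u \<in> T" "v \<in> T" "\<not> prefix v u" "\<not> prefix u v"
  shows "inj_at u g \<otimes> inj_at v h = inj_at v h \<otimes> inj_at u g"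
proof -
  have "inj_at u g \<otimes> inj_at v h \<otimes> inv (inj_at u g) = inj_at v h"
    using conj_ins [of "inj_at u g" h v] assms
    by (simp add: sec_ins_incomparable ins_fixes_incomparable)
  moreover have "inj_at u g \<otimes> inj_at v h = (inj_at u g \<otimes> inj_at v h \<otimes> inv (inj_at u g)) \<otimes> inj_at u g"
    using assms by (simp add: m_assoc)
  ultimately show ?thesis
    by simp
qed

section \<open>Assembling automorphisms from incomparable vertices and levels\<close>

lemma set_mult_iff: "x \<in> set_mult A X Y \<longleftrightarrow> (\<exists>a\<in>X. \<exists>b\<in>Y. x = a \<otimes> b)"
  by (auto simp: set_mult_def)

lemma product_of_subgroups_Nil [simp]: "product_of_subgroups d [] = {\<one>}"
  by (simp add: product_of_subgroups_def A_def)

lemma product_of_subgroups_Cons [simp]: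
  "product_of_subgroups d (X # Xs) = set_mult A X (product_of_subgroups d Xs)"
  by (simp add: product_of_subgroups_def A_def)

lemma product_of_subgroups_subset:
  assumes "subgroup H A" "\<And>X. X \<in> set Xs \<Longrightarrow> X \<subseteq> H"
  shows "product_of_subgroups d Xs \<subseteq> H"
  using assms(2)
proof (induction Xs)
  case Nil
  then show ?case
    using subgroup.one_closed [OF assms(1)] by simp
next
  case (Cons X Xs)
  then have "X \<subseteq> H" "product_of_subgroups d Xs \<subseteq> H"
    by auto
  then show ?case
    using subgroup.m_closed [OF assms(1)] by (auto simp: set_mult_iff subset_iff)
qed

text \<open>Support contained in the cones over \<open>V\<close>. The vertices of \<open>V\<close>
  are treated separately because each has itself as a prefix in \<open>V\<close>.\<close>

definition trivial_off :: "nat list set \<Rightarrow> (nat list \<Rightarrow> nat list) \<Rightarrow> bool" where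
  "trivial_off V x \<longleftrightarrow> (\<forall>v\<in>V. x v = v) \<and> (\<forall>w\<in>T. (\<forall>v\<in>V. \<not> prefix v w) \<longrightarrow> x w = w)"

text \<open>Dividing \<open>x\<close> by the copy of its section at \<open>u\<close> makes it
  trivial below \<open>u\<close> and leaves the sections at the other, incomparable vertices
  unchanged; induction removes one vertex at a time.\<close>

lemma product_of_subgroups_mem:
  assumes x: "x \<in> carrier A" and us: "distinct us" "set us \<subseteq> T"
    "pairwise (\<lambda>u v. \<not> prefix u v \<and> \<not> prefix v u) (set us)"
    and triv: "trivial_off (set us) x"
    and X: "\<And>u. u \<in> set us \<Longrightarrow> inj_at u (sec u x) \<in> X u"
  shows "x \<in> product_of_subgroups d (map X us)"
  using assms
proof (induction us arbitrary: x)
  case Nil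
  then have "x = \<one>"
    by (intro aut_eqI) (auto simp: trivial_off_def)
  then show ?case
    by simp
next
  case (Cons u us)
  let ?i = "inj_at u (sec u x)"
  let ?y = "inv ?i \<otimes> x"
  have u: "u \<in> T" "x u = u" "?i \<in> carrier A" "sec u x \<in> carrier A" "x \<in> carrier A"
    using Cons.prems by (auto simp: trivial_off_def)
  have inv: "inv ?i = inj_at u (inv (sec u x))"
    using u ins_inv by simp
  have inc: "\<not> prefix u v" "\<not> prefix v u" "v \<in> T" "x v = v" if "v \<in> set us" for v
    using Cons.prems that by (auto simp: pairwise_insert trivial_off_def)
  have sec: "sec v ?y = sec v x" "?y v = v" if "v \<in> set us" for v
    using inc [OF that] u unfolding inv by (simp_all add: sec_ins_incomparable ins_fixes_incomparable)
  have "trivial_off (set us) ?y"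
    unfolding trivial_off_def
  proof (intro conjI ballI impI)
    fix w assume w: "w \<in> T" "\<forall>v\<in>set us. \<not> prefix v w"
    show "?y w = w"
    proof (cases "prefix u w")
      case True
      then obtain w' where "w = u @ w'" "w' \<in> T"
        using w by (auto elim!: prefixE)
      then show ?thesis
        using u sec_apply_in_tree [of x u w'] unfolding inv
        by (simp add: apply_append [of x] ins_apply)
    next
      case False
      then have "x w = w"
        using Cons.prems w by (auto simp: trivial_off_def)
      then show ?thesis
        using u w False unfolding inv by (simp add: ins_apply_off)
    qed
  qed (use sec in auto)
  then have "?y \<in> product_of_subgroups d (map X us)"
    using Cons.prems u sec by (intro Cons.IH) (auto simp: pairwise_insert)
  moreover have "x = ?i \<otimes> ?y"
    using u by simp
  moreover have "?i \<in> X u"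
    using Cons.prems by simp
  ultimately show ?case
    by (auto simp: set_mult_iff)
qed

lemma mem_of_ins_mem:
  assumes "x \<in> carrier A" "finite V" "V \<subseteq> T"
    "pairwise (\<lambda>u v. \<not> prefix u v \<and> \<not> prefix v u) V"
    "trivial_off V x" "subgroup H A" "\<And>v. v \<in> V \<Longrightarrow> inj_at v (sec v x) \<in> H"
  shows "x \<in> H"
proof -
  obtain us where us: "set us = V" "distinct us"
    using finite_distinct_list \<open>finite V\<close> by blast
  then have "x \<in> product_of_subgroups d (map (\<lambda>_. H) us)"
    using assms by (intro product_of_subgroups_mem) auto
  then show ?thesis
    using product_of_subgroups_subset [OF assms(6), of "map (\<lambda>_. H) us"] by auto
qed

definition level :: "nat \<Rightarrow> nat list set" where
  "level n = {w \<in> T. length w = n}"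

lemma level_subset: "level n \<subseteq> T"
  by (auto simp: level_def)

lemma finite_level [simp]: "finite (level n)"
proof -
  have "level n = {w. set w \<subseteq> {..<d} \<and> length w = n}"
    by (auto simp: level_def tree_def)
  then show ?thesis
    using finite_lists_length_eq [of "{..<d}" n] by simp
qed

lemma level_prefix_iff: "u \<in> level n \<Longrightarrow> v \<in> level n \<Longrightarrow> prefix u v \<longleftrightarrow> u = v"
  by (auto simp: level_def prefix_def)

lemma pairwise_level:
  "V \<subseteq> level n \<Longrightarrow> pairwise (\<lambda>u v. \<not> prefix u v \<and> \<not> prefix v u) V"
  unfolding pairwise_def using level_prefix_iff [where n = n] by blast

lemma apply_level [simp]: "g \<in> carrier A \<Longrightarrow> g w \<in> level n \<longleftrightarrow> w \<in> level n" if "w \<in> T"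
  using that by (simp add: level_def)

lemma trivial_off_level:
  assumes "x \<in> carrier A" "\<And>u. u \<in> level n \<Longrightarrow> x u = u"
  shows "trivial_off (level n) x"
proof -
  have "x w = w" if w: "w \<in> T" "\<forall>v\<in>level n. \<not> prefix v w" for w
  \<comment> \<open>For \<open>d > 0\<close> a word above level \<open>n\<close> is padded with
    zeros to a fixed word of level \<open>n\<close>; with no letters available only the root
    exists.\<close>
  proof (cases "d = 0")
    case True
    then have "w = []"
      using w by (cases w) auto
    then show ?thesis
      using assms by simp
  next
    case False
    have "length w < n"
    proof (rule ccontr)
      assume "\<not> length w < n"
      then have "take n w \<in> level n"
        using w(1) by (auto simp: level_def tree_def dest: in_set_takeD)
      then show False
        using w(2) take_is_prefix by blast
    qed
    let ?r = "replicate (n - length w) 0"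
    have "w @ ?r \<in> level n"
      using \<open>length w < n\<close> w False by (simp add: level_def)
    then have "x (w @ ?r) = w @ ?r"
      using assms by blast
    then show ?thesis
      using apply_append [of x w ?r] assms(1) w(1) False by simp
  qed
  then show ?thesis
    using assms by (auto simp: trivial_off_def)
qed

lemma level_eqI:
  assumes "g \<in> carrier A" "h \<in> carrier A" "\<And>u. u \<in> level n \<Longrightarrow> g u = h u"
    "\<And>u. u \<in> level n \<Longrightarrow> sec u g = sec u h"
  shows "g = h"
proof -
  have fixed: "(inv g \<otimes> h) u = u" if "u \<in> level n" for u
  proof -
    have "u \<in> T" "h u = g u"
      using that assms(3) by (auto simp: level_def)
    then show ?thesis
      using assms(1,2) by simp
  qed
  have "inv g \<otimes> h \<in> {\<one>}"
  proof (rule mem_of_ins_mem)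
    show "trivial_off (level n) (inv g \<otimes> h)"
      using assms fixed by (intro trivial_off_level) auto
    show "subgroup {\<one>} A"
      by (rule triv_subgroup)
    fix v assume v: "v \<in> level n"
    then have vT: "v \<in> T"
      by (simp add: level_def)
    have "sec v (inv g \<otimes> h) = sec (g v) (inv g) \<otimes> sec v h"
      using assms vT v by simp
    then have "sec v (inv g \<otimes> h) = \<one>"
      using assms(1,2,4) vT v by (simp add: sec_inv)
    then show "inj_at v (sec v (inv g \<otimes> h)) \<in> {\<one>}"
      using vT by simp
  qed (simp_all add: assms pairwise_level [OF order_refl] level_subset)
  then have 1: "inv g \<otimes> h = \<one>"
    by simp
  have "h = g \<otimes> (inv g \<otimes> h)"
    using assms by simp
  then show ?thesis
    unfolding 1 using assms by simp
qed

text \<open>\<open>K\<close> supplies the representatives, while the cosets are formed with the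
  multiplication of \<open>A\<close>; every index becomes a count of cosets in the ambient
  group.\<close>

lemma finite_index_iff: "finite_index d K H \<longleftrightarrow> finite ((\<lambda>x. H #> x) ` K)"
proof -
  have "rcosets\<^bsub>(AutT d)\<lparr>carrier := K\<rparr>\<^esub> H = (\<lambda>x. H #> x) ` K"
    by (auto simp: RCOSETS_def r_coset_def A_def)
  then show ?thesis
    by (simp add: finite_index_def)
qed

end

section \<open>Weakly maximal subgroups of regular branch groups\<close>

text \<open>The index condition concerns \<open>gcomm K\<close>, because
  \<open>nsub_contains_level\<close> recovers copies of \<open>[G, K]\<close>; it implies the one
  for \<open>K\<close>. Regular branching appears as \<open>ins_K\<close>, in terms of inserted
  copies.\<close>

locale branch_setup = regular_tree d A + subgroup_pair A G
  for d :: nat and A (structure) and G :: "(nat list \<Rightarrow> nat list) set" +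
  fixes K :: "(nat list \<Rightarrow> nat list) set" and x0 :: "nat list"
  assumes d_ge_2: "2 \<le> d"
    and self_similar: "g \<in> G \<Longrightarrow> v \<in> T \<Longrightarrow> sec v g \<in> G"
    and level_transitive: "u \<in> T \<Longrightarrow> v \<in> T \<Longrightarrow> length u = length v \<Longrightarrow> \<exists>g\<in>G. g u = v"
    and nsub_K: "nsub K"
    and ins_K: "v \<in> T \<Longrightarrow> k \<in> K \<Longrightarrow> inj_at v k \<in> K"
    and finite_cosets_M: "finite ((\<lambda>x. gcomm K #> x) ` G)"
    and x0: "x0 \<in> T"
    and K_onto: "g \<in> G \<Longrightarrow> \<exists>k\<in>K. k x0 = x0 \<and> sec x0 k = g"
begin

lemmas K_simps = nsub_simps(2-6) [OF nsub_K]

lemma nsub_M: "nsub (gcomm K)"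
  by (rule nsub_gcomm [OF nsub_K])

lemma M_subset: "gcomm K \<subseteq> K"
  by (rule gcomm_subset [OF nsub_K])

lemma ins_in_G: "v \<in> T \<Longrightarrow> k \<in> K \<Longrightarrow> inj_at v k \<in> G"
  by (intro K_simps(1) ins_K)

lemma finite_cosets_K: "finite ((\<lambda>x. K #> x) ` G)"
proof -
  obtain F where F: "F \<subseteq> G" "finite F" "\<And>x. x \<in> G \<Longrightarrow> \<exists>f\<in>F. x \<otimes> inv f \<in> gcomm K"
    using finite_cosets_M finite_cosets_iff [OF nsub_simps(1) [OF nsub_M] subgroup.subset [OF subgroup_G]]
    by blast
  then have "\<exists>f\<in>F. x \<otimes> inv f \<in> K" if "x \<in> G" for x
    using M_subset that by blast
  then show ?thesis
    using F(1,2) finite_cosets_iff [OF nsub_simps(1) [OF nsub_K] subgroup.subset [OF subgroup_G]]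
    by blast
qed

lemma subgroup_of_iff: "subgroup_of d L H \<longleftrightarrow> subgroup H A \<and> H \<subseteq> L"
  by (simp add: subgroup_of_def A_def)

lemma infinite_G: "infinite G"
proof
  assume fin: "finite G"
  \<comment> \<open>Level-transitivity gives at least as many elements as vertices on any level;
    level \<open>card G\<close> already has \<open>d ^ n > n\<close> vertices.\<close>
  define n where "n = card G"
  have z: "replicate n 0 \<in> T"
    using d_ge_2 by simp
  have "level n \<subseteq> (\<lambda>g. g (replicate n 0)) ` G"
  proof
    fix u assume "u \<in> level n"
    then have "\<exists>g\<in>G. g (replicate n 0) = u"
      using z by (intro level_transitive) (auto simp: level_def)
    then show "u \<in> (\<lambda>g. g (replicate n 0)) ` G"
      by blast
  qed
  then have "card (level n) \<le> n"
    unfolding n_def using fin by (meson card_image_le card_mono finite_imageI le_trans)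
  moreover have "level n = {w. set w \<subseteq> {..<d} \<and> length w = n}"
    by (auto simp: level_def tree_def)
  then have "card (level n) = d ^ n"
    using card_lists_length_eq [of "{..<d}" n] by simp
  moreover have "n < 2 ^ n" "2 ^ n \<le> d ^ n"
    using d_ge_2 by (auto simp: power_mono)
  ultimately show False
    by linarith
qed

lemma infinite_K: "infinite K"
proof
  assume "finite K"
  have "G \<subseteq> sec x0 ` K"
    using K_onto by blast
  then show False
    using infinite_G \<open>finite K\<close> finite_surj by blast
qed

lemma move_vertex:
  assumes "g \<in> carrier A" "g \<noteq> \<one>"
  obtains u where "u \<in> T" "g u \<noteq> u"
proof -
  have "\<exists>u\<in>T. g u \<noteq> u"
  proof (rule ccontr)
    assume "\<not> (\<exists>u\<in>T. g u \<noteq> u)"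
    then have "g = \<one>"
      using assms(1) by (intro aut_eqI) auto
    then show False
      using assms(2) by simp
  qed
  then show ?thesis
    using that by blast
qed

lemma apply_incomparable:
  assumes "g \<in> carrier A" "u \<in> T" "g u \<noteq> u"
  shows "\<not> prefix (g u) u" "\<not> prefix u (g u)"
  using assms level_prefix_iff [of u "length u" "g u"] level_prefix_iff [of "g u" "length u" u]
  by (auto simp: level_def)

text \<open>If \<open>g\<close> moves \<open>u\<close>, conjugation by \<open>g\<close> carries a
  copy of \<open>k\<close> below \<open>u\<close> to one below \<open>g u\<close>, which is
  incomparable with \<open>u\<close>. This yields a nontrivial element in
  \<open>finite_index_above_D\<close> and distinguishes the twists in \<open>WM_inj\<close>.\<close>

lemma centralizer_K_trivial:
  assumes g: "g \<in> carrier A" and comm: "\<And>k. k \<in> K \<Longrightarrow> g \<otimes> k \<otimes> inv g = k"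
  shows "g = \<one>"
proof (rule ccontr)
  assume "g \<noteq> \<one>"
  then obtain u where u: "u \<in> T" "g u \<noteq> u"
    using move_vertex g by blast
  obtain k where k: "k \<in> K" "k \<noteq> \<one>"
    using infinite_K by (metis finite.simps finite_subset singletonI subsetI insertI1)
  have kA: "k \<in> carrier A"
    using k K_simps(2) by blast
  have "inj_at (g u) (sec u g \<otimes> k \<otimes> inv (sec u g)) = inj_at u k"
    using conj_ins [OF g kA u(1)] comm [OF ins_K [OF u(1) k(1)]] by simp
  then have "sec u (inj_at (g u) (sec u g \<otimes> k \<otimes> inv (sec u g))) = k"
    using kA u by simp
  moreover have "sec u (inj_at (g u) (sec u g \<otimes> k \<otimes> inv (sec u g))) = \<one>"
    using g u kA apply_incomparable by (intro sec_ins_incomparable) auto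
  ultimately show False
    using k by simp
qed

lemma subgroup_ins_preimage:
  assumes "subgroup N A" "v \<in> T"
  shows "subgroup {m \<in> G. inj_at v m \<in> N} A"
proof (rule subgroupI)
  show "{m \<in> G. inj_at v m \<in> N} \<subseteq> carrier A"
    using mem_carrier by blast
  have "\<one> \<in> {m \<in> G. inj_at v m \<in> N}"
    using assms subgroup.one_closed by simp
  then show "{m \<in> G. inj_at v m \<in> N} \<noteq> {}"
    by blast
qed (use assms mem_carrier subgroup.m_closed [OF assms(1)] subgroup.m_inv_closed [OF assms(1)]
    in \<open>auto simp: ins_mult ins_inv\<close>)

text \<open>Since \<open>y\<close> moves \<open>u\<close>, the commutator of
  \<open>inj_at u k\<close> with \<open>y\<close> is \<open>inj_at u k\<close> times an element
  supported below \<open>y u\<close>. The latter commutes with everything supported below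
  \<open>u\<close> and drops out of the second commutator.\<close>

lemma commutator_ins_supported:
  assumes y: "y \<in> carrier A" and u: "u \<in> T" "y u \<noteq> u" and k: "k \<in> carrier A"
    and k': "k' \<in> carrier A"
  shows "commutator (commutator (inj_at u k) y) (inj_at u k') = inj_at u (commutator k k')"
proof -
  let ?E = "y \<otimes> inv (inj_at u k) \<otimes> inv y"
  have E: "?E = inj_at (y u) (sec u y \<otimes> inv k \<otimes> inv (sec u y))"
    using conj_ins [of y "inv k" u] y u k by (simp add: ins_inv)
  have comm: "?E \<otimes> inj_at u k' = inj_at u k' \<otimes> ?E"
    unfolding E using y u k k' apply_incomparable [OF y u] by (intro ins_commute) auto
  have in_A: "?E \<in> carrier A" "inj_at u k \<in> carrier A" "inj_at u k' \<in> carrier A"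
    using y u k k' by auto
  have "commutator (inj_at u k) y = inj_at u k \<otimes> ?E"
    using y in_A by (simp add: commutator_def m_assoc)
  then have "commutator (commutator (inj_at u k) y) (inj_at u k') =
      inj_at u k \<otimes> (?E \<otimes> inj_at u k') \<otimes> inv ?E \<otimes> inv (inj_at u k) \<otimes> inv (inj_at u k')"
    using in_A by (simp add: commutator_def m_assoc inv_mult_group del: m_closed)
      (simp add: m_assoc y u k k')
  also have "\<dots> = inj_at u k \<otimes> (inj_at u k' \<otimes> ?E) \<otimes> inv ?E \<otimes> inv (inj_at u k) \<otimes> inv (inj_at u k')"
    unfolding comm ..
  also have "\<dots> = inj_at u k \<otimes> inj_at u k' \<otimes> (?E \<otimes> inv ?E) \<otimes> inv (inj_at u k) \<otimes> inv (inj_at u k')"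
    using in_A by (simp only: m_assoc m_closed inv_closed)
  also have "\<dots> = inj_at u k \<otimes> inj_at u k' \<otimes> inv (inj_at u k) \<otimes> inv (inj_at u k')"
    unfolding r_inv [OF in_A(1)] using in_A by simp
  also have "\<dots> = inj_at u (commutator k k')"
    using k k' u by (simp add: commutator_def ins_mult ins_inv)
  finally show ?thesis .
qed

text \<open>Commutators with an element moving \<open>u\<close> localize below \<open>u\<close>.\<close>

lemma nsub_contains_level:
  assumes N: "nsub N" and y: "y \<in> N" "y \<noteq> \<one>"
  obtains n where "n > 0" "\<And>u m. u \<in> level n \<Longrightarrow> m \<in> gcomm K \<Longrightarrow> inj_at u m \<in> N"
proof -
  have yA: "y \<in> carrier A"
    using nsub_simps(3) [OF N y(1)] .
  obtain u where u: "u \<in> T" "y u \<noteq> u"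
    using move_vertex [OF yA y(2)] by blast
  have ux: "u @ x0 \<in> T"
    using u x0 by simp
  \<comment> \<open>\<open>k\<close> acts as \<open>g\<close> at \<open>x0\<close> and meets a copy
    of \<open>m\<close> placed there, so \<open>[k, inj_at x0 m]\<close> is a copy of
    \<open>[g, m]\<close>, a generator of \<open>gcomm K\<close>.\<close>
  have gen: "inj_at (u @ x0) (commutator g m) \<in> N" if g: "g \<in> G" and m: "m \<in> K" for g m
  proof -
    obtain k where k: "k \<in> K" "k x0 = x0" "sec x0 k = g"
      using K_onto g by blast
    have A: "k \<in> carrier A" "m \<in> carrier A" "g \<in> carrier A" "inj_at x0 m \<in> carrier A"
      using k m g K_simps(2) mem_carrier x0 by auto
    have "commutator (inj_at u k) y \<in> N"
      using commutator_in_nsub(1) [OF N ins_in_G [OF u(1) k(1)] y(1)] .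
    then have "commutator (commutator (inj_at u k) y) (inj_at u (inj_at x0 m)) \<in> N"
      using commutator_in_nsub(2) [OF N] ins_in_G [OF u(1) ins_K [OF x0 m]] by blast
    moreover have "commutator k (inj_at x0 m) = inj_at x0 (commutator g m)"
    proof -
      have "commutator k (inj_at x0 m) = (k \<otimes> inj_at x0 m \<otimes> inv k) \<otimes> inv (inj_at x0 m)"
        by (simp add: commutator_def)
      also have "\<dots> = inj_at x0 (g \<otimes> m \<otimes> inv g) \<otimes> inv (inj_at x0 m)"
        using A x0 k by (simp add: conj_ins)
      also have "\<dots> = inj_at x0 (commutator g m)"
        using A x0 by (simp add: commutator_def ins_mult ins_inv)
      finally show ?thesis .
    qed
    ultimately show ?thesis
      using commutator_ins_supported [OF yA u A(1) A(4)] A u x0 by (simp add: ins_append)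
  qed
  have "gcomm K \<subseteq> {m \<in> G. inj_at (u @ x0) m \<in> N}"
    by (rule gcomm_least [OF subgroup_ins_preimage [OF nsub_simps(1) [OF N] ux]])
      (use gen K_simps(1) in auto)
  then have M: "inj_at (u @ x0) m \<in> N" if "m \<in> gcomm K" for m
    using that by blast
  have "inj_at v m \<in> N" if v: "v \<in> level (length (u @ x0))" and m: "m \<in> gcomm K" for v m
  proof -
    have "v \<in> T" "length (u @ x0) = length v"
      using v by (auto simp: level_def)
    then obtain g where g: "g \<in> G" "g (u @ x0) = v"
      using level_transitive ux by blast
    let ?s = "sec (u @ x0) g"
    have s: "?s \<in> G" "?s \<in> carrier A" "g \<in> carrier A" "m \<in> carrier A"
      using g ux self_similar mem_carrier nsub_simps(3) [OF nsub_M m] by auto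
    \<comment> \<open>Moving the support from \<open>u @ x0\<close> to \<open>v\<close> conjugates
      by the section \<open>?s\<close>; conjugating \<open>m\<close> backwards first compensates for
      it.\<close>
    have m': "inv ?s \<otimes> m \<otimes> ?s \<in> gcomm K"
      using nsub_simps(8) [OF nsub_M s(1) m] .
    have "g \<otimes> inj_at (u @ x0) (inv ?s \<otimes> m \<otimes> ?s) \<otimes> inv g = inj_at v m"
      using conj_ins [of g "inv ?s \<otimes> m \<otimes> ?s" "u @ x0"] g s ux by (simp add: m_assoc)
    then show ?thesis
      using nsub_simps(7) [OF N g(1) M [OF m']] by simp
  qed
  \<comment> \<open>The root cannot be moved, so the level is positive;
    \<open>finite_index_above_D\<close> uses this to go strictly below \<open>p\<close>.\<close>
  moreover have "length (u @ x0) > 0"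
    using u yA by (cases u) auto
  ultimately show ?thesis
    using that by blast
qed

text \<open>An element is recorded by its action on the level together with the cosets of its
  sections there, finitely many possibilities. Two elements with the same record differ by one that
  fixes the level and has all sections in \<open>N\<close>, to which \<open>mem\<close>
  applies.\<close>

lemma finite_cosets_level:
  assumes N: "nsub N" "finite ((\<lambda>x. N #> x) ` G)" and L: "subgroup L A" "L \<subseteq> G"
    and H: "subgroup H A"
    and mem: "\<And>x. x \<in> L \<Longrightarrow> (\<And>u. u \<in> level n \<Longrightarrow> x u = u) \<Longrightarrow>
                (\<And>u. u \<in> level n \<Longrightarrow> sec u x \<in> N) \<Longrightarrow> x \<in> H"
  shows "finite ((\<lambda>x. H #> x) ` L)"
proof (rule finite_cosets_invariant [OF H subgroup.subset [OF L(1)]])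
  let ?f = "\<lambda>g. (\<lambda>u\<in>level n. (g u, N #> sec u g))"
  have "?f ` L \<subseteq> PiE (level n) (\<lambda>_. level n \<times> ((\<lambda>x. N #> x) ` G))"
  proof clarify
    fix g assume "g \<in> L"
    then have g: "g \<in> G" "g \<in> carrier A"
      using L mem_carrier by auto
    show "?f g \<in> PiE (level n) (\<lambda>_. level n \<times> ((\<lambda>x. N #> x) ` G))"
      using g self_similar by (auto simp: level_def)
  qed
  moreover have "finite (PiE (level n) (\<lambda>_. level n \<times> ((\<lambda>x. N #> x) ` G)))"
    using N(2) by (intro finite_PiE) auto
  ultimately show "finite (?f ` L)"
    by (rule finite_subset)
  fix g h assume gL: "g \<in> L" and hL: "h \<in> L" and eq: "?f g = ?f h"
  have gh: "g \<in> G" "g \<in> carrier A" "h \<in> G" "h \<in> carrier A"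
    using gL hL L mem_carrier by auto
  have "g u = h u \<and> N #> sec u g = N #> sec u h" if "u \<in> level n" for u
    using fun_cong [OF eq, of u] that by simp
  then have eq': "g u = h u" "sec u g \<otimes> inv (sec u h) \<in> N" if "u \<in> level n" for u
    using that gh r_coset_eq_iff [OF nsub_simps(1) [OF N(1)], of "sec u g" "sec u h"]
    by (auto simp: level_def)
  show "g \<otimes> inv h \<in> H"
  proof (rule mem)
    show "g \<otimes> inv h \<in> L"
      using gL hL subgroup.m_closed [OF L(1)] subgroup.m_inv_closed [OF L(1)] by blast
    fix u assume u: "u \<in> level n"
    let ?w = "(inv h) u"
    have uT: "u \<in> T"
      using u by (simp add: level_def)
    have w: "?w \<in> level n" "?w \<in> T" "h ?w = u"
      using u uT gh by auto
    then have "g ?w = u"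
      using eq'(1) by simp
    then show "(g \<otimes> inv h) u = u"
      using uT gh by simp
    have "sec u (inv h) = inv (sec ?w h)"
      using sec_inv [of h ?w] w gh by simp
    then have "sec u (g \<otimes> inv h) = sec ?w g \<otimes> inv (sec ?w h)"
      using uT gh by simp
    then show "sec u (g \<otimes> inv h) \<in> N"
      using eq'(2) [OF w(1)] by simp
  qed
qed

lemma mem_SRist:
  assumes "incomparable_vertices d V" "g \<in> G" "trivial_off V g"
  shows "g \<in> SRist d G V"
proof -
  have V: "finite V" "V \<subseteq> T" "pairwise (\<lambda>u v. \<not> prefix u v \<and> \<not> prefix v u) V"
    using assms(1) by (auto simp: incomparable_vertices_def)
  obtain vs where vs: "set vs = V" "distinct vs"
    using finite_distinct_list V(1) by blast
  have "inj_at u (sec u g) \<in> Rist d (tree_automorphisms d) u" if "u \<in> set vs" for u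
  proof -
    have "inj_at u (sec u g) \<in> carrier A"
      using that vs V assms(2) mem_carrier by auto
    then show ?thesis
      by (auto simp: Rist_def carrier_iff ins_apply_off)
  qed
  then have "g \<in> product_of_subgroups d (map (Rist d (tree_automorphisms d)) vs)"
    using vs V assms mem_carrier by (intro product_of_subgroups_mem) auto
  then show ?thesis
    using assms(2) vs by (auto simp: SRist_def)
qed

lemma diagonal_block_subgroupI:
  assumes V: "incomparable_vertices d V" and H: "subgroup H A" "H \<subseteq> G"
    and triv: "\<And>g. g \<in> H \<Longrightarrow> trivial_off V g"
    and img: "\<And>v. v \<in> V \<Longrightarrow> sec v ` H = K" and inj: "\<And>v. v \<in> V \<Longrightarrow> inj_on (sec v) H"
  shows "diagonal_block_subgroup d G V H"
proof -
  have "finite_index d (sec v ` Stab G v) (sec v ` H)" if v: "v \<in> V" for v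
  proof -
    have "v \<in> T"
      using V v by (auto simp: incomparable_vertices_def)
    then have "sec v ` Stab G v \<subseteq> G"
      using self_similar by (auto simp: Stab_def)
    then show ?thesis
      unfolding finite_index_iff img [OF v] using finite_cosets_K by (meson finite_subset image_mono)
  qed
  moreover have "subgroup_of d (SRist d G V) H"
    using H mem_SRist [OF V] triv by (auto simp: subgroup_of_iff)
  ultimately show ?thesis
    using V inj by (simp add: diagonal_block_subgroup_def)
qed

end

section \<open>The twisted diagonal and the subgroups above it\<close>

locale twisted_pair = branch_setup +
  fixes v w :: "nat list" and \<kappa> :: "nat list \<Rightarrow> nat list"
  assumes v: "v \<in> tree d" and w: "w \<in> tree d" and length_vw: "length v = length w" and vw: "v \<noteq> w"
    and \<kappa>: "\<kappa> \<in> K"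
begin

definition p where "p = v @ x0"
definition q where "q = w @ x0"

lemma pq: "p \<in> T" "q \<in> T" "p \<noteq> q" "length q = length p" "p \<in> level (length p)" "q \<in> level (length p)"
  "\<not> prefix p q" "\<not> prefix q p"
proof -
  show 1: "p \<in> T" "q \<in> T" "p \<noteq> q" "length q = length p"
    using v w vw length_vw x0 by (auto simp: p_def q_def)
  then show 2: "p \<in> level (length p)" "q \<in> level (length p)"
    by (auto simp: level_def)
  show "\<not> prefix p q" "\<not> prefix q p"
    using 1(3) level_prefix_iff [OF 2] level_prefix_iff [OF 2(2) 2(1)] by auto
qed

lemma \<kappa>_simps: "\<kappa> \<in> G" "\<kappa> \<in> carrier A"
  using \<kappa> K_simps by auto

definition D :: "(nat list \<Rightarrow> nat list) set" where
  "D = {g \<in> G. g p = p \<and> g q = q \<and> sec q g = \<kappa> \<otimes> sec p g \<otimes> inv \<kappa>}"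

lemma subgroup_D: "subgroup D A"
proof (rule subgroupI)
  show "D \<subseteq> carrier A"
    using mem_carrier by (auto simp: D_def)
  have "\<one> \<in> D"
    using pq \<kappa>_simps by (simp add: D_def)
  then show "D \<noteq> {}"
    by blast
next
  fix g assume "g \<in> D"
  then have g: "g \<in> G" "g \<in> carrier A" "g p = p" "g q = q" "sec q g = \<kappa> \<otimes> sec p g \<otimes> inv \<kappa>"
    using mem_carrier by (auto simp: D_def)
  then show "inv g \<in> D"
    using pq \<kappa>_simps by (simp add: D_def inv_fixes sec_inv_fixed inv_mult_group m_assoc)
next
  fix g h assume "g \<in> D" "h \<in> D"
  then have g: "g \<in> G" "g \<in> carrier A" "g p = p" "g q = q" "sec q g = \<kappa> \<otimes> sec p g \<otimes> inv \<kappa>"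
    and h: "h \<in> G" "h \<in> carrier A" "h p = p" "h q = q" "sec q h = \<kappa> \<otimes> sec p h \<otimes> inv \<kappa>"
    using mem_carrier by (auto simp: D_def)
  then show "g \<otimes> h \<in> D"
    using pq \<kappa>_simps by (simp add: D_def m_assoc)
qed

lemma D_subset: "D \<subseteq> G"
  by (auto simp: D_def)

definition diag where "diag y = inj_at p y \<otimes> inj_at q (\<kappa> \<otimes> y \<otimes> inv \<kappa>)"

lemma diag_apply:
  assumes "y \<in> carrier A"
  shows "diag y \<in> carrier A" "diag y p = p" "diag y q = q" "sec p (diag y) = y"
    "sec q (diag y) = \<kappa> \<otimes> y \<otimes> inv \<kappa>"
    "\<And>u. u \<in> T \<Longrightarrow> \<not> prefix p u \<Longrightarrow> \<not> prefix q u \<Longrightarrow> diag y u = u"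
    "\<And>u. u \<in> T \<Longrightarrow> \<not> prefix p u \<Longrightarrow> \<not> prefix q u \<Longrightarrow> \<not> prefix u p \<Longrightarrow> \<not> prefix u q \<Longrightarrow>
       sec u (diag y) = \<one>"
  using assms pq \<kappa>_simps
  by (simp_all add: diag_def ins_fixes_incomparable sec_ins_incomparable)

lemma diag_mult:
  assumes "x \<in> carrier A" "y \<in> carrier A"
  shows "diag (x \<otimes> y) = diag x \<otimes> diag y"
proof -
  let ?c = "\<lambda>y. inj_at q (\<kappa> \<otimes> y \<otimes> inv \<kappa>)"
  have A: "inj_at p x \<in> carrier A" "inj_at p y \<in> carrier A" "?c x \<in> carrier A" "?c y \<in> carrier A"
    using assms pq \<kappa>_simps by auto
  have comm: "inj_at p y \<otimes> ?c x = ?c x \<otimes> inj_at p y"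
    using assms pq \<kappa>_simps by (intro ins_commute) auto
  have "\<kappa> \<otimes> (x \<otimes> y) \<otimes> inv \<kappa> = (\<kappa> \<otimes> x \<otimes> inv \<kappa>) \<otimes> (\<kappa> \<otimes> y \<otimes> inv \<kappa>)"
    using assms \<kappa>_simps by (simp add: m_assoc)
  then have "diag (x \<otimes> y) = (inj_at p x \<otimes> inj_at p y) \<otimes> (?c x \<otimes> ?c y)"
    using assms pq \<kappa>_simps by (simp add: diag_def ins_mult)
  also have "\<dots> = inj_at p x \<otimes> (inj_at p y \<otimes> ?c x) \<otimes> ?c y"
    using A by (simp only: m_assoc m_closed)
  also have "\<dots> = inj_at p x \<otimes> (?c x \<otimes> inj_at p y) \<otimes> ?c y"
    unfolding comm ..
  also have "\<dots> = diag x \<otimes> diag y"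
    unfolding diag_def using A by (simp only: m_assoc m_closed)
  finally show ?thesis .
qed

lemma conj_\<kappa>_in_K: "y \<in> K \<Longrightarrow> \<kappa> \<otimes> y \<otimes> inv \<kappa> \<in> K"
  using nsub_simps(7) [OF nsub_K] \<kappa>_simps by blast

lemma diag_in_D: "y \<in> K \<Longrightarrow> diag y \<in> D"
proof -
  assume y: "y \<in> K"
  then have "diag y \<in> G"
    unfolding diag_def using ins_in_G pq conj_\<kappa>_in_K by simp
  then show "diag y \<in> D"
    using y diag_apply [OF K_simps(2) [OF y]] by (simp add: D_def)
qed

text \<open>Inserting the same \<open>k\<close> at \<open>v\<close> and at \<open>w\<close> gives
  the section \<open>g\<close> at both \<open>p\<close> and \<open>q\<close>; conjugation by a copy
  of \<kappa> at \<open>q\<close> then introduces the twist without touching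
  \<open>p\<close>.\<close>

lemma D_onto:
  assumes g: "g \<in> G"
  obtains \<delta> where "\<delta> \<in> D" "sec p \<delta> = g"
proof -
  obtain k where k: "k \<in> K" "k x0 = x0" "sec x0 k = g"
    using K_onto g by blast
  have A: "k \<in> carrier A" "g \<in> carrier A"
    using k g K_simps(2) mem_carrier by auto
  have inc: "\<not> prefix v q" "\<not> prefix q v" "\<not> prefix w p" "\<not> prefix p w"
    using vw length_vw by (auto simp: p_def q_def prefix_def)
  let ?a = "inj_at v k \<otimes> inj_at w k"
  have "(inj_at v k) p = p" "(inj_at w k) q = q"
    using v w x0 k by (simp_all add: p_def q_def ins_apply)
  moreover have "(inj_at w k) p = p" "(inj_at v k) q = q" "sec p (inj_at w k) = \<one>" "sec q (inj_at v k) = \<one>"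
    using A v w pq inc by (simp_all add: ins_fixes_incomparable sec_ins_incomparable)
  moreover have "sec p (inj_at v k) = g" "sec q (inj_at w k) = g"
    using A v w x0 k by (simp_all add: p_def q_def sec_append)
  ultimately have a: "?a \<in> carrier A" "?a p = p" "?a q = q" "sec p ?a = g" "sec q ?a = g"
    using A v w pq by simp_all
  have aG: "?a \<in> G"
    using ins_in_G v w k by simp
  let ?c = "inj_at q \<kappa>"
  have c: "?c \<in> G" "?c \<in> carrier A" "?c p = p" "?c q = q" "sec p ?c = \<one>" "sec q ?c = \<kappa>"
    using ins_in_G pq \<kappa> \<kappa>_simps by (simp_all add: ins_fixes_incomparable sec_ins_incomparable)
  have ci: "(inv ?c) p = p" "(inv ?c) q = q" "sec p (inv ?c) = \<one>" "sec q (inv ?c) = inv \<kappa>"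
    using c pq by (simp_all add: inv_fixes sec_inv_fixed)
  have "?c \<otimes> ?a \<otimes> inv ?c \<in> D" "sec p (?c \<otimes> ?a \<otimes> inv ?c) = g"
    unfolding D_def using a c ci aG pq A by (simp_all del: apply_mult add: apply_mult [of _ "inv ?c"] apply_mult [of ?c ?a])
  then show ?thesis
    using that by blast
qed

lemma Rist_subset_D:
  assumes u: "u \<in> T" "\<not> prefix u p" "\<not> prefix p u" "\<not> prefix u q" "\<not> prefix q u"
  shows "Rist d G u \<subseteq> D"
proof
  fix g assume g: "g \<in> Rist d G u"
  then have gG: "g \<in> G" "g \<in> carrier A" and triv: "\<And>w. w \<in> T \<Longrightarrow> \<not> prefix u w \<Longrightarrow> g w = w"
    using mem_carrier by (auto simp: Rist_def)
  have *: "g (r @ w) = r @ w" if "r = p \<or> r = q" "w \<in> T" for r w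
  proof (rule triv)
    show "r @ w \<in> T"
      using that pq by auto
    show "\<not> prefix u (r @ w)"
      using that u prefix_same_cases [of u "r @ w" r] by auto
  qed
  have "sec p g = \<one>" "sec q g = \<one>"
    using * triv [of p] triv [of q] gG pq u by (auto intro!: sec_eqI)
  then show "g \<in> D"
    using triv [of p] triv [of q] gG pq u \<kappa>_simps by (simp add: D_def)
qed

lemma ins_in_D:
  assumes "u \<in> T" "\<not> prefix u p" "\<not> prefix p u" "\<not> prefix u q" "\<not> prefix q u" "k \<in> K"
  shows "inj_at u k \<in> D"
proof -
  have "inj_at u k \<in> Rist d G u"
    using assms ins_in_G by (auto simp: Rist_def ins_apply_off)
  then show ?thesis
    using Rist_subset_D assms by blast
qed

text \<open>Conjugating \<open>diag k\<close> by \<open>g\<close> and dividing by a suitable value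
  of \<open>diag\<close> cancels the component at \<open>q\<close> and leaves one at
  \<open>p\<close>. It is nontrivial for some \<open>k\<close> because \<alpha> and \<beta> differ
  and \<open>K\<close> has trivial centralizer.\<close>

lemma finite_index_above_D:
  assumes H: "subgroup H A" "D \<subseteq> H" "H \<subseteq> G" and g: "g \<in> H" "g p = p" "g q = q" "g \<notin> D"
  shows "finite ((\<lambda>x. H #> x) ` G)"
proof -
  have HA: "x \<in> H \<Longrightarrow> y \<in> H \<Longrightarrow> x \<otimes> y \<in> H" "x \<in> H \<Longrightarrow> inv x \<in> H" for x y
    using subgroup.m_closed [OF H(1)] subgroup.m_inv_closed [OF H(1)] by auto
  have gA: "g \<in> carrier A" "g \<in> G"
    using g H mem_carrier by auto
  define \<alpha> where "\<alpha> = sec p g"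
  \<comment> \<open>The section at \<open>q\<close> with the twist removed, so that \<open>g\<close>
    belongs to \<open>D\<close> exactly when \<alpha> = \<beta>.\<close>
  define \<beta> where "\<beta> = inv \<kappa> \<otimes> sec q g \<otimes> \<kappa>"
  have ab: "\<alpha> \<in> G" "\<beta> \<in> G" "\<alpha> \<in> carrier A" "\<beta> \<in> carrier A"
    unfolding \<alpha>_def \<beta>_def using gA pq self_similar \<kappa>_simps by auto
  have qg: "sec q g = \<kappa> \<otimes> \<beta> \<otimes> inv \<kappa>"
    unfolding \<beta>_def using gA pq \<kappa>_simps by (simp add: m_assoc)
  have "\<alpha> \<noteq> \<beta>"
    using g gA qg by (auto simp: D_def \<alpha>_def)
  define N where "N = {m \<in> G. inj_at p m \<in> H}"
  \<comment> \<open>Normal in all of \<open>G\<close>, since \<open>D_onto\<close> realizes every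
    conjugator as the section at \<open>p\<close> of an element of \<open>H\<close>.\<close>
  have N: "nsub N"
    unfolding nsub_def
  proof (intro conjI ballI)
    show "subgroup N A"
      unfolding N_def by (rule subgroup_ins_preimage [OF H(1) pq(1)])
    fix h n assume h: "h \<in> G" and n: "n \<in> N"
    obtain \<delta> where \<delta>: "\<delta> \<in> D" "sec p \<delta> = h"
      using D_onto h by blast
    have "\<delta> \<in> H" "\<delta> \<in> carrier A" "\<delta> p = p" "n \<in> carrier A" "inj_at p n \<in> H" "n \<in> G"
      using \<delta> H n mem_carrier D_subset by (auto simp: N_def D_def)
    moreover from this have "\<delta> \<otimes> inj_at p n \<otimes> inv \<delta> = inj_at p (h \<otimes> n \<otimes> inv h)"
      using conj_ins [of \<delta> n p] \<delta> pq by simp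
    ultimately show "h \<otimes> n \<otimes> inv h \<in> N"
      using HA h unfolding N_def by (metis (mono_tags, lifting) G_simps(1,2) mem_Collect_eq)
  qed (auto simp: N_def)
  have diag_H: "diag y \<in> H" if "y \<in> K" for y
    using that diag_in_D H by blast
  have y_in_N: "\<alpha> \<otimes> k \<otimes> inv \<alpha> \<otimes> inv (\<beta> \<otimes> k \<otimes> inv \<beta>) \<in> N" if k: "k \<in> K" for k
  proof -
    let ?a = "\<alpha> \<otimes> k \<otimes> inv \<alpha>" and ?b = "\<beta> \<otimes> k \<otimes> inv \<beta>"
    let ?c = "inj_at q (\<kappa> \<otimes> ?b \<otimes> inv \<kappa>)"
    have kA: "k \<in> carrier A" "k \<in> G"
      using k K_simps by auto
    have b: "?b \<in> K"
      using nsub_simps(7) [OF nsub_K ab(2) k] .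
    have A: "?a \<in> carrier A" "?b \<in> carrier A" "?c \<in> carrier A" "inj_at p k \<in> carrier A"
      "inj_at q (\<kappa> \<otimes> k \<otimes> inv \<kappa>) \<in> carrier A"
      using kA ab \<kappa>_simps pq by auto
    have "g \<otimes> diag k \<otimes> inv g =
        (g \<otimes> inj_at p k \<otimes> inv g) \<otimes> (g \<otimes> inj_at q (\<kappa> \<otimes> k \<otimes> inv \<kappa>) \<otimes> inv g)"
      unfolding diag_def using gA A(4,5) by (simp add: m_assoc)
    also have "g \<otimes> inj_at p k \<otimes> inv g = inj_at p ?a"
      using conj_ins [of g k p] gA kA pq g by (simp add: \<alpha>_def)
    also have "g \<otimes> inj_at q (\<kappa> \<otimes> k \<otimes> inv \<kappa>) \<otimes> inv g = ?c"
      using conj_ins [of g "\<kappa> \<otimes> k \<otimes> inv \<kappa>" q] gA kA pq g ab \<kappa>_simps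
      by (simp add: qg m_assoc inv_mult_group)
    finally have "g \<otimes> diag k \<otimes> inv g \<otimes> inv (diag ?b) = inj_at p ?a \<otimes> ?c \<otimes> inv (inj_at p ?b \<otimes> ?c)"
      by (simp add: diag_def)
    also have "\<dots> = inj_at p ?a \<otimes> inv (inj_at p ?b)"
    proof -
      have "inj_at p ?a \<in> carrier A" "inj_at p ?b \<in> carrier A"
        using A pq by auto
      then show ?thesis
        using A(3) by (simp only: m_assoc m_closed inv_closed inv_mult_group mult_inv_cancel)
    qed
    also have "\<dots> = inj_at p (?a \<otimes> inv ?b)"
      using A pq ins_inv [of ?b p] ins_mult [of ?a "inv ?b" p] by simp
    finally have "inj_at p (?a \<otimes> inv ?b) \<in> H"
      using HA g(1) diag_H [OF k] diag_H [OF b] by metis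
    then show ?thesis
      unfolding N_def using ab kA by simp
  qed
  have "\<exists>k\<in>K. \<alpha> \<otimes> k \<otimes> inv \<alpha> \<otimes> inv (\<beta> \<otimes> k \<otimes> inv \<beta>) \<noteq> \<one>"
  proof (rule ccontr)
    assume *: "\<not> ?thesis"
    have "inv \<beta> \<otimes> \<alpha> = \<one>"
    proof (rule centralizer_K_trivial)
      fix k assume k: "k \<in> K"
      then have kA: "k \<in> carrier A"
        by (rule K_simps)
      have "\<alpha> \<otimes> k \<otimes> inv \<alpha> = \<beta> \<otimes> k \<otimes> inv \<beta>"
        using * k kA ab inv_equality [of "\<alpha> \<otimes> k \<otimes> inv \<alpha>" "inv (\<beta> \<otimes> k \<otimes> inv \<beta>)"] by simp
      then have "inv \<beta> \<otimes> (\<alpha> \<otimes> k \<otimes> inv \<alpha>) \<otimes> \<beta> = inv \<beta> \<otimes> (\<beta> \<otimes> k \<otimes> inv \<beta>) \<otimes> \<beta>"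
        by simp
      then show "inv \<beta> \<otimes> \<alpha> \<otimes> k \<otimes> inv (inv \<beta> \<otimes> \<alpha>) = k"
        using ab kA by (simp add: m_assoc inv_mult_group)
    qed (use ab in auto)
    moreover have "\<beta> \<otimes> (inv \<beta> \<otimes> \<alpha>) = \<alpha>"
      using ab by simp
    ultimately show False
      using \<open>\<alpha> \<noteq> \<beta>\<close> ab by simp
  qed
  then obtain n where n: "n > 0" "\<And>u m. u \<in> level n \<Longrightarrow> m \<in> gcomm K \<Longrightarrow> inj_at u m \<in> N"
    using nsub_contains_level [OF N] y_in_N by metis
  show ?thesis
  proof (rule finite_cosets_level [OF nsub_M finite_cosets_M subgroup_G order_refl H(1)])
    fix x assume x: "x \<in> G" and fixed: "\<And>u. u \<in> level (length p + n) \<Longrightarrow> x u = u"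
      and secM: "\<And>u. u \<in> level (length p + n) \<Longrightarrow> sec u x \<in> gcomm K"
    have xA: "x \<in> carrier A"
      using x mem_carrier by blast
    show "x \<in> H"
    proof (rule mem_of_ins_mem [OF xA finite_level level_subset pairwise_level [OF order_refl] _ H(1)])
      show "trivial_off (level (length p + n)) x"
        using fixed xA by (intro trivial_off_level)
      fix u assume u: "u \<in> level (length p + n)"
      let ?m = "sec u x"
      have m: "?m \<in> gcomm K" "?m \<in> K" "?m \<in> carrier A"
        using secM [OF u] M_subset K_simps(2) by auto
      have uT: "u \<in> T" "length u = length p + n"
        using u by (auto simp: level_def)
      \<comment> \<open>Below \<open>p\<close> membership comes from \<open>N\<close>; below
        \<open>q\<close> the element is a value of \<open>diag\<close> divided by its component at
        \<open>p\<close>; at the remaining vertices copies of \<open>K\<close> already lie in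
        \<open>D\<close>.\<close>
      consider u' where "u = p @ u'" | u' where "u = q @ u'" | "\<not> prefix p u" "\<not> prefix q u"
        by (auto simp: prefix_def)
      then show "inj_at u ?m \<in> H"
      proof cases
        case 1
        then have u': "u' \<in> level n" "u' \<in> T"
          using uT by (auto simp: level_def)
        then have "inj_at p (inj_at u' ?m) \<in> H"
          using n(2) m by (simp add: N_def)
        then show ?thesis
          using 1 pq u' m ins_append by simp
      next
        case 2
        then have u': "u' \<in> level n" "u' \<in> T"
          using uT pq by (auto simp: level_def)
        let ?i = "inj_at u' ?m"
        let ?y = "inv \<kappa> \<otimes> ?i \<otimes> \<kappa>"
        have iK: "?i \<in> K" "?i \<in> N" "?i \<in> carrier A"
          using u' m ins_K n(2) by auto
        have y: "?y \<in> K" "?y \<in> N"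
          using nsub_simps(8) [OF nsub_K] nsub_simps(8) [OF N] \<kappa>_simps iK by blast+
        then have "inj_at p ?y \<in> H" "diag ?y \<in> H" and yA: "?y \<in> carrier A"
          using diag_H K_simps(2) by (auto simp: N_def)
        then have in_H: "inv (inj_at p ?y) \<otimes> diag ?y \<in> H"
          using HA by blast
        have "\<kappa> \<otimes> ?y \<otimes> inv \<kappa> = ?i"
          using \<kappa>_simps iK by (simp add: m_assoc)
        then have "inv (inj_at p ?y) \<otimes> diag ?y = inj_at q ?i"
          using yA iK pq by (simp add: diag_def)
        then have "inj_at q ?i \<in> H"
          using in_H by simp
        then show ?thesis
          using 2 pq u' m ins_append by simp
      next
        case 3
        \<comment> \<open>\<open>n > 0\<close> makes \<open>u\<close> longer than \<open>p\<close>
          and \<open>q\<close>, so it cannot lie above them.\<close>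
        then have "\<not> prefix u p" "\<not> prefix u q"
          using uT n(1) pq(4) prefix_length_le [of u p] prefix_length_le [of u q] by auto
        then show ?thesis
          using 3 uT m(2) ins_in_D H(2) by blast
      qed
    qed
  qed
qed

text \<open>Copies at \<open>r\<close> of distinct elements of \<open>K\<close> lie in distinct
  cosets: a quotient in \<open>H\<close> would be in \<open>D\<close>, where the sections at
  \<open>p\<close> and \<open>q\<close> determine each other, while one of them is trivial because
  \<open>r\<close> lies below only one of the two vertices.\<close>

lemma infinite_index_of_ins:
  assumes H: "subgroup H A" "\<And>g. g \<in> H \<Longrightarrow> g p = p \<Longrightarrow> g q = q \<Longrightarrow> g \<in> D"
    and L: "L \<subseteq> carrier A" "\<And>k. k \<in> K \<Longrightarrow> inj_at r k \<in> L"
    and r: "r \<in> T" "prefix p r \<or> prefix q r"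
  shows "infinite ((\<lambda>x. H #> x) ` L)"
proof (rule infinite_cosets [OF H(1) L(1) infinite_K L(2)])
  fix k k' assume k: "k \<in> K" "k' \<in> K" and mem: "inj_at r k \<otimes> inv (inj_at r k') \<in> H"
  have A: "k \<in> carrier A" "k' \<in> carrier A"
    using k K_simps(2) by auto
  let ?z = "k \<otimes> inv k'"
  have z: "?z \<in> carrier A" "inj_at r ?z \<in> H"
    using mem A r ins_inv [of k' r] ins_mult [of k "inv k'" r] by auto
  have z1: "?z = \<one>" if "inj_at r ?z \<in> D"
    using r(2)
  proof
    assume "prefix p r"
    then obtain t where t: "r = p @ t"
      by (auto simp: prefix_def)
    then have tT: "t \<in> T"
      using r by simp
    have "\<not> prefix r q" "\<not> prefix q r"
      using t pq prefix_same_cases [of q r p] append_prefixD by auto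
    then have "sec q (inj_at r ?z) = \<one>"
      using z r pq by (intro sec_ins_incomparable) auto
    moreover have "sec p (inj_at r ?z) = inj_at t ?z"
      using z t tT pq by (simp add: ins_append)
    ultimately have "\<kappa> \<otimes> inj_at t ?z \<otimes> inv \<kappa> = \<one>"
      using that by (simp add: D_def)
    then have "inv \<kappa> \<otimes> (\<kappa> \<otimes> inj_at t ?z \<otimes> inv \<kappa>) \<otimes> \<kappa> = \<one>"
      using \<kappa>_simps by simp
    then have "inj_at t ?z = inj_at t \<one>"
      using z tT \<kappa>_simps by (simp add: m_assoc)
    then show ?thesis
      using z tT ins_inject by blast
  next
    assume "prefix q r"
    then obtain t where t: "r = q @ t"
      by (auto simp: prefix_def)
    then have tT: "t \<in> T"
      using r by simp
    have "\<not> prefix r p" "\<not> prefix p r"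
      using t pq prefix_same_cases [of p r q] append_prefixD by auto
    then have "sec p (inj_at r ?z) = \<one>"
      using z r pq by (intro sec_ins_incomparable) auto
    moreover have "sec q (inj_at r ?z) = inj_at t ?z"
      using z t tT pq by (simp add: ins_append)
    ultimately have "inj_at t ?z = inj_at t \<one>"
      using that \<kappa>_simps tT by (simp add: D_def)
    then show ?thesis
      using z tT ins_inject by blast
  qed
  have "inj_at r ?z p = p" "inj_at r ?z q = q"
  proof -
    have *: "inj_at r ?z u = u" if "u = p \<or> u = q" for u
    proof (cases "r = u")
      case True
      then show ?thesis
        using z r by simp
    next
      case False
      have "\<not> prefix r u"
      proof
        assume "prefix r u"
        then have "length r \<le> length p" "prefix p u \<or> prefix q u"
          using that pq(4) r(2) prefix_length_le [of r u] prefix_order.trans by auto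
        then have "prefix r u" "length r = length u"
          using \<open>prefix r u\<close> that pq(4) r(2) prefix_length_le [of p r] prefix_length_le [of q r] by auto
        then show False
          using False by (auto simp: prefix_def)
      qed
      then show ?thesis
        using that pq by (intro ins_fixes_incomparable) auto
    qed
    show "inj_at r ?z p = p" "inj_at r ?z q = q"
      using * by auto
  qed
  then have "?z = \<one>"
    using H(2) z(2) z1 by blast
  then show "k = k'"
    using A inv_equality [of k "inv k'"] by simp
qed

text \<open>Above \<open>D\<close>, a subgroup of infinite index meets the stabilizer of \<open>(p, q)\<close> in \<open>D\<close> only, so
  it is determined up to finitely many choices; a largest orbit of \<open>(p, q)\<close> gives weak maximality.\<close>

definition admissible :: "(nat list \<Rightarrow> nat list) set \<Rightarrow> bool" where
  "admissible H \<longleftrightarrow> subgroup H A \<and> D \<subseteq> H \<and> H \<subseteq> G \<and> (\<forall>g\<in>H. g p = p \<longrightarrow> g q = q \<longrightarrow> g \<in> D)"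

lemma infinite_index_admissible:
  assumes "admissible H"
  shows "infinite ((\<lambda>x. H #> x) ` G)"
  using assms pq ins_in_G
  by (intro infinite_index_of_ins [of _ _ p]) (auto simp: admissible_def mem_carrier)

lemma exists_weakly_maximal: "\<exists>W. admissible W \<and> weakly_maximal d G W"
proof -
  let ?orb = "\<lambda>H. (\<lambda>g. (g p, g q)) ` H"
  let ?L = "level (length p) \<times> level (length p)"
  have sub: "?orb H \<subseteq> ?L" if "admissible H" for H
    using that pq mem_carrier by (auto simp: admissible_def level_def subset_iff)
  have fin: "finite (?orb H)" if "admissible H" for H
    using sub [OF that] finite_level finite_subset by blast
  have "admissible D"
    using subgroup_D D_subset by (auto simp: admissible_def)
  moreover have "card (?orb H) < Suc (card ?L)" if "admissible H" for H
    using sub [OF that] by (intro le_imp_less_Suc card_mono) auto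
  ultimately obtain W where W: "admissible W"
    and max: "\<And>H. admissible H \<Longrightarrow> card (?orb H) \<le> card (?orb W)"
    using ex_has_greatest_nat [of admissible D "\<lambda>H. card (?orb H)" "Suc (card ?L)"] by blast
  have WA: "subgroup W A" "D \<subseteq> W" "W \<subseteq> G"
    using W by (auto simp: admissible_def)
  have "H = W" if H: "subgroup_of d G H" "\<not> finite_index d G H" "W \<subseteq> H" for H
  proof
    have HA: "subgroup H A" "H \<subseteq> G"
      using H(1) by (auto simp: subgroup_of_iff)
    have "g \<in> D" if "g \<in> H" "g p = p" "g q = q" for g
      using finite_index_above_D [OF HA(1) _ HA(2) that] H(2,3) WA(2) finite_index_iff by blast
    then have "admissible H"
      using HA H(3) WA(2) by (auto simp: admissible_def)
    \<comment> \<open>\<open>W\<close> was chosen with the largest orbit of \<open>(p, q)\<close>.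
      Equal orbits and equal stabilizers, both \<open>D\<close>, force \<open>H = W\<close>.\<close>
    then have "?orb W = ?orb H"
      using max fin H(3) by (intro card_seteq) auto
    show "H \<subseteq> W"
    proof
      fix h assume h: "h \<in> H"
      then have "(h p, h q) \<in> ?orb W"
        using \<open>?orb W = ?orb H\<close> by blast
      then obtain g where g: "g \<in> W" "g p = h p" "g q = h q"
        by auto
      have A: "g \<in> carrier A" "h \<in> carrier A"
        using g h HA WA mem_carrier by auto
      have "inv g \<otimes> h \<in> H"
        using g h H(3) subgroup.m_closed [OF HA(1)] subgroup.m_inv_closed [OF HA(1)] by blast
      moreover have "(inv g \<otimes> h) p = p" "(inv g \<otimes> h) q = q"
        using A g(2,3) pq apply_inv(1) [of g p] apply_inv(1) [of g q] by simp_all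
      ultimately have "inv g \<otimes> h \<in> W"
        using \<open>admissible H\<close> WA(2) by (auto simp: admissible_def)
      then have "g \<otimes> (inv g \<otimes> h) \<in> W"
        using g subgroup.m_closed [OF WA(1)] by blast
      then show "h \<in> W"
        using A by simp
    qed
  qed (use H in auto)
  then have "weakly_maximal d G W"
    using WA infinite_index_admissible [OF W] finite_index_iff
    unfolding weakly_maximal_def subgroup_of_iff by blast
  then show ?thesis
    using W by blast
qed

section \<open>Non-rigidity tree and block structure\<close>

lemma subgroup_Rist:
  assumes "subgroup H A"
  shows "subgroup (Rist d H u) A"
proof (rule subgroupI)
  show "Rist d H u \<subseteq> carrier A"
    using assms subgroup.subset by (auto simp: Rist_def)
  have "\<one> \<in> Rist d H u"
    using subgroup.one_closed [OF assms] by (auto simp: Rist_def)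
  then show "Rist d H u \<noteq> {}"
    by blast
next
  fix g assume "g \<in> Rist d H u"
  then show "inv g \<in> Rist d H u"
    using subgroup.m_inv_closed [OF assms] subgroup.mem_carrier [OF assms] inv_fixes
    by (auto simp: Rist_def)
next
  fix g h assume "g \<in> Rist d H u" "h \<in> Rist d H u"
  then show "g \<otimes> h \<in> Rist d H u"
    using subgroup.m_closed [OF assms] subgroup.mem_carrier [OF assms] by (auto simp: Rist_def)
qed

text \<open>The rigid stabilizer of a vertex comparable with \<open>p\<close> or \<open>q\<close>
  contains a copy of \<open>K\<close> at or below one of them, which meets infinitely many cosets;
  that of any other vertex lies entirely in \<open>D\<close>.\<close>

lemma NR_admissible:
  assumes W: "admissible W"
  shows "NR d G W = {u \<in> T. prefix u p \<or> prefix p u \<or> prefix u q \<or> prefix q u}"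
proof -
  have WA: "subgroup W A" "D \<subseteq> W" "W \<subseteq> G"
    using W by (auto simp: admissible_def)
  have "infinite ((\<lambda>x. Rist d W u #> x) ` Rist d G u)"
    if u: "u \<in> T" "prefix u p \<or> prefix p u \<or> prefix u q \<or> prefix q u" for u
  proof -
    \<comment> \<open>The longer of \<open>u\<close> and a vertex among \<open>p\<close>,
      \<open>q\<close> comparable with it.\<close>
    obtain r where r: "r \<in> T" "prefix u r" "prefix p r \<or> prefix q r"
      using u pq by blast
    show ?thesis
    proof (rule infinite_index_of_ins [OF subgroup_Rist [OF WA(1)] _ _ _ r(1,3)])
      show "g \<in> D" if "g \<in> Rist d W u" "g p = p" "g q = q" for g
        using that W by (auto simp: Rist_def admissible_def)
      show "Rist d G u \<subseteq> carrier A"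
        using mem_carrier by (auto simp: Rist_def)
      fix k assume k: "k \<in> K"
      have "inj_at r k x = x" if "x \<in> T" "\<not> prefix u x" for x
        using that r(2) prefix_order.trans by (intro ins_apply_off) blast+
      then show "inj_at r k \<in> Rist d G u"
        using ins_in_G [OF r(1) k] by (simp add: Rist_def)
    qed
  qed
  moreover have "finite ((\<lambda>x. Rist d W u #> x) ` Rist d G u)"
    if u: "u \<in> T" "\<not> (prefix u p \<or> prefix p u \<or> prefix u q \<or> prefix q u)" for u
  proof -
    have "Rist d G u \<subseteq> W"
      using Rist_subset_D u WA(2) by blast
    then have "Rist d W u = Rist d G u"
      using WA(3) by (auto simp: Rist_def)
    then show ?thesis
      using subgroup_Rist [OF subgroup_G, of u] subgroup.m_closed subgroup.m_inv_closed subgroup.subset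
      by (intro finite_cosets_invariant [where f = "\<lambda>_. ()"]) fastforce+
  qed
  ultimately show ?thesis
    unfolding NR_def finite_index_iff by blast
qed

lemma diag_image_subgroup: "subgroup (diag ` K) A"
proof (rule subgroupI)
  show "diag ` K \<subseteq> carrier A"
    using diag_apply(1) K_simps(2) by auto
  show "diag ` K \<noteq> {}"
    using K_simps(3) by blast
next
  fix g assume "g \<in> diag ` K"
  then obtain y where y: "y \<in> K" "g = diag y"
    by blast
  have yA: "y \<in> carrier A"
    using y K_simps(2) by blast
  have "diag \<one> = \<one>"
    using \<kappa>_simps pq by (simp add: diag_def)
  then have "diag (inv y) \<otimes> g = \<one>"
    using diag_mult [of "inv y" y] yA y by simp
  then have "inv g = diag (inv y)"
    using inv_equality diag_apply(1) yA y by simp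
  then show "inv g \<in> diag ` K"
    using y K_simps(5) by blast
next
  fix g h assume "g \<in> diag ` K" "h \<in> diag ` K"
  then obtain k l where k: "k \<in> K" "g = diag k" and l: "l \<in> K" "h = diag l"
    by blast
  then have "g \<otimes> h = diag (k \<otimes> l)"
    using K_simps(2) diag_mult by simp
  then show "g \<otimes> h \<in> diag ` K"
    using K_simps(4) [OF k(1) l(1)] by blast
qed

lemma ins_image_subgroup:
  assumes "u \<in> T"
  shows "subgroup (inj_at u ` K) A"
proof (rule subgroupI)
  show "inj_at u ` K \<subseteq> carrier A"
    using K_simps(2) assms by auto
  show "inj_at u ` K \<noteq> {}"
    using K_simps(3) by blast
next
  fix g assume "g \<in> inj_at u ` K"
  then obtain k where k: "k \<in> K" "g = inj_at u k"
    by blast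
  then have "inv g = inj_at u (inv k)"
    using K_simps(2) assms ins_inv by simp
  then show "inv g \<in> inj_at u ` K"
    using K_simps(5) k by blast
next
  fix g h assume "g \<in> inj_at u ` K" "h \<in> inj_at u ` K"
  then obtain k l where k: "k \<in> K" "g = inj_at u k" and l: "l \<in> K" "h = inj_at u l"
    by blast
  then have "g \<otimes> h = inj_at u (k \<otimes> l)"
    using K_simps(2) assms ins_mult by simp
  then show "g \<otimes> h \<in> inj_at u ` K"
    using K_simps(4) [OF k(1) l(1)] by blast
qed

text \<open>The block subgroup in membership form; \<open>product_eq_B\<close> identifies it with
  the product of the twisted diagonal over \<open>{p, q}\<close> and a copy of \<open>K\<close> at
  every other vertex of the level.\<close>

definition B :: "(nat list \<Rightarrow> nat list) set" where
  "B = {g \<in> D. \<forall>u\<in>level (length p). g u = u \<and> sec u g \<in> K}"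

lemma subgroup_B: "subgroup B A"
proof (rule subgroupI)
  show "B \<subseteq> carrier A"
    using subgroup.subset [OF subgroup_D] by (auto simp: B_def)
  have "\<one> \<in> B"
    using subgroup.one_closed [OF subgroup_D] K_simps(3) by (auto simp: B_def level_def)
  then show "B \<noteq> {}"
    by blast
next
  fix g assume "g \<in> B"
  then show "inv g \<in> B"
    using subgroup.m_inv_closed [OF subgroup_D] subgroup.mem_carrier [OF subgroup_D] K_simps(5)
    by (auto simp: B_def level_def inv_fixes sec_inv_fixed)
next
  fix g h assume "g \<in> B" "h \<in> B"
  then show "g \<otimes> h \<in> B"
    using subgroup.m_closed [OF subgroup_D] subgroup.mem_carrier [OF subgroup_D] K_simps(4)
    by (auto simp: B_def level_def)
qed

lemma level_p_incomparable:
  assumes "u \<in> level (length p) - {p, q}"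
  shows "u \<in> T" "\<not> prefix u p" "\<not> prefix p u" "\<not> prefix u q" "\<not> prefix q u"
  using assms pq level_prefix_iff [of u "length p"] level_prefix_iff [of _ "length p" u]
  by (auto simp: level_def)

lemma ins_in_B:
  assumes u: "u \<in> level (length p) - {p, q}" and k: "k \<in> K"
  shows "inj_at u k \<in> B"
proof -
  have kA: "k \<in> carrier A"
    using k K_simps(2) by blast
  have "inj_at u k x = x \<and> sec x (inj_at u k) \<in> K" if x: "x \<in> level (length p)" for x
  proof (cases "x = u")
    case True
    then show ?thesis
      using u k kA by (simp add: level_def)
  next
    case False
    then have "\<not> prefix u x" "\<not> prefix x u" "x \<in> T" "u \<in> T"
      using u x level_prefix_iff [of u "length p" x] level_prefix_iff [of x "length p" u]
      by (auto simp: level_def)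
    then show ?thesis
      using kA K_simps(3) by (simp add: ins_fixes_incomparable sec_ins_incomparable)
  qed
  then show ?thesis
    using ins_in_D level_p_incomparable [OF u] k by (simp add: B_def)
qed

lemma diag_in_B:
  assumes y: "y \<in> K"
  shows "diag y \<in> B"
proof -
  have yA: "y \<in> carrier A"
    using y K_simps(2) by blast
  have "diag y x = x \<and> sec x (diag y) \<in> K" if x: "x \<in> level (length p)" for x
  proof (cases "x = p \<or> x = q")
    case True
    then show ?thesis
      using diag_apply [OF yA] y conj_\<kappa>_in_K by auto
  next
    case False
    then have "x \<in> level (length p) - {p, q}"
      using x by blast
    then show ?thesis
      using diag_apply(6,7) [OF yA] level_p_incomparable K_simps(3) by simp
  qed
  then show ?thesis
    using diag_in_D y by (simp add: B_def)
qed

text \<open>For the harder inclusion, dividing by \<open>diag (sec p x)\<close> clears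
  \<open>p\<close> and \<open>q\<close> at once, as membership in \<open>D\<close> ties the two
  sections; the rest splits vertex by vertex.\<close>

lemma product_eq_B:
  assumes us: "distinct us" "set us = level (length p) - {p, q}"
  shows "product_of_subgroups d ((diag ` K) # map (\<lambda>u. inj_at u ` K) us) = B"
proof
  show "product_of_subgroups d ((diag ` K) # map (\<lambda>u. inj_at u ` K) us) \<subseteq> B"
    using subgroup_B us diag_in_B ins_in_B by (intro product_of_subgroups_subset) auto
  show "B \<subseteq> product_of_subgroups d ((diag ` K) # map (\<lambda>u. inj_at u ` K) us)"
  proof
    fix x assume xB: "x \<in> B"
    then have xD: "x \<in> D" and lev: "\<And>u. u \<in> level (length p) \<Longrightarrow> x u = u \<and> sec u x \<in> K"
      by (auto simp: B_def)
    have x: "x \<in> carrier A" "x p = p" "x q = q" "sec q x = \<kappa> \<otimes> sec p x \<otimes> inv \<kappa>"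
      using xD mem_carrier by (auto simp: D_def)
    let ?\<delta> = "diag (sec p x)"
    have sK: "sec p x \<in> K" "sec p x \<in> carrier A"
      using lev pq K_simps(2) by auto
    note \<delta> = diag_apply [OF sK(2)]
    let ?y = "inv ?\<delta> \<otimes> x"
    have yA: "?y \<in> carrier A"
      using x \<delta>(1) by simp
    have yB: "?y \<in> B"
      using subgroup.m_closed [OF subgroup_B] subgroup.m_inv_closed [OF subgroup_B] xB diag_in_B sK by blast
    have ypq: "sec p ?y = \<one>" "sec q ?y = \<one>" "?y p = p" "?y q = q"
      using x \<delta> pq sec_inv_fixed [of ?\<delta> p] sec_inv_fixed [of ?\<delta> q] sK(2) \<kappa>_simps
        inv_fixes [of ?\<delta> p] inv_fixes [of ?\<delta> q]
      by simp_all
    have triv: "trivial_off (level (length p)) ?y"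
      using yB yA by (intro trivial_off_level) (auto simp: B_def)
    have "?y \<in> product_of_subgroups d (map (\<lambda>u. inj_at u ` K) us)"
    proof (rule product_of_subgroups_mem [OF yA us(1)])
      show "set us \<subseteq> T" "pairwise (\<lambda>u v. \<not> prefix u v \<and> \<not> prefix v u) (set us)"
        using us(2) level_subset pairwise_level [of "set us"] by auto
      show "inj_at u (sec u ?y) \<in> inj_at u ` K" if "u \<in> set us" for u
        using that us(2) yB by (auto simp: B_def)
      show "trivial_off (set us) ?y"
        unfolding trivial_off_def
      proof (intro conjI ballI impI)
        show "?y u = u" if "u \<in> set us" for u
          using that us(2) yB by (auto simp: B_def)
        fix z assume z: "z \<in> T" "\<forall>v\<in>set us. \<not> prefix v z"
        consider z' where "z = p @ z'" | z' where "z = q @ z'" | "\<not> prefix p z" "\<not> prefix q z"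
          by (auto simp: prefix_def)
        then show "?y z = z"
        proof cases
          case 1
          then show ?thesis
            using apply_append [OF yA pq(1), of z'] ypq z by simp
        next
          case 2
          then show ?thesis
            using apply_append [OF yA pq(2), of z'] ypq z by simp
        next
          case 3
          then have "\<forall>v\<in>level (length p). \<not> prefix v z"
            using z us(2) by blast
          then show ?thesis
            using triv z(1) by (auto simp: trivial_off_def)
        qed
      qed
    qed
    moreover have "x = ?\<delta> \<otimes> ?y"
      using x \<delta>(1) by simp
    ultimately show "x \<in> product_of_subgroups d ((diag ` K) # map (\<lambda>u. inj_at u ` K) us)"
      unfolding product_of_subgroups_Cons set_mult_iff using sK by blast
  qed
qed

lemma block_subgroup_B: "block_subgroup d G B"
proof -
  obtain us where us: "distinct us" "set us = level (length p) - {p, q}"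
    using finite_distinct_list [of "level (length p) - {p, q}"] by auto
  \<comment> \<open>One block is the pair \<open>{p, q}\<close> and the others are singletons; the
    lists put the diagonal block at index 0.\<close>
  define Vs where "Vs = {p, q} # map (\<lambda>u. {u}) us"
  define Hs where "Hs = (diag ` K) # map (\<lambda>u. inj_at u ` K) us"
  have len: "length Vs = Suc (length us)" "length Hs = Suc (length us)"
    by (auto simp: Vs_def Hs_def)
  have inc: "incomparable_vertices d V" if "V \<subseteq> level (length p)" for V
    using that level_subset pairwise_level [OF that] finite_subset [OF that finite_level]
    by (auto simp: incomparable_vertices_def)
  have Un: "(\<Union>i<Suc (length us). Vs ! i) = \<Union>(set Vs)"
    using len by (auto simp: set_conv_nth)
  also have "\<dots> \<subseteq> level (length p)"
    using us pq by (auto simp: Vs_def)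
  finally have 1: "incomparable_vertices d (\<Union>i<Suc (length us). Vs ! i)"
    by (rule inc)
  have nth: "Vs ! Suc i = {us ! i}" "Hs ! Suc i = inj_at (us ! i) ` K" if "i < length us" for i
    using that by (auto simp: Vs_def Hs_def)
  have us_nth: "us ! i \<in> level (length p) - {p, q}" if "i < length us" for i
    using that us nth_mem by blast
  have 2: "disjoint_family_on (\<lambda>i. Vs ! i) {..<Suc (length us)}"
    unfolding disjoint_family_on_def
  proof (intro ballI impI)
    fix i j assume ij: "i \<in> {..<Suc (length us)}" "j \<in> {..<Suc (length us)}" "i \<noteq> j"
    have *: "Vs ! 0 \<inter> Vs ! Suc j = {}" if "j < length us" for j
      using us_nth [OF that] nth(1) [OF that] by (auto simp: Vs_def)
    show "Vs ! i \<inter> Vs ! j = {}"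
    proof (cases i; cases j)
      fix i' j' assume "i = Suc i'" "j = Suc j'"
      then show ?thesis
        using ij nth us(1) by (auto simp: nth_eq_iff_index_eq)
    qed (use ij * in auto)
  qed
  have block0: "diagonal_block_subgroup d G {p, q} (diag ` K)"
  proof (rule diagonal_block_subgroupI)
    show "incomparable_vertices d {p, q}"
      using inc pq by simp
    show "diag ` K \<subseteq> G"
      using diag_in_D D_subset by blast
    show "trivial_off {p, q} g" if "g \<in> diag ` K" for g
      using that diag_apply K_simps(2) by (auto simp: trivial_off_def)
    have p_sec: "sec p (diag y) = y" "sec q (diag y) = \<kappa> \<otimes> y \<otimes> inv \<kappa>" if "y \<in> K" for y
      using that diag_apply K_simps(2) by auto
    have "sec p ` diag ` K = K"
      using p_sec by (force simp: image_image)
    moreover have "sec q ` diag ` K = K"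
    proof
      show "sec q ` diag ` K \<subseteq> K"
        using p_sec conj_\<kappa>_in_K by auto
      show "K \<subseteq> sec q ` diag ` K"
      proof
        fix y assume y: "y \<in> K"
        then have "inv \<kappa> \<otimes> y \<otimes> \<kappa> \<in> K" "y \<in> carrier A"
          using nsub_simps(8) [OF nsub_K] \<kappa>_simps K_simps(2) by auto
        moreover from this have "sec q (diag (inv \<kappa> \<otimes> y \<otimes> \<kappa>)) = y"
          using p_sec(2) \<kappa>_simps by (simp add: m_assoc)
        ultimately show "y \<in> sec q ` diag ` K"
          by force
      qed
    qed
    ultimately show "sec v ` diag ` K = K" if "v \<in> {p, q}" for v
      using that by auto
    have "inj_on (sec p) (diag ` K)"
      using p_sec by (auto simp: inj_on_def)
    moreover have "inj_on (sec q) (diag ` K)"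
    proof (rule inj_onI, clarify)
      fix y z assume yz: "y \<in> K" "z \<in> K" "sec q (diag y) = sec q (diag z)"
      then have "inv \<kappa> \<otimes> (\<kappa> \<otimes> y \<otimes> inv \<kappa>) \<otimes> \<kappa> = inv \<kappa> \<otimes> (\<kappa> \<otimes> z \<otimes> inv \<kappa>) \<otimes> \<kappa>"
        using p_sec by simp
      then show "diag y = diag z"
        using K_simps(2) [OF yz(1)] K_simps(2) [OF yz(2)] \<kappa>_simps by (simp add: m_assoc)
    qed
    ultimately show "inj_on (sec v) (diag ` K)" if "v \<in> {p, q}" for v
      using that by auto
  qed (rule diag_image_subgroup)
  have block1: "diagonal_block_subgroup d G {u} (inj_at u ` K)" if u: "u \<in> level (length p) - {p, q}" for u
  proof (rule diagonal_block_subgroupI)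
    have uT: "u \<in> T"
      using u by (simp add: level_def)
    show "incomparable_vertices d {u}"
      using inc u by simp
    show "subgroup (inj_at u ` K) A"
      using ins_image_subgroup uT by blast
    show "inj_at u ` K \<subseteq> G"
      using ins_in_G uT by blast
    show "trivial_off {u} g" if "g \<in> inj_at u ` K" for g
      using that K_simps(2) uT by (auto simp: trivial_off_def ins_apply_off)
    have s: "sec u (inj_at u k) = k" if "k \<in> K" for k
      using that K_simps(2) uT by simp
    show "sec v ` inj_at u ` K = K" if "v \<in> {u}" for v
      using that s by (force simp: image_image)
    show "inj_on (sec v) (inj_at u ` K)" if "v \<in> {u}" for v
      using that s by (auto simp: inj_on_def)
  qed
  have 3: "Vs ! i \<noteq> {} \<and> diagonal_block_subgroup d G (Vs ! i) (Hs ! i)" if "i < Suc (length us)" for i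
  proof (cases i)
    case 0
    then show ?thesis
      using block0 by (simp add: Vs_def Hs_def)
  next
    case (Suc j)
    then show ?thesis
      using that nth us_nth block1 by simp
  qed
  have "map ((!) Hs) [0..<Suc (length us)] = Hs"
    using map_nth [of Hs] len by simp
  then have 4: "B = product_of_subgroups d (map ((!) Hs) [0..<Suc (length us)])"
    using product_eq_B [OF us] by (simp add: Hs_def)
  have "subgroup_of d G B"
    using subgroup_B D_subset by (auto simp: subgroup_of_iff B_def)
  then show ?thesis
    unfolding block_subgroup_def using 1 2 3 4 by blast
qed

lemma has_block_structure_admissible:
  assumes W: "admissible W"
  shows "has_block_structure d G W"
proof -
  have WA: "subgroup W A" "D \<subseteq> W" "W \<subseteq> G"
    using W by (auto simp: admissible_def)
  have "finite ((\<lambda>x. B #> x) ` W)"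
  proof (rule finite_cosets_level [OF nsub_K finite_cosets_K WA(1,3) subgroup_B])
    fix x assume x: "x \<in> W" and fixed: "\<And>u. u \<in> level (length p) \<Longrightarrow> x u = u"
      and sec: "\<And>u. u \<in> level (length p) \<Longrightarrow> sec u x \<in> K"
    have "x \<in> D"
      using W x fixed pq by (auto simp: admissible_def)
    then show "x \<in> B"
      using fixed sec by (simp add: B_def)
  qed
  moreover have "B \<subseteq> W"
    using WA(2) by (auto simp: B_def)
  ultimately show ?thesis
    using block_subgroup_B WA
    by (auto simp: has_block_structure_def subgroup_of_iff finite_index_iff)
qed

end

section \<open>Separating the twists and the depths\<close>

context branch_setup
begin

definition left :: "nat \<Rightarrow> nat list" where "left n = replicate n 0 @ [0]"
definition right :: "nat \<Rightarrow> nat list" where "right n = replicate n 0 @ [1]"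

lemma twisted_pair: "\<kappa> \<in> K \<Longrightarrow> twisted_pair d A G K x0 (left n) (right n) \<kappa>"
  using d_ge_2 by unfold_locales (auto simp: left_def right_def)

definition below :: "nat \<Rightarrow> nat list set" where
  "below n = {u \<in> T. prefix u (left n @ x0) \<or> prefix (left n @ x0) u \<or>
                   prefix u (right n @ x0) \<or> prefix (right n @ x0) u}"

text \<open>The last conjunct is \<open>D\<close> written without the constants of
  \<open>twisted_pair\<close>. It keeps \<kappa> visible in \<open>W\<close>, since the non-rigidity
  tree does not depend on the twist.\<close>

lemma exists_wm:
  assumes \<kappa>: "\<kappa> \<in> K"
  shows "\<exists>W. weakly_maximal d G W \<and> has_block_structure d G W \<and> NR d G W = below n \<and>
    {g \<in> W. g (left n @ x0) = left n @ x0 \<and> g (right n @ x0) = right n @ x0} =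
    {g \<in> G. g (left n @ x0) = left n @ x0 \<and> g (right n @ x0) = right n @ x0 \<and>
       sec (right n @ x0) g = \<kappa> \<otimes> sec (left n @ x0) g \<otimes> inv \<kappa>}"
proof -
  interpret twisted_pair d A G K x0 "left n" "right n" \<kappa>
    by (rule twisted_pair [OF \<kappa>])
  obtain W where W: "admissible W" "weakly_maximal d G W"
    using exists_weakly_maximal by blast
  have "{g \<in> W. g p = p \<and> g q = q} = D"
    using W(1) by (auto simp: admissible_def D_def)
  then show ?thesis
    using W has_block_structure_admissible NR_admissible
    unfolding D_def p_def q_def below_def by blast
qed

definition WM :: "nat \<Rightarrow> (nat list \<Rightarrow> nat list) \<Rightarrow> (nat list \<Rightarrow> nat list) set" where
  "WM n \<kappa> = (SOME W. weakly_maximal d G W \<and> has_block_structure d G W \<and> NR d G W = below n \<and>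
    {g \<in> W. g (left n @ x0) = left n @ x0 \<and> g (right n @ x0) = right n @ x0} =
    {g \<in> G. g (left n @ x0) = left n @ x0 \<and> g (right n @ x0) = right n @ x0 \<and>
       sec (right n @ x0) g = \<kappa> \<otimes> sec (left n @ x0) g \<otimes> inv \<kappa>})"

lemma WM:
  assumes "\<kappa> \<in> K"
  shows "weakly_maximal d G (WM n \<kappa>)" "has_block_structure d G (WM n \<kappa>)" "NR d G (WM n \<kappa>) = below n"
    "{g \<in> WM n \<kappa>. g (left n @ x0) = left n @ x0 \<and> g (right n @ x0) = right n @ x0} =
     {g \<in> G. g (left n @ x0) = left n @ x0 \<and> g (right n @ x0) = right n @ x0 \<and>
       sec (right n @ x0) g = \<kappa> \<otimes> sec (left n @ x0) g \<otimes> inv \<kappa>}"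
  using someI_ex [OF exists_wm [OF assms, of n]] unfolding WM_def [symmetric] by auto

text \<open>Equal subgroups have the same \<open>D\<close>, so conjugation by \<kappa> and by \<mu>
  agree on \<open>K\<close>, and \<open>inv \<mu> \<otimes> \<kappa>\<close> centralizes
  \<open>K\<close>.\<close>

lemma WM_inj:
  assumes \<kappa>: "\<kappa> \<in> K" and \<mu>: "\<mu> \<in> K" and eq: "WM n \<kappa> = WM n \<mu>"
  shows "\<kappa> = \<mu>"
proof -
  interpret P: twisted_pair d A G K x0 "left n" "right n" \<kappa>
    by (rule twisted_pair [OF \<kappa>])
  interpret Q: twisted_pair d A G K x0 "left n" "right n" \<mu>
    by (rule twisted_pair [OF \<mu>])
  have "P.D = Q.D"
    using WM(4) [OF \<kappa>, of n] WM(4) [OF \<mu>, of n] eq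
    unfolding P.D_def Q.D_def P.p_def P.q_def Q.p_def Q.q_def by simp
  have A: "\<kappa> \<in> carrier A" "\<mu> \<in> carrier A"
    using \<kappa> \<mu> K_simps(2) by auto
  have "inv \<mu> \<otimes> \<kappa> = \<one>"
  proof (rule centralizer_K_trivial)
    fix y assume y: "y \<in> K"
    then have yA: "y \<in> carrier A"
      using K_simps(2) by blast
    have "P.diag y \<in> Q.D"
      using P.diag_in_D [OF y] \<open>P.D = Q.D\<close> by simp
    then have "sec P.q (P.diag y) = \<mu> \<otimes> sec P.p (P.diag y) \<otimes> inv \<mu>"
      by (simp add: Q.D_def)
    then have "\<kappa> \<otimes> y \<otimes> inv \<kappa> = \<mu> \<otimes> y \<otimes> inv \<mu>"
      using P.diag_apply(4,5) [OF yA] by simp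
    then have "inv \<mu> \<otimes> (\<kappa> \<otimes> y \<otimes> inv \<kappa>) \<otimes> \<mu> = inv \<mu> \<otimes> (\<mu> \<otimes> y \<otimes> inv \<mu>) \<otimes> \<mu>"
      by simp
    then show "inv \<mu> \<otimes> \<kappa> \<otimes> y \<otimes> inv (inv \<mu> \<otimes> \<kappa>) = y"
      using A yA by (simp add: m_assoc inv_mult_group)
  qed (use A in auto)
  moreover have "\<mu> \<otimes> (inv \<mu> \<otimes> \<kappa>) = \<kappa>"
    using A by simp
  ultimately show ?thesis
    using A by simp
qed

text \<open>The two minimal vertices whose whole cone lies in the non-rigidity tree are at level
  \<open>n + 1 + length x0\<close>; counting vertices of that level recovers \<open>n\<close>.\<close>

lemma below_not_isomorphic:
  assumes "n < m" "f \<in> tree_automorphisms d"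
  shows "f ` below n \<noteq> below m"
proof
  assume eq: "f ` below n = below m"
  have f: "f \<in> carrier A"
    using assms by (simp add: carrier_iff)
  define N where "N = m + 1 + length x0"
  \<comment> \<open>Three vertices of level \<open>N\<close> in \<open>below n\<close> are built,
    two of them separated just under \<open>left n @ x0\<close>; \<open>below m\<close> has only two
    on that level. The padding \<open>m - n - 1\<close> is what remains after the separating
    letter.\<close>
  let ?r = "replicate (m - n - 1) 0"
  define a where "a = (left n @ x0) @ [0] @ ?r"
  define b where "b = (left n @ x0) @ [1] @ ?r"
  define c where "c = (right n @ x0) @ [0] @ ?r"
  have d: "0 < d" "1 < d"
    using d_ge_2 by auto
  have T: "a \<in> T" "b \<in> T" "c \<in> T"
    using d x0 by (auto simp: a_def b_def c_def left_def right_def)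
  have len: "length a = N" "length b = N" "length c = N"
    using assms(1) by (auto simp: a_def b_def c_def left_def right_def N_def)
  have dist: "a \<noteq> b" "a \<noteq> c" "b \<noteq> c"
    by (auto simp: a_def b_def c_def left_def right_def)
  have "prefix (left n @ x0) a" "prefix (left n @ x0) b" "prefix (right n @ x0) c"
    by (auto simp only: a_def b_def c_def prefixI)
  then have "a \<in> below n" "b \<in> below n" "c \<in> below n"
    using T by (auto simp: below_def)
  then have fb: "f a \<in> below m" "f b \<in> below m" "f c \<in> below m"
    using eq by auto
  have two: "u = left m @ x0 \<or> u = right m @ x0" if "u \<in> below m" "length u = N" for u
  proof -
    have pre: "x = y" if "prefix x y" "length x = length y" for x y :: "nat list"
      using that by (auto simp: prefix_def)
    have "length (left m @ x0) = N" "length (right m @ x0) = N"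
      by (simp_all add: left_def right_def N_def)
    then show ?thesis
      using that pre unfolding below_def mem_Collect_eq by metis
  qed
  have "f x = left m @ x0 \<or> f x = right m @ x0" if "x = a \<or> x = b \<or> x = c" for x
    using that fb f T len by (intro two) auto
  then have "f a = left m @ x0 \<or> f a = right m @ x0" "f b = left m @ x0 \<or> f b = right m @ x0"
    "f c = left m @ x0 \<or> f c = right m @ x0"
    by simp_all
  moreover have "f a \<noteq> f b" "f a \<noteq> f c" "f b \<noteq> f c"
    using apply_inj [OF f] T dist by simp_all
  ultimately show False
    by auto
qed

theorem infinitely_many_classes:
  "infinite {C \<in> {W. weakly_maximal d G W} // tree_equivalence d G.
                     infinite {W \<in> C. has_block_structure d G W}}"
proof -
  \<comment> \<open>The untwisted \<open>WM n \<one>\<close> serves as representative; all twists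
    join its class through the identity automorphism.\<close>
  define C where "C n = tree_equivalence d G `` {WM n \<one>}" for n
  have one: "\<one> \<in> K"
    by (rule K_simps)
  have id: "\<one> \<in> tree_automorphisms d" "\<one> ` X = X" if "X \<subseteq> T" for X
    using that carrier_iff by (auto simp: subset_iff image_iff)
  have mem: "WM n \<kappa> \<in> C n" if "\<kappa> \<in> K" for n \<kappa>
  proof -
    have "below n \<subseteq> T"
      by (auto simp: below_def)
    then have "\<exists>f\<in>tree_automorphisms d. f ` below n = below n"
      using id by blast
    then show ?thesis
      using WM(1,3) [OF that, of n] WM(1,3) [OF one, of n] by (simp add: C_def tree_equivalence_def)
  qed
  have "infinite {W \<in> C n. has_block_structure d G W}" for n
  proof -
    have "inj_on (WM n) K"
      using WM_inj by (auto intro: inj_onI)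
    then have "infinite (WM n ` K)"
      using infinite_K finite_imageD by blast
    moreover have "WM n ` K \<subseteq> {W \<in> C n. has_block_structure d G W}"
      using mem WM(2) by auto
    ultimately show ?thesis
      using infinite_super by blast
  qed
  moreover have "C n \<in> {W. weakly_maximal d G W} // tree_equivalence d G" for n
    unfolding C_def using WM(1) [OF one] by (intro quotientI) simp
  ultimately have sub: "range C \<subseteq> {C \<in> {W. weakly_maximal d G W} // tree_equivalence d G.
                     infinite {W \<in> C. has_block_structure d G W}}"
    by blast
  have no: "C n \<noteq> C m" if "n < m" for n m
  proof
    assume "C n = C m"
    then have "WM m \<one> \<in> C n"
      using mem [OF one] by simp
    then have "\<exists>f\<in>tree_automorphisms d. f ` below n = below m"
      using WM(3) [OF one] by (auto simp: C_def tree_equivalence_def)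
    then show False
      using below_not_isomorphic that by blast
  qed
  have "inj C"
  proof (rule injI)
    fix n m assume "C n = C m"
    then show "n = m"
      using no [of n m] no [of m n] by (cases n m rule: linorder_cases) auto
  qed
  then have "infinite (range C)"
    using finite_imageD infinite_UNIV_nat by blast
  then show ?thesis
    using sub infinite_super by blast
qed

end

section \<open>Fractal groups\<close>

context regular_tree
begin

text \<open>A period \<open>n\<close> supplies the inverse \<open>f ^^ (n - 1)\<close>, so
  bijectivity and finite order come together; the generators are all given by recursive maps of
  known period.\<close>

lemma restrict_automorphism:
  assumes f: "\<And>w. w \<in> T \<Longrightarrow> f w \<in> T" "f [] = []" "\<And>u i. \<exists>j. f (u @ [i]) = f u @ [j]"
    and period: "n > 0" "\<And>w. w \<in> T \<Longrightarrow> (f ^^ n) w = w"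
  shows "restrict f T \<in> carrier A" "restrict f T [^] n = \<one>"
proof -
  obtain m where m: "n = Suc m"
    using period(1) by (cases n) auto
  have iter: "(f ^^ k) w \<in> T" if "w \<in> T" for k w
    using that f(1) by (induction k) auto
  have "f ((f ^^ m) w) = w" "(f ^^ m) (f w) = w" if "w \<in> T" for w
    using period(2) [OF that] by (simp_all add: m funpow_swap1)
  then have "bij_betw (restrict f T) T T"
    using f(1) iter by (intro bij_betwI [where g = "f ^^ m"]) auto
  moreover have "\<exists>j. restrict f T (u @ [i]) = restrict f T u @ [j]" if "u \<in> T" "i < d" for u i
    using that f(3) [of u i] by auto
  ultimately show closed: "restrict f T \<in> carrier A"
    unfolding carrier_iff using f(2) by (intro tree_automorphismI) auto
  define F where "F = restrict f T"
  have F: "F \<in> carrier A" "\<And>w. w \<in> T \<Longrightarrow> F w = f w"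
    using closed by (simp_all add: F_def)
  have "(F [^] k) w = (f ^^ k) w" if "w \<in> T" for k :: nat and w
    using that
  proof (induction k arbitrary: w)
    case (Suc k)
    then show ?case
      using F f(1) by (simp add: funpow_swap1)
  qed auto
  then have "(restrict f T [^] k) w = (f ^^ k) w" if "w \<in> T" for k :: nat and w
    unfolding F_def using that by blast
  then show "restrict f T [^] n = \<one>"
    using closed period(2) by (intro aut_eqI) auto
qed

lemma sec_restrict:
  assumes "restrict f T \<in> carrier A" "restrict f' T \<in> carrier A" "i < d"
    "\<And>w. w \<in> T \<Longrightarrow> f (i # w) = j # f' w"
  shows "sec [i] (restrict f T) = restrict f' T" "restrict f T [i] = [j]"
proof -
  have 1: "restrict f' T [] = []"
    using assms(2) by (rule apply_Nil)
  show 2: "restrict f T [i] = [j]"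
    using assms(3) assms(4) [of "[]"] 1 by simp
  show "sec [i] (restrict f T) = restrict f' T"
    using assms 2 by (intro sec_eqI) auto
qed

lemma restrict_id: "restrict (\<lambda>w. w) T = \<one>"
  by (simp add: A_def AutT_def BijGroup_def)

definition rot :: "nat list \<Rightarrow> nat list" where
  "rot = restrict (rooted_cycle d) T"

lemma rooted_cycle_funpow: "i < d \<Longrightarrow> (rooted_cycle d ^^ k) (i # w) = ((i + k) mod d) # w"
  by (induction k) (auto simp: mod_Suc_eq)

lemma rooted_cycle_snoc: "\<exists>j. rooted_cycle d (u @ [i]) = rooted_cycle d u @ [j]"
  by (cases u) auto

lemma rooted_cycle_in_tree: "w \<in> T \<Longrightarrow> rooted_cycle d w \<in> T"
  by (cases w) auto

lemma rooted_cycle_period: "w \<in> T \<Longrightarrow> (rooted_cycle d ^^ d) w = w"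
proof (cases w)
  case Nil
  have "(rooted_cycle d ^^ k) [] = []" for k
    by (induction k) auto
  then show ?thesis
    using Nil by simp
qed (simp add: rooted_cycle_funpow)

lemma rot:
  assumes "d > 0"
  shows rot_closed: "rot \<in> carrier A" and rot_period: "rot [^] d = \<one>"
  unfolding rot_def
  by (rule restrict_automorphism [where n = d];
      use assms rooted_cycle_in_tree rooted_cycle_snoc rooted_cycle_period in auto)+

lemma sec_rot: "i < d \<Longrightarrow> sec [i] rot = \<one>" and rot_apply: "i < d \<Longrightarrow> rot [i] = [(i + 1) mod d]"
proof -
  assume i: "i < d"
  have "restrict (\<lambda>w. w) T \<in> carrier A"
    by (simp add: restrict_id)
  then show "sec [i] rot = \<one>" "rot [i] = [(i + 1) mod d]"
    using sec_restrict [of "rooted_cycle d" "\<lambda>w. w" i "(i + 1) mod d"] i rot_closed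
    by (simp_all add: rot_def restrict_id)
qed

lemma level_Suc_0: "level (Suc 0) = (\<lambda>i. [i]) ` {..<d}"
  by (auto simp: level_def length_Suc_conv)

lemma first_level_eqI:
  assumes "g \<in> carrier A" "h \<in> carrier A" "\<And>i. i < d \<Longrightarrow> g [i] = h [i]"
    "\<And>i. i < d \<Longrightarrow> sec [i] g = sec [i] h"
  shows "g = h"
  by (rule level_eqI [OF assms(1,2), of "Suc 0"]) (use assms(3,4) level_Suc_0 in auto)

lemma sec_Cons: "g \<in> carrier A \<Longrightarrow> i < d \<Longrightarrow> w \<in> T \<Longrightarrow> sec (i # w) g = sec w (sec [i] g)"
  using sec_append [of g "[i]" w] by simp

lemma apply_Cons: "g \<in> carrier A \<Longrightarrow> i < d \<Longrightarrow> w \<in> T \<Longrightarrow> g (i # w) = g [i] @ sec [i] g w"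
  using apply_append [of g "[i]" w] by simp

end

text \<open>Only first-level data are required, mostly on generators; inductions over the generated
  subgroup and along vertices turn them into self-similarity, projections onto \<open>G\<close> at
  every vertex and level-transitivity.\<close>

locale fractal_group = regular_tree d A + subgroup_pair A G
  for d :: nat and A (structure) and G :: "(nat list \<Rightarrow> nat list) set" +
  fixes S :: "(nat list \<Rightarrow> nat list) set"
  assumes d_ge_2: "2 \<le> d"
    and G_def: "G = generate A S" and finite_S: "finite S"
    and torsion_S: "s \<in> S \<Longrightarrow> \<exists>m>0. s [^] (m::nat) = \<one>"
    and sec_S: "s \<in> S \<Longrightarrow> i < d \<Longrightarrow> sec [i] s \<in> G"
    and transitive_first: "i < d \<Longrightarrow> \<exists>g\<in>G. g [0] = [i]"
    and fractal_S: "s \<in> S \<Longrightarrow> \<exists>h\<in>G. h [0] = [0] \<and> sec [0] h = s"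
begin

lemma S_subset: "S \<subseteq> G"
  by (subst G_def) (rule generate_superset)

lemma sec_first_closed:
  assumes "g \<in> G" "i < d"
  shows "sec [i] g \<in> G"
proof -
  let ?H = "{g \<in> G. \<forall>i<d. sec [i] g \<in> G}"
  have move: "\<exists>j<d. g [i] = [j]" if "g \<in> G" "i < d" for g i
  proof -
    have "g [i] \<in> level (Suc 0)"
      using that mem_carrier by (simp add: level_def)
    then show ?thesis
      by (auto simp: level_Suc_0)
  qed
  have "subgroup ?H A"
  proof (rule subgroupI)
    show "?H \<subseteq> carrier A"
      using mem_carrier by blast
    have "\<one> \<in> ?H"
      by simp
    then show "?H \<noteq> {}"
      by blast
  next
    fix g assume g: "g \<in> ?H"
    then have gA: "g \<in> carrier A" "inv g \<in> G" "inv g \<in> carrier A"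
      using mem_carrier by auto
    have "sec [i] (inv g) \<in> G" if i: "i < d" for i
    proof -
      obtain j where j: "j < d" "(inv g) [i] = [j]"
        using move gA i by blast
      then have "[i] = g [j]"
        using gA(1) i apply_inv(2) [of g "[i]"] by simp
      then have "sec [i] (inv g) = inv (sec [j] g)"
        using sec_inv [of g "[j]"] gA(1) j by simp
      then show ?thesis
        using g j by simp
    qed
    then show "inv g \<in> ?H"
      using gA by simp
  next
    fix g h assume g: "g \<in> ?H" and h: "h \<in> ?H"
    have "sec [i] (g \<otimes> h) \<in> G" if i: "i < d" for i
    proof -
      obtain j where j: "j < d" "h [i] = [j]"
        using move h i by blast
      then show ?thesis
        using g h i mem_carrier by simp
    qed
    then show "g \<otimes> h \<in> ?H"
      using g h by simp
  qed
  moreover have "S \<subseteq> ?H"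
    using S_subset sec_S by blast
  ultimately have "generate A S \<subseteq> ?H"
    by (intro generate_subgroup_incl)
  then show ?thesis
    using assms G_def by blast
qed

lemma self_similar:
  assumes "g \<in> G" "v \<in> T"
  shows "sec v g \<in> G"
  using assms
proof (induction v arbitrary: g)
  case Nil
  then show ?case
    using mem_carrier by simp
next
  case (Cons i v)
  then show ?case
    using mem_carrier sec_first_closed sec_Cons [of g i v] by simp
qed

lemma zero_less_d: "0 < d"
  using d_ge_2 by simp

lemma fractal_zero:
  assumes "g \<in> G"
  shows "\<exists>h\<in>G. h [0] = [0] \<and> sec [0] h = g"
proof -
  let ?H = "{g \<in> G. \<exists>h\<in>G. h [0] = [0] \<and> sec [0] h = g}"
  have "subgroup ?H A"
  proof (rule subgroupI)
    show "?H \<subseteq> carrier A"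
      using mem_carrier by blast
    have "\<one> \<in> ?H"
      using zero_less_d by (auto intro!: bexI [of _ \<one>])
    then show "?H \<noteq> {}"
      by blast
  next
    fix g assume "g \<in> ?H"
    then obtain h where h: "h \<in> G" "h [0] = [0]" "sec [0] h = g" "g \<in> G"
      by blast
    then have "inv h \<in> G" "(inv h) [0] = [0]" "sec [0] (inv h) = inv g"
      using mem_carrier zero_less_d by (simp_all add: inv_fixes sec_inv_fixed)
    then show "inv g \<in> ?H"
      using h(4) by (metis (mono_tags, lifting) G_simps(2) mem_Collect_eq)
  next
    fix g g' assume "g \<in> ?H" "g' \<in> ?H"
    then obtain h h' where h: "h \<in> G" "h [0] = [0]" "sec [0] h = g" "g \<in> G"
      and h': "h' \<in> G" "h' [0] = [0]" "sec [0] h' = g'" "g' \<in> G"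
      by blast
    then have "h \<otimes> h' \<in> G" "(h \<otimes> h') [0] = [0]" "sec [0] (h \<otimes> h') = g \<otimes> g'"
      using mem_carrier zero_less_d by simp_all
    then show "g \<otimes> g' \<in> ?H"
      using h h' by (metis (mono_tags, lifting) G_simps(1) mem_Collect_eq)
  qed
  moreover have "S \<subseteq> ?H"
    using S_subset fractal_S by blast
  ultimately have "generate A S \<subseteq> ?H"
    by (intro generate_subgroup_incl)
  then show ?thesis
    using assms G_def by blast
qed

lemma fractal_first:
  assumes g: "g \<in> G" and i: "i < d"
  shows "\<exists>h\<in>G. h [i] = [i] \<and> sec [i] h = g"
proof -
  obtain t where t: "t \<in> G" "t [0] = [i]"
    using transitive_first i by blast
  let ?s = "sec [0] t"
  have s: "?s \<in> G" "?s \<in> carrier A" "t \<in> carrier A" "g \<in> carrier A"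
    using t g sec_first_closed zero_less_d mem_carrier by auto
  obtain h where h: "h \<in> G" "h [0] = [0]" "sec [0] h = inv ?s \<otimes> g \<otimes> ?s"
    using fractal_zero [of "inv ?s \<otimes> g \<otimes> ?s"] s g by auto
  have hA: "h \<in> carrier A"
    using h mem_carrier by blast
  have ti: "(inv t) [i] = [0]"
    using apply_inv(1) [of t "[0]"] t s zero_less_d by simp
  then have "sec [i] (inv t) = inv ?s"
    using sec_inv [of t "[0]"] t s zero_less_d by simp
  then have "sec [i] (t \<otimes> h \<otimes> inv t) = ?s \<otimes> (inv ?s \<otimes> g \<otimes> ?s) \<otimes> inv ?s"
    using ti h t s hA i zero_less_d by simp
  then have "sec [i] (t \<otimes> h \<otimes> inv t) = g"
    using s by (simp add: m_assoc)
  moreover have "(t \<otimes> h \<otimes> inv t) [i] = [i]"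
    using ti h t s hA i by simp
  ultimately show ?thesis
    using t h by (intro bexI [of _ "t \<otimes> h \<otimes> inv t"]) simp_all
qed

lemma fractal:
  assumes "g \<in> G" "v \<in> T"
  shows "\<exists>h\<in>G. h v = v \<and> sec v h = g"
  using assms
proof (induction v arbitrary: g)
  case Nil
  then show ?case
    using mem_carrier by (intro bexI [of _ g]) auto
next
  case (Cons i v)
  then obtain h where h: "h \<in> G" "h v = v" "sec v h = g"
    by auto
  obtain k where k: "k \<in> G" "k [i] = [i]" "sec [i] k = h"
    using fractal_first [OF h(1)] Cons by auto
  have "k (i # v) = i # v" "sec (i # v) k = g"
    using k h Cons mem_carrier apply_Cons [of k i v] sec_Cons [of k i v] by simp_all
  then show ?case
    using k(1) by blast
qed

text \<open>First letters are matched by \<open>t \<otimes> inv s\<close>, passing through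
  \<open>[0]\<close>; the remaining words are then corrected by an element fixing
  \<open>[j]\<close>, which fractality provides with any desired section.\<close>

lemma level_transitive:
  assumes "u \<in> T" "v \<in> T" "length u = length v"
  shows "\<exists>g\<in>G. g u = v"
  using assms(3,1,2)
proof (induction u v rule: list_induct2)
  case Nil
  then show ?case
    by (intro bexI [of _ \<one>]) auto
next
  case (Cons i u j v)
  have ij: "i < d" "j < d"
    using Cons.prems by auto
  obtain s where s: "s \<in> G" "s [0] = [i]"
    using transitive_first [OF ij(1)] by blast
  obtain t where t: "t \<in> G" "t [0] = [j]"
    using transitive_first [OF ij(2)] by blast
  let ?g = "t \<otimes> inv s"
  have si: "(inv s) [i] = [0]"
    using apply_inv(1) [of s "[0]"] s mem_carrier zero_less_d by simp
  have g: "?g \<in> G" "?g \<in> carrier A" "?g [i] = [j]"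
    using s t si Cons mem_carrier by simp_all
  let ?u = "sec [i] ?g u"
  have u: "?u \<in> T" "?g (i # u) = j # ?u"
    using g Cons sec_apply_in_tree [of ?g "[i]" u] apply_Cons [of ?g i u]
    by (simp_all del: sec_mult apply_mult)
  obtain h where h: "h \<in> G" "h u = v"
    using Cons by auto
  have sG: "sec [i] ?g \<in> G" "sec [i] ?g \<in> carrier A"
    using sec_first_closed [OF g(1)] Cons mem_carrier by (auto simp del: sec_mult)
  obtain k where k: "k \<in> G" "k [j] = [j]" "sec [j] k = h \<otimes> inv (sec [i] ?g)"
    using fractal_first [of "h \<otimes> inv (sec [i] ?g)" j] sG h Cons by (auto simp del: sec_mult)
  have "(h \<otimes> inv (sec [i] ?g)) ?u = v"
    using sG h Cons mem_carrier sec_apply_in_tree [of ?g "[i]" u] g(2) by (simp del: sec_mult)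
  then have "k (j # ?u) = j # v"
    using k Cons mem_carrier u apply_Cons [of k j ?u] by (simp del: sec_mult)
  then have "(k \<otimes> ?g) (i # u) = j # v"
    using apply_mult [of k ?g "i # u"] k g u Cons mem_carrier by (simp del: apply_mult)
  then show ?case
    using G_simps(1) [OF k(1) g(1)] by (rule bexI)
qed

text \<open>An element fixing \<open>[0]\<close> with section \<open>h\<close> conjugates copies at
  \<open>[0]\<close> as \<open>h\<close> conjugates the originals, and fractality provides one for
  each \<open>h\<close>. Branching can hence be tested on normal generators.\<close>

lemma nsub_ins_preimage:
  assumes N: "nsub N"
  shows "nsub {g \<in> G. inj_at [0] g \<in> N}"
  unfolding nsub_def
proof (intro conjI ballI)
  show "subgroup {g \<in> G. inj_at [0] g \<in> N} A"
  proof (rule subgroupI)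
    show "{g \<in> G. inj_at [0] g \<in> N} \<subseteq> carrier A"
      using mem_carrier by blast
    have "\<one> \<in> {g \<in> G. inj_at [0] g \<in> N}"
      using nsub_simps(4) [OF N] zero_less_d by simp
    then show "{g \<in> G. inj_at [0] g \<in> N} \<noteq> {}"
      by blast
  qed (use mem_carrier zero_less_d nsub_simps(5,6) [OF N] in \<open>auto simp: ins_mult ins_inv\<close>)
  fix h g assume h: "h \<in> G" and g: "g \<in> {g \<in> G. inj_at [0] g \<in> N}"
  obtain t where t: "t \<in> G" "t [0] = [0]" "sec [0] t = h"
    using fractal_zero h by blast
  have "t \<otimes> inj_at [0] g \<otimes> inv t = inj_at [0] (h \<otimes> g \<otimes> inv h)"
    using conj_ins [of t g "[0]"] t g mem_carrier zero_less_d by simp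
  then show "h \<otimes> g \<otimes> inv h \<in> {g \<in> G. inj_at [0] g \<in> N}"
    using nsub_simps(7) [OF N t(1), of "inj_at [0] g"] g h by simp
qed blast

text \<open>Conjugation carries copies at \<open>[0]\<close> to any first-level vertex, and copies
  at longer vertices are iterated first-level copies; so branching need only be checked at
  \<open>[0]\<close>.\<close>

lemma ins_mem_all:
  assumes N: "nsub N" and zero: "\<And>k. k \<in> N \<Longrightarrow> inj_at [0] k \<in> N" and "v \<in> T" "k \<in> N"
  shows "inj_at v k \<in> N"
  using assms(3)
proof (induction v)
  case Nil
  have "inj_at [] k = k"
    using nsub_simps(3) [OF N assms(4)] ins_apply [of "[]" _ k] by (intro aut_eqI ins_closed) simp_all
  then show ?case
    using assms(4) by simp
next
  case (Cons i v)
  let ?k = "inj_at v k"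
  have k: "?k \<in> N" "k \<in> carrier A" "?k \<in> carrier A"
    using Cons nsub_simps(3) [OF N] assms(4) by auto
  obtain t where t: "t \<in> G" "t [0] = [i]"
    using transitive_first Cons by auto
  let ?s = "sec [0] t"
  have s: "?s \<in> G" "?s \<in> carrier A" "t \<in> carrier A"
    using t sec_first_closed zero_less_d mem_carrier by auto
  have "t \<otimes> inj_at [0] (inv ?s \<otimes> ?k \<otimes> ?s) \<otimes> inv t = inj_at [i] ?k"
    using conj_ins [of t "inv ?s \<otimes> ?k \<otimes> ?s" "[0]"] t s k zero_less_d by (simp add: m_assoc)
  then have "inj_at [i] ?k \<in> N"
    using nsub_simps(7) [OF N t(1) zero [OF nsub_simps(8) [OF N s(1) k(1)]]] by simp
  then show ?case
    using ins_append [of k "[i]" v] k Cons by simp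
qed

text \<open>The projection at \<open>v\<close> of the stabilizer of \<open>v\<close> in gamma_3; the
  remaining branch hypothesis asks for some \<open>v\<close> where it is all of
  \<open>G\<close>.\<close>

definition sections :: "nat list \<Rightarrow> (nat list \<Rightarrow> nat list) set" where
  "sections v = {sec v k | k. k \<in> lcs 2 \<and> k v = v}"

lemma nsub_sections:
  assumes v: "v \<in> T"
  shows "nsub (sections v)"
proof -
  note N = nsub_simps [OF nsub_lcs [of 2]]
  have sub: "sections v \<subseteq> G"
    using N(2) self_similar v by (auto simp: sections_def)
  have "subgroup (sections v) A"
  proof (rule subgroupI)
    show "sections v \<subseteq> carrier A"
      using sub mem_carrier by blast
    have "sec v \<one> \<in> sections v"
      unfolding sections_def using N(4) v by (intro CollectI exI [of _ \<one>]) simp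
    then show "sections v \<noteq> {}"
      by blast
  next
    fix g assume "g \<in> sections v"
    then obtain k where k: "k \<in> lcs 2" "k v = v" "g = sec v k"
      by (auto simp: sections_def)
    then have "inv k \<in> lcs 2 \<and> (inv k) v = v \<and> inv g = sec v (inv k)"
      using N(3,6) v by (simp add: inv_fixes sec_inv_fixed)
    then show "inv g \<in> sections v"
      unfolding sections_def by blast
  next
    fix g h assume "g \<in> sections v" "h \<in> sections v"
    then obtain k l where "k \<in> lcs 2" "k v = v" "g = sec v k" "l \<in> lcs 2" "l v = v" "h = sec v l"
      by (auto simp: sections_def)
    then have "k \<otimes> l \<in> lcs 2 \<and> (k \<otimes> l) v = v \<and> g \<otimes> h = sec v (k \<otimes> l)"
      using N(3,5) v by simp
    then show "g \<otimes> h \<in> sections v"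
      unfolding sections_def by blast
  qed
  moreover have "g \<otimes> n \<otimes> inv g \<in> sections v" if g: "g \<in> G" and n: "n \<in> sections v" for g n
  proof -
    obtain k where k: "k \<in> lcs 2" "k v = v" "n = sec v k"
      using n by (auto simp: sections_def)
    obtain h where h: "h \<in> G" "h v = v" "sec v h = g"
      using fractal g v by blast
    have "h \<otimes> k \<otimes> inv h \<in> lcs 2"
      using N(7) h(1) k(1) .
    moreover have "(h \<otimes> k \<otimes> inv h) v = v \<and> g \<otimes> n \<otimes> inv g = sec v (h \<otimes> k \<otimes> inv h)"
      using h k mem_carrier N(3) v by (simp add: inv_fixes sec_inv_fixed)
    ultimately show ?thesis
      unfolding sections_def by blast
  qed
  ultimately show ?thesis
    using sub by (simp add: nsub_def)
qed

lemma sections_append: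
  assumes "g \<in> sections v" "g u = u" "v \<in> T" "u \<in> T"
  shows "sec u g \<in> sections (v @ u)"
proof -
  obtain k where k: "k \<in> lcs 2" "k v = v" "g = sec v k"
    using assms by (auto simp: sections_def)
  then have "k (v @ u) = v @ u \<and> sec u g = sec (v @ u) k"
    using assms nsub_simps(3) [OF nsub_lcs k(1)] by (simp add: apply_append sec_append)
  then show ?thesis
    unfolding sections_def using k(1) by blast
qed

lemma branch:
  assumes ins: "\<And>k. k \<in> lcs 2 \<Longrightarrow> inj_at [0] k \<in> lcs 2"
    and v: "v \<in> T" and S: "S \<subseteq> sections v"
  shows "branch_setup d A G (lcs 2) v"
proof
  fix g assume "g \<in> G"
  moreover have "generate A S \<subseteq> sections v"
    using S nsub_simps(1) [OF nsub_sections [OF v]] by (rule generate_subgroup_incl)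
  ultimately have "g \<in> sections v"
    using G_def by blast
  then show "\<exists>k\<in>lcs 2. k v = v \<and> sec v k = g"
    by (auto simp: sections_def)
next
  have "gcomm (lcs 2) = lcs (Suc 2)"
    by (simp only: lcs.simps)
  then show "finite ((\<lambda>x. gcomm (lcs 2) #> x) ` G)"
    using finite_cosets_lcs [OF G_def finite_S torsion_S, of "Suc 2"] by simp
  show "inj_at u k \<in> lcs 2" if "u \<in> T" "k \<in> lcs 2" for u k
    by (rule ins_mem_all [OF nsub_lcs ins that])
qed (fact d_ge_2 self_similar level_transitive nsub_lcs v)+

text \<open>Inserting preimages below \<open>[0]\<close> moves members found at different depths to
  a common deeper vertex.\<close>

lemma sections_mono:
  assumes ins: "\<And>k. k \<in> lcs 2 \<Longrightarrow> inj_at [0] k \<in> lcs 2" and v: "v \<in> T"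
  shows "sections v \<subseteq> sections (0 # v)"
proof
  fix g assume "g \<in> sections v"
  then obtain k where k: "k \<in> lcs 2" "k v = v" "g = sec v k"
    by (auto simp: sections_def)
  then have "(inj_at [0] k) (0 # v) = 0 # v \<and> g = sec (0 # v) (inj_at [0] k)"
    using v nsub_simps(3) [OF nsub_lcs k(1)] zero_less_d apply_Cons [of "inj_at [0] k" 0 v]
      sec_Cons [of "inj_at [0] k" 0 v] by simp
  then show "g \<in> sections (0 # v)"
    unfolding sections_def using ins [OF k(1)] by blast
qed

end

section \<open>The first Grigorchuk group\<close>

lemma funpow_2: "(f ^^ 2) w = f (f w)"
  by (simp add: numeral_2_eq_2)

lemma less_2_iff: "i < 2 \<longleftrightarrow> i = 0 \<or> i = (1::nat)"
  by auto

lemma grig_in_tree: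
  "w \<in> tree 2 \<Longrightarrow> grig_b w \<in> tree 2" "w \<in> tree 2 \<Longrightarrow> grig_c w \<in> tree 2" "w \<in> tree 2 \<Longrightarrow> grig_d w \<in> tree 2"
proof (induction w)
  case (Cons i w)
  have "w \<in> tree 2 \<Longrightarrow> rooted_cycle 2 w \<in> tree 2"
    by (cases w) auto
  with Cons show "i # w \<in> tree 2 \<Longrightarrow> grig_b (i # w) \<in> tree 2"
    "i # w \<in> tree 2 \<Longrightarrow> grig_c (i # w) \<in> tree 2" "i # w \<in> tree 2 \<Longrightarrow> grig_d (i # w) \<in> tree 2"
    by auto
qed auto

lemma grig_snoc:
  "\<exists>j. grig_b (u @ [i]) = grig_b u @ [j]" "\<exists>j. grig_c (u @ [i]) = grig_c u @ [j]"
  "\<exists>j. grig_d (u @ [i]) = grig_d u @ [j]"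
proof (induction u)
  case (Cons k u)
  have "\<exists>j. rooted_cycle 2 (u @ [i]) = rooted_cycle 2 u @ [j]"
    by (cases u) auto
  with Cons show "\<exists>j. grig_b ((k # u) @ [i]) = grig_b (k # u) @ [j]"
    "\<exists>j. grig_c ((k # u) @ [i]) = grig_c (k # u) @ [j]"
    "\<exists>j. grig_d ((k # u) @ [i]) = grig_d (k # u) @ [j]"
    by auto
qed auto

lemma rooted_cycle_2: "w \<in> tree 2 \<Longrightarrow> rooted_cycle 2 (rooted_cycle 2 w) = w"
  by (cases w) (auto simp: less_2_iff)

lemma grig_involution:
  "w \<in> tree 2 \<Longrightarrow> grig_b (grig_b w) = w" "w \<in> tree 2 \<Longrightarrow> grig_c (grig_c w) = w"
  "w \<in> tree 2 \<Longrightarrow> grig_d (grig_d w) = w"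
  by (induction w) (auto simp: rooted_cycle_2)

lemma grig_mult:
  "w \<in> tree 2 \<Longrightarrow> grig_b (grig_d w) = grig_c w" "w \<in> tree 2 \<Longrightarrow> grig_d (grig_b w) = grig_c w"
  "w \<in> tree 2 \<Longrightarrow> grig_b (grig_c w) = grig_d w" "w \<in> tree 2 \<Longrightarrow> grig_c (grig_b w) = grig_d w"
  "w \<in> tree 2 \<Longrightarrow> grig_c (grig_d w) = grig_b w" "w \<in> tree 2 \<Longrightarrow> grig_d (grig_c w) = grig_b w"
  by (induction w) (auto simp: rooted_cycle_2)

locale grigorchuk = regular_tree 2 A for A (structure)
begin

text \<open>The generator usually called \<open>d\<close> is \<open>e\<close> here, \<open>d\<close> being the degree of the tree.\<close>

definition b where "b = restrict grig_b T"
definition c where "c = restrict grig_c T"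
definition e where "e = restrict grig_d T"

abbreviation a where "a \<equiv> rot"

lemma closed [simp]: "a \<in> carrier A" "b \<in> carrier A" "c \<in> carrier A" "e \<in> carrier A"
  and period: "a [^] (2::nat) = \<one>" "b [^] (2::nat) = \<one>" "c [^] (2::nat) = \<one>" "e [^] (2::nat) = \<one>"
  unfolding b_def c_def e_def
  by (rule rot restrict_automorphism [where n = 2];
      use grig_in_tree grig_snoc grig_involution in \<open>auto simp: funpow_2\<close>)+

lemma square [simp]: "a \<otimes> a = \<one>" "b \<otimes> b = \<one>" "c \<otimes> c = \<one>" "e \<otimes> e = \<one>"
proof -
  have "x [^] (2::nat) = x \<otimes> x" if "x \<in> carrier A" for x
    using that by (simp add: numeral_2_eq_2)
  then show "a \<otimes> a = \<one>" "b \<otimes> b = \<one>" "c \<otimes> c = \<one>" "e \<otimes> e = \<one>"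
    using period closed by metis+
qed

lemma square_cancel [simp]:
  assumes "x \<in> carrier A"
  shows "a \<otimes> (a \<otimes> x) = x" "b \<otimes> (b \<otimes> x) = x" "c \<otimes> (c \<otimes> x) = x" "e \<otimes> (e \<otimes> x) = x"
  using assms by (simp_all add: m_assoc [symmetric])

lemma inv_gen [simp]: "inv a = a" "inv b = b" "inv c = c" "inv e = e"
  by (rule inv_equality; simp)+

lemma apply_gen [simp]:
  "a [0] = [1]" "a [Suc 0] = [0]" "b [0] = [0]" "b [Suc 0] = [Suc 0]"
  "c [0] = [0]" "c [Suc 0] = [Suc 0]" "e [0] = [0]" "e [Suc 0] = [Suc 0]"
  by (simp_all add: rot_apply b_def c_def e_def)

lemma sec_gen [simp]:
  "sec [0] a = \<one>" "sec [Suc 0] a = \<one>" "sec [0] b = a" "sec [Suc 0] b = c"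
  "sec [0] c = a" "sec [Suc 0] c = e" "sec [0] e = \<one>" "sec [Suc 0] e = b"
proof -
  show "sec [0] a = \<one>" "sec [Suc 0] a = \<one>"
    by (simp_all add: sec_rot)
  note cl = closed [unfolded rot_def b_def c_def e_def]
  show "sec [0] b = a" "sec [0] c = a"
    unfolding rot_def b_def c_def using cl
    by (intro sec_restrict(1) [where j = 0]; simp)+
  show "sec [Suc 0] b = c" "sec [Suc 0] c = e" "sec [Suc 0] e = b"
    unfolding rot_def b_def c_def e_def using cl
    by (intro sec_restrict(1) [where j = 1]; simp)+
  show "sec [0] e = \<one>"
    unfolding e_def restrict_id [symmetric] using cl
    by (intro sec_restrict(1) [where j = 0]; simp add: restrict_id)
qed

lemma apply_word: "w \<in> T \<Longrightarrow> b w = grig_b w" "w \<in> T \<Longrightarrow> c w = grig_c w" "w \<in> T \<Longrightarrow> e w = grig_d w"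
  by (simp_all add: b_def c_def e_def)

lemma klein:
  "b \<otimes> e = c" "e \<otimes> b = c" "b \<otimes> c = e" "c \<otimes> b = e" "c \<otimes> e = b" "e \<otimes> c = b"
  by (rule aut_eqI; simp add: apply_word grig_in_tree grig_mult)+

text \<open>The generator \<open>c\<close> is dropped, being \<open>b \<otimes> e\<close>; this
  shortens the case analysis over triple commutators in \<open>ins_lcs\<close>.\<close>

definition G where "G = generate A {a, b, e}"

lemma G_eq: "grigorchuk_group = G"
proof -
  have gens: "(\<lambda>f. restrict f T) ` {rooted_cycle 2, grig_b, grig_c, grig_d} = {a, b, c, e}"
    by (simp add: rot_def b_def c_def e_def)
  have "generate A {a, b, c, e} = generate A {a, b, e}"
  proof
    have sub: "subgroup (generate A {a, b, e}) A"
      by (rule generate_is_subgroup) simp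
    have "{a, b, e} \<subseteq> generate A {a, b, e}"
      by (auto intro: generate.incl)
    moreover from this have "c \<in> generate A {a, b, e}"
      using subgroup.m_closed [OF sub, of b e] klein(1) by simp
    ultimately show "generate A {a, b, c, e} \<subseteq> generate A {a, b, e}"
      by (intro generate_subgroup_incl sub) simp
    show "generate A {a, b, e} \<subseteq> generate A {a, b, c, e}"
      by (rule mono_generate) auto
  qed
  then show ?thesis
    unfolding grigorchuk_group_def gens A_def [symmetric] G_def .
qed

lemma gens_in_G: "a \<in> G" "b \<in> G" "c \<in> G" "e \<in> G"
proof -
  show *: "a \<in> G" "b \<in> G" "e \<in> G"
    unfolding G_def by (auto intro: generate.incl)
  show "c \<in> G"
    using generate.eng [of b A "{a, b, e}" e] * klein(1) by (simp add: G_def)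
qed

lemma subgroup_grigorchuk: "subgroup G A"
  unfolding G_def by (rule generate_is_subgroup) simp

sublocale subgroup_pair A G
  by (intro subgroup_pair.intro is_group subgroup_pair_axioms.intro subgroup_grigorchuk)

sublocale fractal_group 2 A G "{a, b, e}"
proof
  note sub = subgroup_grigorchuk
  have one: "\<one> \<in> G" and aba: "a \<otimes> e \<otimes> a \<in> G"
    using subgroup.one_closed [OF sub] subgroup.m_closed [OF sub] gens_in_G by auto
  show "\<exists>m>0. s [^] (m::nat) = \<one>" if "s \<in> {a, b, e}" for s
    using that period by (intro exI [of _ 2]) auto
  show "sec [i] s \<in> G" if "s \<in> {a, b, e}" "i < 2" for s i
    using that gens_in_G one by (auto simp: less_2_iff)
  show "\<exists>g\<in>G. g [0] = [i]" if "i < 2" for i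
    using that gens_in_G one by (auto simp: less_2_iff intro: bexI [of _ \<one>] bexI [of _ a])
  have aca: "a \<otimes> c \<otimes> a \<in> G"
    using subgroup.m_closed [OF sub] gens_in_G by auto
  \<comment> \<open>At \<open>[0]\<close> the section of \<open>b\<close> is \<open>a\<close>;
    conjugating by \<open>a\<close> exposes the sections at \<open>[1]\<close>, giving
    \<open>b\<close> from \<open>e\<close> and \<open>e\<close> from \<open>c\<close>.\<close>
  show "\<exists>h\<in>G. h [0] = [0] \<and> sec [0] h = s" if "s \<in> {a, b, e}" for s
    using that gens_in_G(2) aba aca
    by (auto intro: bexI [of _ b] bexI [of _ "a \<otimes> e \<otimes> a"] bexI [of _ "a \<otimes> c \<otimes> a"])
qed (auto simp: G_def)

text \<open>Here \<open>(a e)^4 = 1\<close>, so \<open>a\<close> and \<open>e\<close> generate a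
  dihedral group in which \<open>[a, e] = (a e)^2\<close> is central.\<close>

lemma ae: "commutator a e \<otimes> e = e \<otimes> commutator a e" "commutator a e \<otimes> a = a \<otimes> commutator a e"
proof -
  have "a \<otimes> e \<otimes> a \<otimes> e = e \<otimes> a \<otimes> e \<otimes> a"
    by (rule first_level_eqI) (auto simp: less_2_iff)
  then have 1: "commutator a e = e \<otimes> a \<otimes> e \<otimes> a" and 2: "commutator a e = a \<otimes> e \<otimes> a \<otimes> e"
    by (simp_all add: commutator_def)
  have "commutator a e \<otimes> e = a \<otimes> e \<otimes> a" "a \<otimes> commutator a e = e \<otimes> a \<otimes> e"
    unfolding 2 by (simp_all add: m_assoc)
  moreover have "e \<otimes> commutator a e = a \<otimes> e \<otimes> a" "commutator a e \<otimes> a = e \<otimes> a \<otimes> e"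
    unfolding 1 by (simp_all add: m_assoc)
  ultimately show "commutator a e \<otimes> e = e \<otimes> commutator a e" "commutator a e \<otimes> a = a \<otimes> commutator a e"
    by simp_all
qed

text \<open>On the first level \<open>[a, e]\<close> is \<open>(b, b)\<close> and \<open>b\<close>
  is \<open>(a, c)\<close>. As \<open>b\<close> and \<open>c\<close> commute, only the first
  coordinate of their commutator survives.\<close>

lemma ins_commutator_ba: "inj_at [0] (commutator b a) = commutator (commutator a e) b"
proof (rule first_level_eqI)
  fix i :: nat assume "i < 2"
  then have i: "i = 0 \<or> i = Suc 0"
    by (auto simp: less_2_iff)
  then show "inj_at [0] (commutator b a) [i] = commutator (commutator a e) b [i]"
    by (auto simp: ins_fixes_incomparable word_simps)
  from i show "sec [i] (inj_at [0] (commutator b a)) = sec [i] (commutator (commutator a e) b)"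
    by (auto simp: sec_ins_incomparable word_simps klein)
qed auto

text \<open>The generators \<open>b\<close> and \<open>e\<close> commute with \<open>b\<close>, so
  the single commutator \<open>[b, a]\<close> controls all commutators with
  \<open>b\<close>.\<close>

lemma commutator_with_b:
  assumes Q: "nsub Q" and ba: "commutator b a \<in> Q" and g: "g \<in> G"
  shows "commutator g b \<in> Q" "commutator b g \<in> Q"
proof -
  have "commutator a b \<in> Q"
    using nsub_simps(6) [OF Q ba] by (simp add: inv_commutator)
  moreover have "commutator b b = \<one>" "commutator e b = \<one>"
    by (rule commutator_trivial; simp add: klein)+
  ultimately have *: "commutator s t \<in> Q" if "s \<in> {a, b, e}" "t \<in> {b}" for s t
    using that nsub_simps(4) [OF Q] by auto
  show 1: "commutator g b \<in> Q"
    by (rule commutator_generate [OF Q, of "{a, b, e}" "{b}"])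
      (use g gens_in_G * in \<open>simp_all add: G_def [symmetric] generate.incl\<close>)
  show "commutator b g \<in> Q"
    using nsub_simps(6) [OF Q 1] g by (simp add: inv_commutator mem_carrier)
qed

text \<open>It suffices to place triple commutators of generators in the normal preimage
  \<open>?Q\<close>. Those involving \<open>b\<close> follow from \<open>[b, a]\<close>, supplied by
  \<open>ins_commutator_ba\<close>; the others are trivial because \<open>[a, e]\<close> commutes
  with \<open>a\<close> and \<open>e\<close>.\<close>

lemma ins_lcs:
  assumes "k \<in> lcs 2"
  shows "inj_at [0] k \<in> lcs 2"
proof -
  let ?Q = "{g \<in> G. inj_at [0] g \<in> lcs 2}"
  have Q: "nsub ?Q"
    by (rule nsub_ins_preimage [OF nsub_lcs])
  have ba: "commutator b a \<in> ?Q"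
  proof -
    have "commutator a e \<in> lcs 1"
      using commutator_in_lcs [of a e 0] gens_in_G by simp
    then have "commutator b (commutator a e) \<in> lcs 2"
      using commutator_in_lcs [of b _ 1] gens_in_G by (simp add: numeral_2_eq_2)
    then have "inv (commutator b (commutator a e)) \<in> lcs 2"
      by (rule nsub_simps(6) [OF nsub_lcs])
    then show ?thesis
      using gens_in_G by (simp add: inv_commutator ins_commutator_ba)
  qed
  have "lcs 2 \<subseteq> ?Q"
  proof (rule lcs_2_subset [OF _ Q])
    fix r s t assume rst: "r \<in> {a, b, e}" "s \<in> {a, b, e}" "t \<in> {a, b, e}"
    then have rG: "r \<in> G" "s \<in> G" "t \<in> G"
      using gens_in_G by auto
    consider "s = b" | "t = b" | "r = b" | "s = t" | "r \<noteq> b" "s = a" "t = e" | "r \<noteq> b" "s = e" "t = a"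
      using rst by blast
    then show "commutator r (commutator s t) \<in> ?Q"
    proof cases
      case 1
      then show ?thesis
        using commutator_in_nsub(1) [OF Q rG(1) commutator_with_b(2) [OF Q ba rG(3)]] by simp
    next
      case 2
      then show ?thesis
        using commutator_in_nsub(1) [OF Q rG(1) commutator_with_b(1) [OF Q ba rG(2)]] by simp
    next
      case 3
      then show ?thesis
        using commutator_with_b(2) [OF Q ba] rG by simp
    next
      case 4
      then have "commutator r (commutator s t) = \<one>"
        using rG by (simp add: commutator_trivial mem_carrier)
      then show ?thesis
        using nsub_simps(4) [OF Q] by simp
    next
      case 5
      then have "commutator r (commutator s t) = \<one>"
        using rst ae by (intro commutator_trivial) auto
      then show ?thesis
        using nsub_simps(4) [OF Q] by simp
    next
      case 6
      have "commutator e a = inv (commutator a e)"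
        by (simp add: inv_commutator)
      moreover have "r \<otimes> commutator a e = commutator a e \<otimes> r" "r \<in> carrier A"
        using 6 rst ae by auto
      then have "r \<otimes> inv (commutator a e) = inv (commutator a e) \<otimes> r"
        by (intro commute_inv) auto
      ultimately have "commutator r (commutator s t) = \<one>"
        using 6 rst by (intro commutator_trivial) auto
      then show ?thesis
        using nsub_simps(4) [OF Q] by simp
    qed
  qed (simp add: G_def)
  then show ?thesis
    using assms by blast
qed

text \<open>One starts from \<open>[b, a]\<close> at depth one. Its section at \<open>[0]\<close> is
  \<open>a c\<close>; the square of \<open>a c\<close> then gives \<open>e a\<close>, the commutator
  of \<open>a c\<close> with \<open>e\<close> gives \<open>b\<close>, and \<open>b\<close> gives
  \<open>a\<close> at depth four. \<open>sections_mono\<close> brings \<open>b\<close> and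
  \<open>e a\<close> down to that vertex.\<close>

lemma sections_gens: "{a, b, e} \<subseteq> sections [0, 0, 0, 0]"
proof -
  note mono = sections_mono [OF ins_lcs]
  note N = nsub_simps [OF nsub_sections]
  have step: "sec [0] g \<in> sections (v @ [0])" if "g \<in> sections v" "g [0] = [0]" "v \<in> T" for g v
    using that by (intro sections_append) auto
  have "commutator a e \<in> lcs 1"
    using commutator_in_lcs [of a e 0] gens_in_G by simp
  then have "commutator b (commutator a e) \<in> lcs 2"
    using commutator_in_lcs [of b _ 1] gens_in_G by (simp add: numeral_2_eq_2)
  then have "inv (commutator b (commutator a e)) \<in> lcs 2"
    by (rule nsub_simps(6) [OF nsub_lcs])
  then have "inj_at [0] (commutator b a) \<in> lcs 2"
    using gens_in_G by (simp add: inv_commutator ins_commutator_ba)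
  then have "sec [0] (inj_at [0] (commutator b a)) \<in> sections [0]"
    unfolding sections_def by (intro CollectI exI [of _ "inj_at [0] (commutator b a)"]) simp
  then have "commutator b a \<in> sections [0]"
    by simp
  then have "sec [0] (commutator b a) \<in> sections [0, 0]"
    using step [of "commutator b a" "[0]"] by (simp add: word_simps)
  then have 2: "a \<otimes> c \<in> sections [0, 0]"
    by (simp add: word_simps)
  have "(a \<otimes> c) \<otimes> (a \<otimes> c) \<in> sections [0, 0]"
    using N(5) [OF _ 2 2] by simp
  from step [OF this] have ea: "e \<otimes> a \<in> sections [0, 0, 0]"
    by (simp add: m_assoc)
  have "(a \<otimes> c) \<otimes> (e \<otimes> inv (a \<otimes> c) \<otimes> inv e) \<in> sections [0, 0]"
    using N(5) [OF _ 2 N(7) [OF _ gens_in_G(4) N(6) [OF _ 2]]] by simp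
  from step [OF this] have b: "b \<in> sections [0, 0, 0]"
    by (simp add: word_simps klein)
  from step [OF b] have a4: "a \<in> sections [0, 0, 0, 0]"
    by simp
  have 4: "b \<in> sections [0, 0, 0, 0]" "e \<otimes> a \<in> sections [0, 0, 0, 0]"
    using b ea mono [of "[0, 0, 0]"] by auto
  have "(e \<otimes> a) \<otimes> a \<in> sections [0, 0, 0, 0]"
    using N(5) [OF _ 4(2) a4] by simp
  then show ?thesis
    using a4 4 by (simp add: m_assoc)
qed

lemma branch_setup_grigorchuk: "branch_setup 2 A grigorchuk_group (lcs 2) [0, 0, 0, 0]"
  unfolding G_eq by (rule branch) (use ins_lcs sections_gens in auto)

end

section \<open>GGS groups\<close>

lemma (in group) int_pow_generates:
  fixes n x :: int
  assumes H: "subgroup H G" and g: "g \<in> carrier G" and "g [^] n = \<one>" "coprime x n" "g [^] x \<in> H"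
  shows "g \<in> H"
proof -
  obtain u v where uv: "u * x + v * n = 1"
    using bezout_int [of x n] assms(4) by (auto simp: coprime_iff_gcd_eq_1)
  have "g = g [^] (x * u + n * v)"
    using uv g by (simp add: int_pow_1 mult.commute)
  also have "\<dots> = (g [^] x) [^] u \<otimes> (g [^] n) [^] v"
    using g by (simp add: int_pow_mult int_pow_pow)
  also have "\<dots> = (g [^] x) [^] u"
    using g assms(3) by (simp add: int_pow_one)
  finally show ?thesis
    using subgroup_int_pow_closed [OF H assms(5), of u] by simp
qed

lemma (in regular_tree) sec_int_pow_fixed:
  fixes k :: int
  assumes g: "g \<in> carrier A" and v: "v \<in> T" "g v = v"
  shows "(g [^] k) v = v" "sec v (g [^] k) = (sec v g) [^] k"
proof -
  have nat: "(g [^] n) v = v \<and> sec v (g [^] n) = (sec v g) [^] n" for n :: nat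
    using assms by (induction n) auto
  have "(g [^] k) v = v \<and> sec v (g [^] k) = (sec v g) [^] k"
  proof (cases k rule: int_cases2)
    case (nonneg n)
    then show ?thesis
      using nat [of n] by (simp add: int_pow_int)
  next
    case (nonpos n)
    then show ?thesis
      using nat [of n] g v by (simp add: int_pow_neg int_pow_int inv_fixes sec_inv_fixed)
  qed
  then show "(g [^] k) v = v" "sec v (g [^] k) = (sec v g) [^] k"
    by auto
qed

locale ggs = regular_tree p A for p :: nat and A (structure) +
  fixes \<epsilon> :: "nat \<Rightarrow> nat"
  assumes prime_p: "prime p" and \<epsilon>: "defining_vector p \<epsilon>"
begin

lemma p_ge_2: "2 \<le> p" and p_pos [simp]: "0 < p"
  using prime_p prime_ge_2_nat [of p] by auto

lemma prime_int_p: "prime (int p)"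
  using prime_p by simp

definition b where "b = restrict (ggs_b p \<epsilon>) T"
abbreviation a where "a \<equiv> rot"

lemma rooted_cycle_funpow_in_tree: "w \<in> T \<Longrightarrow> (rooted_cycle p ^^ k) w \<in> T"
  by (induction k) (auto simp: rooted_cycle_in_tree)

lemma rooted_cycle_funpow_snoc: "\<exists>j. (rooted_cycle p ^^ k) (u @ [i]) = (rooted_cycle p ^^ k) u @ [j]"
proof (induction k)
  case (Suc k)
  then obtain j where "(rooted_cycle p ^^ k) (u @ [i]) = (rooted_cycle p ^^ k) u @ [j]"
    by blast
  then show ?case
    using rooted_cycle_snoc by simp
qed simp

lemma rooted_cycle_funpow_period:
  assumes w: "w \<in> T"
  shows "(rooted_cycle p ^^ (k * p)) w = w"
proof (induction k)
  case (Suc k)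
  have "(rooted_cycle p ^^ (Suc k * p)) w = (rooted_cycle p ^^ p) ((rooted_cycle p ^^ (k * p)) w)"
    by (simp add: funpow_add)
  then show ?case
    using Suc w rooted_cycle_period by simp
qed simp

lemma ggs_b_in_tree: "w \<in> T \<Longrightarrow> ggs_b p \<epsilon> w \<in> T"
  by (induction w) (auto simp: rooted_cycle_funpow_in_tree)

lemma ggs_b_snoc: "\<exists>j. ggs_b p \<epsilon> (u @ [i]) = ggs_b p \<epsilon> u @ [j]"
proof (induction u)
  case Nil
  have "(rooted_cycle p ^^ k) [] = []" for k
    by (induction k) auto
  then show ?case
    by simp
next
  case (Cons k u)
  then show ?case
    using rooted_cycle_funpow_snoc [of "\<epsilon> k" u i] by auto
qed

lemma ggs_b_funpow:
  "(ggs_b p \<epsilon> ^^ n) (i # w) =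
     i # (if i < p - 1 then (rooted_cycle p ^^ (\<epsilon> i * n)) w else (ggs_b p \<epsilon> ^^ n) w)"
  by (induction n) (auto simp: funpow_add)

lemma ggs_b_period: "w \<in> T \<Longrightarrow> (ggs_b p \<epsilon> ^^ p) w = w"
proof (induction w)
  case Nil
  have "(ggs_b p \<epsilon> ^^ k) [] = []" for k
    by (induction k) auto
  then show ?case
    by simp
next
  case (Cons i w)
  then show ?case
    by (simp add: ggs_b_funpow rooted_cycle_funpow_period)
qed

lemma closed [simp]: "a \<in> carrier A" "b \<in> carrier A"
  and period: "a [^] p = \<one>" "b [^] p = \<one>"
  unfolding b_def
  by (rule rot restrict_automorphism [where n = p];
      use ggs_b_in_tree ggs_b_snoc ggs_b_period in \<open>auto simp: rot_closed rot_period\<close>)+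

lemma int_period: "a [^] int p = \<one>" "b [^] int p = \<one>"
  using period by (simp_all add: int_pow_int)

lemma int_period_dvd:
  assumes "int p dvd k"
  shows "a [^] k = \<one>" "b [^] k = \<one>"
proof -
  obtain m where "k = int p * m"
    using assms by (auto simp: dvd_def)
  then have "a [^] k = (a [^] int p) [^] m" "b [^] k = (b [^] int p) [^] m"
    by (simp_all add: int_pow_pow)
  then show "a [^] k = \<one>" "b [^] k = \<one>"
    by (simp_all add: int_period int_pow_one)
qed

text \<open>First-level vertices are indexed by integers modulo \<open>p\<close>, so that shifts,
  differences and negatives of indices need no wrap-around.\<close>

definition vtx :: "int \<Rightarrow> nat list" where
  "vtx j = [nat (j mod int p)]"

lemma nat_mod_less [simp]: "nat (j mod int p) < p"
  by (simp add: nat_less_iff)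

lemma vtx_in_tree [simp]: "vtx j \<in> T"
  by (simp add: vtx_def)

lemma vtx_of_nat: "i < p \<Longrightarrow> vtx (int i) = [i]"
  by (simp add: vtx_def)

lemma vtx_0: "vtx 0 = [0]"
  by (simp add: vtx_def)

lemma vtx_eq_iff: "vtx i = vtx j \<longleftrightarrow> int p dvd (i - j)"
  by (simp add: vtx_def eq_nat_nat_iff mod_eq_dvd_iff)

lemma first_level_vtx_eqI:
  assumes "g \<in> carrier A" "h \<in> carrier A" "\<And>j. g (vtx j) = h (vtx j)" "\<And>j. sec (vtx j) g = sec (vtx j) h"
  shows "g = h"
  by (rule first_level_eqI [OF assms(1,2)]) (use assms(3,4) vtx_of_nat in metis)+

lemma a_vtx: "a (vtx j) = vtx (j + 1)" "sec (vtx j) a = \<one>"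
proof -
  have "int ((nat (j mod int p) + 1) mod p) = (j + 1) mod int p"
    by (simp add: zmod_int mod_simps add.commute)
  then show "a (vtx j) = vtx (j + 1)"
    by (simp add: vtx_def rot_apply flip: nat_int_add)
  show "sec (vtx j) a = \<one>"
    by (simp add: vtx_def sec_rot)
qed

lemma a_pow_vtx: "(a [^] k) (vtx j) = vtx (j + k)" "sec (vtx j) (a [^] k) = \<one>" for k :: int
proof -
  have nat: "(a [^] n) (vtx j) = vtx (j + int n) \<and> sec (vtx j) (a [^] n) = \<one>" for n :: nat and j
  proof (induction n arbitrary: j)
    case (Suc n)
    then show ?case
      using Suc [of "j + 1"] a_vtx [of j] by (simp add: algebra_simps)
  qed simp
  have "(a [^] k) (vtx j) = vtx (j + k) \<and> sec (vtx j) (a [^] k) = \<one>"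
  proof (cases k rule: int_cases2)
    case (nonneg n)
    then show ?thesis
      using nat [of n j] by (simp add: int_pow_int)
  next
    case (nonpos n)
    have j: "(a [^] n) (vtx (j + k)) = vtx j"
      using nat [of n "j + k"] nonpos by simp
    then have "(inv (a [^] n)) (vtx j) = vtx (j + k)"
      using apply_inv(1) [of "a [^] n" "vtx (j + k)"] by simp
    moreover have "sec (vtx j) (inv (a [^] n)) = \<one>"
      using sec_inv [of "a [^] n" "vtx (j + k)"] j nat [of n "j + k"] by simp
    ultimately show ?thesis
      using nonpos by (simp add: int_pow_neg int_pow_int)
  qed
  then show "(a [^] k) (vtx j) = vtx (j + k)" "sec (vtx j) (a [^] k) = \<one>"
    by auto
qed

lemma b_vtx: "b (vtx j) = vtx j"
  "sec (vtx j) b = (if int p dvd j + 1 then b else a [^] int (\<epsilon> (nat (j mod int p))))"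
proof -
  let ?i = "nat (j mod int p)"
  have rc: "(a [^] k) w = (rooted_cycle p ^^ k) w" if "w \<in> T" for k :: nat and w
    using that
  proof (induction k arbitrary: w)
    case (Suc k)
    have "a w = rooted_cycle p w"
      using Suc.prems by (simp add: rot_def)
    then show ?case
      using Suc rooted_cycle_in_tree by (simp add: funpow_swap1)
  qed simp
  have bw: "b w = ggs_b p \<epsilon> w" if "w \<in> T" for w
    using that by (simp add: b_def)
  have nil: "(rooted_cycle p ^^ k) [] = []" for k
    by (induction k) auto
  show 1: "b (vtx j) = vtx j"
    by (simp add: bw) (simp add: vtx_def nil)
  \<comment> \<open>The recursion of \<open>b\<close> continues at the last letter
    \<open>p - 1\<close>, which is \<open>-1\<close> modulo \<open>p\<close>.\<close>
  have "int p dvd j + 1 \<longleftrightarrow> \<not> ?i < p - 1"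
  proof -
    have "int p dvd j + 1 \<longleftrightarrow> (j mod int p) = (- 1) mod int p"
      by (simp add: mod_eq_dvd_iff)
    also have "(- 1) mod int p = int p - 1"
      using p_ge_2 by (simp add: zmod_minus1)
    also have "j mod int p = int p - 1 \<longleftrightarrow> \<not> j mod int p < int p - 1"
      using pos_mod_bound [of "int p" j] p_pos by linarith
    also have "\<dots> \<longleftrightarrow> \<not> ?i < p - 1"
      using p_ge_2 pos_mod_sign [of "int p" j] by (auto simp: nat_less_iff)
    finally show ?thesis .
  qed
  moreover have "sec (vtx j) b = a [^] (\<epsilon> ?i)" if "?i < p - 1"
    using that by (intro sec_eqI) (simp_all add: 1, simp_all add: bw rc vtx_def)
  moreover have "sec (vtx j) b = b" if "\<not> ?i < p - 1"
    using that by (intro sec_eqI) (simp_all add: 1, simp_all add: bw vtx_def)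
  ultimately show "sec (vtx j) b = (if int p dvd j + 1 then b else a [^] int (\<epsilon> ?i))"
    by (simp add: int_pow_int)
qed

text \<open>\<open>E\<close> is the defining vector shifted so that the conjugate \<open>B i\<close> of \<open>b\<close> has the section
  \<open>b\<close> at \<open>i\<close> and \<open>a ^ E (j - i)\<close> at \<open>j \<noteq> i\<close>, indices being taken modulo \<open>p\<close>.\<close>

definition E :: "int \<Rightarrow> int" where
  "E k = (if int p dvd k then 0 else int (\<epsilon> (nat ((k - 1) mod int p))))"

lemma E_cong: "int p dvd (i - j) \<Longrightarrow> E i = E j"
proof -
  assume ij: "int p dvd (i - j)"
  then have "int p dvd i \<longleftrightarrow> int p dvd j"
    by (metis dvd_diff_commute dvd_diff_left_iff dvd_add_right_iff diff_add_cancel add.commute)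
  moreover have "(i - 1) mod int p = (j - 1) mod int p"
    using ij by (simp add: mod_eq_dvd_iff)
  ultimately show ?thesis
    by (simp add: E_def)
qed

lemma E_0 [simp]: "E 0 = 0"
  by (simp add: E_def)

lemma E_bounds: "0 \<le> E k" "E k < int p"
proof -
  have "\<epsilon> (nat ((k - 1) mod int p)) < p" if "\<not> int p dvd k"
  proof -
    \<comment> \<open>The index avoids \<open>p - 1\<close>, the only residue where
      \<open>defining_vector\<close> gives no bound.\<close>
    have "(k - 1) mod int p \<noteq> (- 1) mod int p"
      using that by (simp add: mod_eq_dvd_iff)
    moreover have "(- 1) mod int p = int p - 1"
      using p_ge_2 by (simp add: zmod_minus1)
    moreover have "(k - 1) mod int p < int p"
      by simp
    ultimately have "(k - 1) mod int p < int p - 1"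
      by linarith
    then have "nat ((k - 1) mod int p) < p - 1"
      using p_ge_2 by (simp add: nat_less_iff)
    then show ?thesis
      using \<epsilon> by (simp add: defining_vector_def)
  qed
  then show "0 \<le> E k" "E k < int p"
    by (auto simp: E_def)
qed

lemma E_dvd_iff: "int p dvd E k \<longleftrightarrow> E k = 0"
  using E_bounds [of k] zdvd_not_zless [of "E k" "int p"] by (cases "E k = 0") auto

lemma coprime_iff: "coprime x (int p) \<longleftrightarrow> \<not> int p dvd x"
  using prime_int_p prime_imp_coprime [of "int p" x] by (auto simp: coprime_commute not_coprimeI)

lemma unit_mod_p:
  assumes "\<not> int p dvd x"
  shows "\<exists>u v. u * x + v * int p = 1"
proof -
  have "gcd x (int p) = 1"
    using assms coprime_iff coprime_imp_gcd_eq_1 by blast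
  then show ?thesis
    using bezout_int [of x "int p"] by simp
qed

lemma E_nonzero: obtains k where "E k \<noteq> 0"
proof -
  obtain i where "i < p - 1" "\<epsilon> i \<noteq> 0"
    using \<epsilon> by (auto simp: defining_vector_def)
  then have "E (int i + 1) = int (\<epsilon> i)" "\<epsilon> i \<noteq> 0"
    using zdvd_not_zless [of "int i + 1" "int p"] by (auto simp: E_def)
  then show ?thesis
    using that [of "int i + 1"] by simp
qed

text \<open>The exponent is \<open>i + 1\<close> because \<open>b\<close> itself has its section
  \<open>b\<close> at position \<open>-1\<close>.\<close>

definition B :: "int \<Rightarrow> nat list \<Rightarrow> nat list" where
  "B i = a [^] (i + 1) \<otimes> b \<otimes> inv (a [^] (i + 1))"

lemma B_closed [simp]: "B i \<in> carrier A"
  by (simp add: B_def)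

lemma B_vtx: "B i (vtx j) = vtx j"
  "sec (vtx j) (B i) = (if int p dvd (j - i) then b else a [^] E (j - i))"
proof -
  have inv: "inv (a [^] (i + 1)) = a [^] (- (i + 1))"
    by (rule int_pow_neg [symmetric]) simp
  show "B i (vtx j) = vtx j"
    unfolding B_def inv by (simp add: a_pow_vtx b_vtx)
  have "sec (vtx j) (B i) = sec (vtx (j + - (i + 1))) b"
    unfolding B_def inv by (simp add: a_pow_vtx b_vtx(1) del: minus_add_distrib)
  also have "j + - (i + 1) = j - i - 1"
    by simp
  finally show "sec (vtx j) (B i) = (if int p dvd (j - i) then b else a [^] E (j - i))"
    using b_vtx(2) [of "j - i - 1"] by (simp add: E_def)
qed

lemma B_conj: "a \<otimes> B i \<otimes> inv a = B (i + 1)"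
proof -
  have "a [^] (i + 1 + 1) = a \<otimes> a [^] (i + 1)"
    using int_pow_mult [of a 1 "i + 1"] by (simp add: int_pow_1 add.commute)
  then show ?thesis
    by (simp add: B_def m_assoc inv_mult_group)
qed

definition G where "G = generate A {a, b}"

lemma G_eq: "GGS_group p \<epsilon> = G"
  unfolding GGS_group_def G_def A_def [symmetric] by (simp add: rot_def b_def)

lemma subgroup_ggs: "subgroup G A"
  unfolding G_def by (rule generate_is_subgroup) simp

sublocale subgroup_pair A G
  by (intro subgroup_pair.intro is_group subgroup_pair_axioms.intro subgroup_ggs)

lemma gens_in_G [simp]: "a \<in> G" "b \<in> G"
  unfolding G_def by (auto intro: generate.incl)

lemma B_in_G [simp]: "B i \<in> G"
  by (simp add: B_def)

sublocale fractal_group p A G "{a, b}"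
proof
  show "\<exists>m>0. s [^] (m::nat) = \<one>" if "s \<in> {a, b}" for s
    using that period by (intro exI [of _ p]) auto
  show "sec [i] s \<in> G" if "s \<in> {a, b}" "i < p" for s i
    using that b_vtx(2) [of "int i"] a_vtx(2) [of "int i"] by (auto simp: vtx_of_nat split: if_splits)
  show "\<exists>g\<in>G. g [0] = [i]" if "i < p" for i
    using that a_pow_vtx(1) [of "int i" 0] by (intro bexI [of _ "a [^] int i"]) (simp_all add: vtx_of_nat vtx_0)
  show "\<exists>h\<in>G. h [0] = [0] \<and> sec [0] h = s" if "s \<in> {a, b}" for s
  proof -
    obtain k where k: "E k \<noteq> 0"
      using E_nonzero .
    then obtain u v where uv: "u * E k + v * int p = 1"
      using unit_mod_p E_dvd_iff by blast
    have nd: "\<not> int p dvd k"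
      using k by (auto simp: E_def)
    \<comment> \<open>\<open>B (- k)\<close> has the section \<open>a ^ E k\<close> at
      \<open>[0]\<close>, with \<open>E k\<close> invertible modulo \<open>p\<close>; the inverse
      \<open>u\<close> as exponent yields \<open>a\<close>.\<close>
    let ?h = "B (- k) [^] u"
    have "sec [0] ?h = (a [^] E k) [^] u" "?h [0] = [0]"
      using sec_int_pow_fixed [of "B (- k)" "[0]" u] B_vtx [where i = "- k" and j = 0] nd
      by (simp_all add: vtx_0)
    moreover have "(a [^] E k) [^] u = a"
    proof -
      have "E k * u = 1 + int p * (- v)"
        using uv by (simp add: algebra_simps)
      then have "(a [^] E k) [^] u = a [^] (1 + int p * (- v))"
        by (simp add: int_pow_pow)
      also have "\<dots> = a \<otimes> (a [^] int p) [^] (- v)"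
        by (simp only: int_pow_mult int_pow_pow closed int_pow_1)
      finally show ?thesis
        by (simp add: int_period int_pow_one)
    qed
    ultimately have ha: "?h \<in> G \<and> ?h [0] = [0] \<and> sec [0] ?h = a"
      by simp
    have hb: "B 0 \<in> G \<and> B 0 [0] = [0] \<and> sec [0] (B 0) = b"
      using B_vtx [of 0 0] by (simp add: vtx_0)
    show ?thesis
      using that ha hb by (metis empty_iff insert_iff)
  qed
qed (use p_ge_2 in \<open>auto simp: G_def\<close>)

text \<open>Both generators act on the first level as rotations. An element fixing one first-level
  vertex therefore fixes all of them (\<open>fixes_first_level\<close>), and its commutators with
  other such elements are computed coordinatewise.\<close>

lemma G_cyclic_first_level:
  assumes "g \<in> G"
  shows "\<exists>k. \<forall>j. g (vtx j) = vtx (j + k)"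
proof -
  let ?H = "{g \<in> G. \<exists>k. \<forall>j. g (vtx j) = vtx (j + k)}"
  have "subgroup ?H A"
  proof (rule subgroupI)
    show "?H \<subseteq> carrier A"
      using mem_carrier by blast
    have "\<one> \<in> ?H"
      by (auto intro: exI [of _ 0])
    then show "?H \<noteq> {}"
      by blast
  next
    fix g assume "g \<in> ?H"
    then obtain k where k: "g \<in> G" "\<And>j. g (vtx j) = vtx (j + k)"
      by blast
    have "(inv g) (vtx j) = vtx (j + - k)" for j
      using apply_inv(1) [of g "vtx (j + - k)"] k mem_carrier by simp
    then show "inv g \<in> ?H"
      using k(1) by (intro CollectI conjI exI [of _ "- k"]) simp_all
  next
    fix g h assume "g \<in> ?H" "h \<in> ?H"
    then obtain k l where k: "g \<in> G" "\<And>j. g (vtx j) = vtx (j + k)"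
      and l: "h \<in> G" "\<And>j. h (vtx j) = vtx (j + l)"
      by blast
    have "(g \<otimes> h) (vtx j) = vtx (j + (l + k))" for j
      using k l mem_carrier by (simp add: algebra_simps)
    then show "g \<otimes> h \<in> ?H"
      using k(1) l(1) by (intro CollectI conjI exI [of _ "l + k"]) simp_all
  qed
  moreover have "{a, b} \<subseteq> ?H"
    using a_vtx(1) b_vtx(1) by (auto intro: exI [of _ 0])
  ultimately have "generate A {a, b} \<subseteq> ?H"
    by (intro generate_subgroup_incl)
  then show ?thesis
    using assms G_def by blast
qed

lemma fixes_first_level:
  assumes "g \<in> G" "g [0] = [0]"
  shows "g (vtx j) = vtx j"
proof -
  obtain k where k: "\<And>j. g (vtx j) = vtx (j + k)"
    using G_cyclic_first_level assms(1) by blast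
  then have "vtx (0 + k) = vtx 0"
    using assms(2) k [of 0] by (simp add: vtx_0)
  then have "int p dvd k"
    by (simp add: vtx_eq_iff)
  then show ?thesis
    using k [of j] vtx_eq_iff [of "j + k" j] by simp
qed

subsection \<open>Torsion forces the defining vector to have sum zero\<close>

text \<open>Multiplication by \<sigma> permutes the residues modulo \<open>p\<close>, and
  \<open>t\<close> is the one sent to \<open>p - 1\<close>, where the section of \<open>b\<close> is
  \<open>b\<close> rather than a power of \<open>a\<close>.\<close>

lemma sum_\<epsilon>_reindex:
  assumes \<sigma>: "\<not> p dvd \<sigma>" and t: "t < p" "int p dvd int (t * \<sigma>) + 1"
  shows "(\<Sum>i\<in>{..<p} - {t}. \<epsilon> (nat (int (i * \<sigma>) mod int p))) = (\<Sum>i<p - 1. \<epsilon> i)"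
proof -
  let ?f = "\<lambda>i. nat (int (i * \<sigma>) mod int p)"
  have inj: "i = j" if "?f i = ?f j" "i < p" "j < p" for i j
  proof -
    have "int (i * \<sigma>) mod int p = int (j * \<sigma>) mod int p"
      using that(1) by (simp add: nat_eq_iff2)
    then have "int p dvd (int i - int j) * int \<sigma>"
      by (simp add: mod_eq_dvd_iff algebra_simps)
    then have "int p dvd int i - int j"
      using prime_dvd_multD [OF prime_int_p, of "int i - int j" "int \<sigma>"] \<sigma> by simp
    then have "int i mod int p = int j mod int p"
      by (simp add: mod_eq_dvd_iff)
    then show ?thesis
      using that by simp
  qed
  have ft: "?f t = p - 1"
  proof -
    have "int (t * \<sigma>) mod int p = (- 1) mod int p"
      using t(2) by (simp add: mod_eq_dvd_iff)
    then show ?thesis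
      using p_ge_2 by (simp add: zmod_minus1)
  qed
  have "inj_on ?f ({..<p} - {t})"
    by (rule inj_onI, rule inj) auto
  moreover have "?f ` ({..<p} - {t}) = {..<p - 1}"
  proof (rule card_seteq)
    show "?f ` ({..<p} - {t}) \<subseteq> {..<p - 1}"
    proof (rule image_subsetI)
      fix i assume "i \<in> {..<p} - {t}"
      then have i: "i < p" "i \<noteq> t"
        by auto
      then have "?f i \<noteq> p - 1" "?f i < p"
        using inj [of i t] t(1) ft by auto
      then have "?f i < p - 1"
        by linarith
      then show "?f i \<in> {..<p - 1}"
        by (rule lessThan_iff [THEN iffD2])
    qed
    show "card {..<p - 1} \<le> card (?f ` ({..<p} - {t}))"
      using calculation t(1) by (simp add: card_image)
  qed simp
  ultimately have "bij_betw ?f ({..<p} - {t}) {..<p - 1}"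
    by (simp add: bij_betw_def)
  then show ?thesis
    by (rule sum.reindex_bij_betw)
qed

text \<open>If the sum \<open>\<sigma>\<close> is nonzero modulo \<open>p\<close>, then \<open>g = a ^ \<sigma> b\<close> permutes the first level cyclically and
  the sections of \<open>g ^ p\<close> on that level are conjugate to \<open>g\<close>, so the order of \<open>g\<close> would be \<open>p\<close> times
  itself.\<close>

lemma infinite_order:
  assumes \<sigma>: "\<sigma> = (\<Sum>i<p - 1. \<epsilon> i)" "\<not> p dvd \<sigma>" and "n > 0"
  shows "(a [^] int \<sigma> \<otimes> b) [^] (n::nat) \<noteq> \<one>"
proof -
  define g where "g = a [^] int \<sigma> \<otimes> b"
  have g: "g \<in> carrier A"
    by (simp add: g_def)
  have g_vtx: "g (vtx j) = vtx (j + int \<sigma>)" "sec (vtx j) g = sec (vtx j) b" for j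
    by (simp_all add: g_def b_vtx(1) a_pow_vtx)
  have pow_vtx: "(g [^] m) (vtx 0) = vtx (int (m * \<sigma>))" for m :: nat
  proof -
    have "(g [^] m) (vtx j) = vtx (j + int (m * \<sigma>))" for j
    proof (induction m arbitrary: j)
      case (Suc m)
      then show ?case
        using g g_vtx(1) [of j] by (simp add: algebra_simps)
    qed simp
    then show ?thesis
      using \<open>\<And>j. (g [^] m) (vtx j) = vtx (j + int (m * \<sigma>))\<close> [of 0] by simp
  qed
  have coset: "\<not> int p dvd int \<sigma>"
    using \<sigma>(2) by simp
  \<comment> \<open>\<open>t\<close> is \<open>-1/\<sigma>\<close> modulo \<open>p\<close>: the step
    at which the orbit of \<open>vtx 0\<close> under \<open>g\<close> meets the position where the
    section of \<open>b\<close> is \<open>b\<close>.\<close>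
  obtain t where t: "t < p" "int p dvd int (t * \<sigma>) + 1"
  proof -
    obtain u v where uv: "u * int \<sigma> + v * int p = 1"
      using unit_mod_p coset by blast
    let ?t = "nat ((- u) mod int p)"
    have "int (?t * \<sigma>) + 1 = ((- u) mod int p) * int \<sigma> + (u * int \<sigma> + v * int p)"
      using uv by simp
    also have "\<dots> = ((- u) mod int p - (- u)) * int \<sigma> + v * int p"
      by (simp add: algebra_simps)
    finally have "int p dvd int (?t * \<sigma>) + 1"
      using mod_eq_dvd_iff [of "(- u) mod int p" "int p" "- u"] by (metis dvd_add dvd_mult2 dvd_triv_right mod_mod_trivial)
    then show ?thesis
      using that [of ?t] by simp
  qed
  define x where "x i = \<epsilon> (nat (int (i * \<sigma>) mod int p))" for i
  have step: "sec (vtx 0) (g [^] Suc m) = sec (vtx (int (m * \<sigma>))) b \<otimes> sec (vtx 0) (g [^] m)" for m :: nat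
  proof -
    have "g [^] Suc m = g \<otimes> g [^] m"
      using g by (simp only: nat_pow_Suc2)
    then show ?thesis
      using g g_vtx pow_vtx [of m] by (simp del: nat_pow_Suc)
  qed
  have t_iff: "int p dvd int (m * \<sigma>) + 1 \<longleftrightarrow> m = t" if "m < p" for m
  proof
    assume "int p dvd int (m * \<sigma>) + 1"
    then have "int p dvd (int (m * \<sigma>) + 1) - (int (t * \<sigma>) + 1)"
      using t(2) by (rule dvd_diff)
    then have "int p dvd (int m - int t) * int \<sigma>"
      by (simp add: algebra_simps)
    then have "int p dvd int m - int t"
      using prime_dvd_multD [OF prime_int_p] coset by blast
    then have "int m mod int p = int t mod int p"
      by (simp add: mod_eq_dvd_iff)
    then show "m = t"
      using that t(1) by simp
  qed (use t in simp)
  have secb: "sec (vtx (int (m * \<sigma>))) b = (if m = t then b else a [^] int (x m))" if "m < p" for m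
    using b_vtx(2) [of "int (m * \<sigma>)"] t_iff [OF that] by (simp add: x_def)
  have before: "sec (vtx 0) (g [^] m) = a [^] int (\<Sum>i<m. x i)" if "m \<le> t" for m :: nat
    using that
  proof (induction m)
    case (Suc m)
    then have "sec (vtx 0) (g [^] Suc m) = a [^] int (x m) \<otimes> a [^] int (\<Sum>i<m. x i)"
      using step [of m] secb [of m] t(1) by simp
    then show ?case
      by (simp add: int_pow_mult [symmetric] add.commute)
  qed simp
  \<comment> \<open>The factor \<open>b\<close> enters exactly once, at step \<open>t\<close>, and
    the powers of \<open>a\<close> accumulate separately on its two sides.\<close>
  have after: "sec (vtx 0) (g [^] m) =
      a [^] int (\<Sum>i\<in>{..<m} - {..t}. x i) \<otimes> b \<otimes> a [^] int (\<Sum>i<t. x i)" if "t < m" "m \<le> p" for m :: nat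
    using that
  proof (induction m)
    case (Suc m)
    show ?case
    proof (cases "m = t")
      case True
      then have sum: "(\<Sum>i\<in>{..<Suc m} - {..t}. x i) = 0"
        by (simp add: lessThan_Suc_atMost)
      show ?thesis
        unfolding sum using step [of m] secb [of m] before [of m] Suc.prems True
        by (simp del: nat_pow_Suc)
    next
      case False
      then have "{..<Suc m} - {..t} = insert m ({..<m} - {..t})"
        using Suc.prems by auto
      then have sum: "(\<Sum>i\<in>{..<Suc m} - {..t}. x i) = x m + (\<Sum>i\<in>{..<m} - {..t}. x i)"
        by simp
      show ?thesis
        unfolding sum using step [of m] secb [of m] Suc False
        by (simp add: int_pow_mult [symmetric] m_assoc del: nat_pow_Suc)
          (simp add: int_pow_mult m_assoc)
    qed
  qed simp
  let ?X = "\<Sum>i\<in>{..<p} - {..t}. x i" and ?Y = "\<Sum>i<t. x i"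
  have "{..<p} - {t} = ({..<p} - {..t}) \<union> {..<t}" "({..<p} - {..t}) \<inter> {..<t} = {}"
    using t(1) by auto
  then have "(\<Sum>i\<in>{..<p} - {t}. x i) = ?X + ?Y"
    by (simp add: sum.union_disjoint)
  moreover have "(\<Sum>i\<in>{..<p} - {t}. x i) = \<sigma>"
    by (simp only: x_def sum_\<epsilon>_reindex [OF \<sigma>(2) t] \<sigma>(1) [symmetric])
  ultimately have XY: "\<sigma> = ?X + ?Y"
    by simp
  \<comment> \<open>As \<open>\<sigma> = ?X + ?Y\<close>, the product \<open>a^?X b a^?Y\<close> is
    \<open>g\<close> conjugated by \<open>a^?Y\<close>.\<close>
  have conj: "sec (vtx 0) (g [^] p) = inv (a [^] int ?Y) \<otimes> g \<otimes> a [^] int ?Y"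
  proof -
    have "int \<sigma> = int ?Y + int ?X"
      using XY by simp
    then have "g = a [^] int ?Y \<otimes> a [^] int ?X \<otimes> b"
      unfolding g_def by (simp only: int_pow_mult closed)
    then show ?thesis
      using after [of p] t(1) by (simp add: m_assoc)
  qed
  \<comment> \<open>Descent: if \<open>g^n = 1\<close>, the action on the first level forces
    \<open>n = p m\<close>, and the section of \<open>(g^p)^m\<close> gives \<open>g^m = 1\<close>
    with \<open>m < n\<close>.\<close>
  have "g [^] n \<noteq> \<one>"
    using \<open>n > 0\<close>
  proof (induction n rule: less_induct)
    case (less n)
    show ?case
    proof
      assume gn: "g [^] n = \<one>"
      then have "vtx (int (n * \<sigma>)) = vtx 0"
        using pow_vtx [of n] by simp
      then have "p dvd n * \<sigma>"
        by (simp add: vtx_eq_iff del: of_nat_mult)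
      then have "p dvd n"
        using prime_dvd_multD [OF prime_p] \<sigma>(2) by blast
      then obtain m where m: "n = p * m"
        by (auto simp: dvd_def)
      have gp: "g [^] p \<in> carrier A" "(g [^] p) (vtx 0) = vtx 0"
        using g pow_vtx [of p] by (simp_all add: vtx_eq_iff)
      have "\<one> = sec (vtx 0) ((g [^] p) [^] m)"
        using gn m g by (simp add: nat_pow_pow)
      also have "\<dots> = (sec (vtx 0) (g [^] p)) [^] m"
        using sec_int_pow_fixed(2) [OF gp(1) _ gp(2), of "int m"] by (simp add: int_pow_int)
      also have "\<dots> = inv (a [^] int ?Y) \<otimes> g [^] m \<otimes> a [^] int ?Y"
      proof -
        have "(inv y \<otimes> g \<otimes> y) [^] k = inv y \<otimes> g [^] k \<otimes> y" if "y \<in> carrier A" for y and k :: nat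
          using that g by (induction k) (simp_all add: m_assoc)
        then show ?thesis
          unfolding conj by simp
      qed
      finally have eq: "\<one> = inv (a [^] int ?Y) \<otimes> g [^] m \<otimes> a [^] int ?Y" .
      have "g [^] m = a [^] int ?Y \<otimes> (inv (a [^] int ?Y) \<otimes> g [^] m \<otimes> a [^] int ?Y) \<otimes> inv (a [^] int ?Y)"
        using g by (simp add: m_assoc)
      then have "g [^] m = \<one>"
        unfolding eq [symmetric] by simp
      moreover have "0 < m" "m < n"
        using m less.prems p_ge_2 by auto
      ultimately show False
        using less.IH by blast
    qed
  qed
  then show ?thesis
    by (simp add: g_def)
qed

lemma sum_dvd_of_torsion:
  assumes "torsion p G"
  shows "p dvd (\<Sum>i<p - 1. \<epsilon> i)"
proof (rule ccontr)
  assume nd: "\<not> p dvd (\<Sum>i<p - 1. \<epsilon> i)"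
  have "a [^] int (\<Sum>i<p - 1. \<epsilon> i) \<otimes> b \<in> G"
    by simp
  then obtain n :: nat where "n > 0" "(a [^] int (\<Sum>i<p - 1. \<epsilon> i) \<otimes> b) [^] n = \<one>"
    using assms unfolding torsion_def A_def [symmetric] by blast
  then show False
    using infinite_order [OF refl nd] by blast
qed

lemma pow_cong:
  assumes "int p dvd (x - y)"
  shows "a [^] x = a [^] y" "b [^] x = b [^] y"
proof -
  have "a [^] (x - y + y) = a [^] y" "b [^] (x - y + y) = b [^] y"
    using int_period_dvd [OF assms] by (simp_all only: int_pow_mult closed l_one int_pow_closed)
  then show "a [^] x = a [^] y" "b [^] x = b [^] y"
    by simp_all
qed

lemma B_sec:
  "int p dvd (j - i) \<Longrightarrow> sec (vtx j) (B i) = b"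
  "\<not> int p dvd (j - i) \<Longrightarrow> sec (vtx j) (B i) = a [^] E (j - i)"
  by (simp_all add: B_vtx)

lemma E_zero_of_dvd: "int p dvd k \<Longrightarrow> E k = 0"
  by (simp add: E_def)

lemma a_mem_of_pow:
  assumes "subgroup H A" "\<not> int p dvd x" "a [^] x \<in> H"
  shows "a \<in> H"
  using int_pow_generates [OF assms(1) closed(1) int_period(1) _ assms(3)] assms(2) coprime_iff by blast

lemma b_mem_of_pow:
  assumes "subgroup H A" "\<not> int p dvd x" "b [^] x \<in> H"
  shows "b \<in> H"
  using int_pow_generates [OF assms(1) closed(2) int_period(2) _ assms(3)] assms(2) coprime_iff by blast

lemma a_pow_commute: "a [^] (x::int) \<otimes> a [^] (y::int) = a [^] y \<otimes> a [^] x"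
  by (simp add: int_pow_mult [symmetric] add.commute)

end

subsection \<open>The branch structure of torsion GGS groups\<close>

lemma (in regular_tree) sec_commutator_fixed:
  assumes "g \<in> carrier A" "h \<in> carrier A" "v \<in> T" "g v = v" "h v = v"
  shows "commutator g h v = v" "sec v (commutator g h) = commutator (sec v g) (sec v h)"
  using assms by (simp_all add: commutator_def inv_fixes sec_inv_fixed)

locale torsion_ggs = ggs +
  assumes sum_\<epsilon>: "p dvd (\<Sum>i<p - 1. \<epsilon> i)"
begin

lemma sum_E: "int p dvd (\<Sum>j\<in>{0..<int p}. E j)"
proof -
  have "{0..<int p} = insert 0 ((\<lambda>i. int i + 1) ` {..<p - 1})"
  proof
    show "{0..<int p} \<subseteq> insert 0 ((\<lambda>i. int i + 1) ` {..<p - 1})"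
    proof
      fix j assume j: "j \<in> {0..<int p}"
      show "j \<in> insert 0 ((\<lambda>i. int i + 1) ` {..<p - 1})"
      proof (cases "j = 0")
        case False
        then have "j = int (nat (j - 1)) + 1" "nat (j - 1) < p - 1"
          using j by auto
        then show ?thesis
          by blast
      qed simp
    qed
  qed (use p_ge_2 in auto)
  moreover have "inj_on (\<lambda>i. int i + 1) {..<p - 1}" "0 \<notin> (\<lambda>i. int i + 1) ` {..<p - 1}"
    by (auto simp: inj_on_def)
  ultimately have "(\<Sum>j\<in>{0..<int p}. E j) = (\<Sum>i<p - 1. E (int i + 1))"
    by (simp add: sum.reindex)
  also have "\<dots> = (\<Sum>i<p - 1. int (\<epsilon> i))"
  proof (rule sum.cong)
    fix i assume "i \<in> {..<p - 1}"
    then have "\<not> int p dvd int i + 1"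
      using zdvd_not_zless [of "int i + 1" "int p"] by auto
    then show "E (int i + 1) = int (\<epsilon> i)"
      using \<open>i \<in> {..<p - 1}\<close> by (simp add: E_def)
  qed simp
  also have "\<dots> = int (\<Sum>i<p - 1. \<epsilon> i)"
    by simp
  finally show ?thesis
    using sum_\<epsilon> by (simp only: int_dvd_int_iff)
qed

lemma sum_E_reflect: "int p dvd (\<Sum>j\<in>{0..<int p}. E (s - j))"
proof -
  have inv: "(s - (s - j) mod int p) mod int p = j" if "j \<in> {0..<int p}" for j
    using that by (simp add: mod_diff_right_eq)
  have "(\<Sum>j\<in>{0..<int p}. E (s - j)) = (\<Sum>j\<in>{0..<int p}. E j)"
  proof (rule sum.reindex_bij_witness [where i = "\<lambda>j. (s - j) mod int p" and j = "\<lambda>j. (s - j) mod int p"])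
    show "E ((s - j) mod int p) = E (s - j)" for j
      by (rule E_cong) (simp add: mod_eq_dvd_iff [symmetric])
  qed (use inv in auto)
  then show ?thesis
    using sum_E by simp
qed

text \<open>If \<open>E\<close> vanished off the class of \<open>s\<close>, its sum would be
  \<open>E s\<close>, which must then be zero by \<open>sum_E\<close> and the bounds on
  \<open>E\<close>; so \<open>E\<close> would vanish identically.\<close>

lemma exists_other:
  assumes s: "E (- s) \<noteq> 0"
  obtains j where "E j \<noteq> 0" "\<not> int p dvd (j - s)"
proof -
  have "\<exists>j. E j \<noteq> 0 \<and> \<not> int p dvd (j - s)"
  proof (rule ccontr)
    assume "\<not> ?thesis"
    then have *: "E j = 0" if "\<not> int p dvd (j - s)" for j
      using that by blast
    let ?s = "s mod int p"
    have sm: "?s \<in> {0..<int p}" "E ?s = E s"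
      using E_cong [of ?s s] by (simp_all add: mod_eq_dvd_iff [symmetric])
    have "E j = 0" if "j \<in> {0..<int p} - {?s}" for j
    proof (rule *)
      have "j mod int p \<noteq> s mod int p"
        using that by auto
      then show "\<not> int p dvd (j - s)"
        by (simp add: mod_eq_dvd_iff)
    qed
    then have "(\<Sum>j\<in>{0..<int p}. E j) = E s"
      using sm by (simp add: sum.remove [of _ ?s])
    then have "E s = 0"
      using sum_E E_dvd_iff by metis
    then show False
      using * [of "- s"] s E_cong [of "- s" s] by auto
  qed
  then show ?thesis
    using that by blast
qed

text \<open>That \<open>\<gamma>\<^sub>3(G)\<close> contains its copy below \<open>[0]\<close> amounts to \<open>Z = G\<close>.\<close>

definition Q where "Q = {g \<in> G. inj_at [0] g \<in> lcs 2}"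
definition Z where "Z = {g \<in> G. \<forall>x\<in>lcs 1. commutator g x \<in> Q}"

lemma nsub_Q: "nsub Q"
  unfolding Q_def by (rule nsub_ins_preimage [OF nsub_lcs])

lemma lcs_in_G: "x \<in> lcs n \<Longrightarrow> x \<in> G"
  by (rule nsub_simps(2) [OF nsub_lcs])

lemma nsub_Z: "nsub Z"
  unfolding Z_def
proof (rule nsub_centralizer_mod [OF nsub_Q])
  show "lcs 1 \<subseteq> G"
    using lcs_in_G by blast
  show "g \<otimes> x \<otimes> inv g \<in> lcs 1" if "g \<in> G" "x \<in> lcs 1" for g x
    using nsub_simps(7) [OF nsub_lcs that] .
qed

lemma commutator_swap_mem:
  assumes "nsub N" "commutator x y \<in> N" "x \<in> G" "y \<in> G"
  shows "commutator y x \<in> N"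
  using nsub_simps(6) [OF assms(1,2)] inv_commutator [of x y] assms(3,4) mem_carrier by simp

text \<open>\<open>G\<close> has two generators, so it is abelian modulo \<open>N\<close> as soon as
  these commute there.\<close>

lemma lcs_1_subset:
  assumes N: "nsub N" and ab: "commutator a b \<in> N"
  shows "lcs 1 \<subseteq> N"
proof -
  have triv: "commutator a a = \<one>" "commutator b b = \<one>"
    by (simp_all add: commutator_trivial)
  have "commutator b a \<in> N"
    using commutator_swap_mem [OF N ab] by simp
  then have *: "commutator s t \<in> N" if "s \<in> {a, b}" "t \<in> {a, b}" for s t
    using that ab nsub_simps(4) [OF N] triv by auto
  have "commutator x y \<in> N" if "x \<in> G" "y \<in> G" for x y
    by (rule commutator_generate [OF N, of "{a, b}" "{a, b}"])
      (use that * in \<open>simp_all add: G_def [symmetric]\<close>)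
  then have "gcomm G \<subseteq> N"
    by (intro gcomm_least nsub_simps(1) [OF N])
  then show ?thesis
    by simp
qed

text \<open>\<open>[B 0, B s]\<close> is supported at \<open>0\<close> and \<open>s\<close>; commuting it with an element that is trivial at
  \<open>s\<close> leaves an element supported at \<open>0\<close>.\<close>

lemma sec_mem_Z:
  assumes s: "E (- s) \<noteq> 0" and h: "h \<in> G" "h [0] = [0]" "E s = 0 \<or> sec (vtx s) h = \<one>"
  shows "sec [0] h \<in> Z"
proof -
  have ns: "\<not> int p dvd s" "\<not> int p dvd (0 - s)"
    using s E_zero_of_dvd [of "- s"] by auto
  \<comment> \<open>This is the section at \<open>[0]\<close> of \<open>y = [B 0, B s]\<close>: a
    commutator of \<open>b\<close> with a power of \<open>a\<close> whose exponent is invertible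
    modulo \<open>p\<close>.\<close>
  define m where "m = commutator b (a [^] E (- s))"
  have mG: "m \<in> G"
    by (simp add: m_def)
  define y where "y = commutator (B 0) (B s)"
  have "B s \<in> lcs 0"
    by simp
  then have y: "y \<in> lcs 1" "y \<in> carrier A"
    unfolding y_def using commutator_in_lcs [OF B_in_G, of "B s" 0] by simp_all
  have y_vtx: "y (vtx j) = vtx j" for j
    unfolding y_def by (rule sec_commutator_fixed) (simp_all add: B_vtx)
  have y_sec: "sec (vtx j) y = commutator (sec (vtx j) (B 0)) (sec (vtx j) (B s))" for j
    unfolding y_def by (rule sec_commutator_fixed) (simp_all add: B_vtx)
  have vtx_eq: "vtx j = [0]" if "int p dvd j" for j
    using that vtx_eq_iff [of j 0] vtx_0 by simp
  have y0: "sec [0] y = m"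
    using y_sec [of 0] B_sec(1) [of 0 0] B_sec(2) [of 0 s] ns by (simp add: vtx_0 m_def)
  have key: "commutator (sec [0] h) m \<in> Q"
    if h: "h \<in> G" "h [0] = [0]" "E s = 0 \<or> sec (vtx s) h = \<one>" for h
  proof -
    have hA: "h \<in> carrier A" and h_vtx: "h (vtx j) = vtx j" for j
      using h fixes_first_level mem_carrier by auto
    have cG: "sec [0] h \<in> G" "sec [0] h \<in> carrier A"
      using h self_similar hA by simp_all
    \<comment> \<open>At \<open>s\<close> either \<open>h\<close> or \<open>y\<close> has trivial
      section; at the other nonzero positions the section of \<open>y\<close> is a commutator of two
      powers of \<open>a\<close>.\<close>
    have triv: "commutator (sec (vtx j) h) (sec (vtx j) y) = \<one>" if j: "\<not> int p dvd j" for j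
    proof (cases "int p dvd (j - s)")
      case True
      have js: "vtx j = vtx s" "E j = E s"
        using True vtx_eq_iff [of j s] E_cong by auto
      have "sec (vtx j) y = commutator (a [^] E j) b"
        using y_sec [of j] B_sec(1) [OF True] B_sec(2) [of j 0] j by simp
      then show ?thesis
        using h(3) js hA by (auto simp: commutator_def)
    next
      case False
      have "sec (vtx j) y = \<one>"
        using y_sec [of j] B_sec(2) [OF False] B_sec(2) [of j 0] j
        by (simp add: commutator_trivial a_pow_commute)
      then show ?thesis
        using hA by (simp add: commutator_def)
    qed
    have "commutator h y = inj_at [0] (commutator (sec [0] h) m)"
    proof (rule first_level_vtx_eqI)
      fix j
      note c = sec_commutator_fixed [OF hA y(2) vtx_in_tree h_vtx y_vtx, of j]
      show "commutator h y (vtx j) = inj_at [0] (commutator (sec [0] h) m) (vtx j)"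
        unfolding c(1) using vtx_eq [of j] vtx_eq_iff [of j 0] cG mG mem_carrier
        by (auto simp: vtx_def ins_def)
      show "sec (vtx j) (commutator h y) = sec (vtx j) (inj_at [0] (commutator (sec [0] h) m))"
      proof (cases "int p dvd j")
        case True
        then show ?thesis
          using c(2) vtx_eq [OF True] y0 cG mG mem_carrier [of m] by simp
      next
        case False
        then have "vtx j \<noteq> [0]"
          using vtx_eq_iff [of j 0] vtx_0 by simp
        then have "\<not> prefix [0] (vtx j)" "\<not> prefix (vtx j) [0]"
          by (auto simp: vtx_def)
        then have "sec (vtx j) (inj_at [0] (commutator (sec [0] h) m)) = \<one>"
          using cG mG mem_carrier by (intro sec_ins_incomparable) auto
        then show ?thesis
          unfolding c(2) using triv [OF False] by simp
      qed
    qed (use hA y(2) cG mG mem_carrier in auto)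
    moreover have "commutator h y \<in> lcs (Suc 1)"
      by (rule commutator_in_lcs [OF h(1) y(1)])
    ultimately show ?thesis
      using cG mG by (simp add: Q_def numeral_2_eq_2)
  qed
  \<comment> \<open>Commuting with all of \<open>C\<close> modulo \<open>Q\<close> is a normal
    condition, as \<open>C\<close> is closed under conjugation. It holds for \<open>m\<close>, hence
    for \<open>[a, b]\<close> since \<open>E (- s)\<close> is invertible, hence on
    \<open>lcs 1\<close>; with the entries exchanged this is membership of \<open>C\<close> in
    \<open>Z\<close>.\<close>
  define C where "C = {sec [0] h | h. h \<in> G \<and> h [0] = [0] \<and> (E s = 0 \<or> sec (vtx s) h = \<one>)}"
  have CG: "C \<subseteq> G"
    using self_similar by (auto simp: C_def)
  let ?Z1 = "{x \<in> G. \<forall>c\<in>C. commutator x c \<in> Q}"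
  have Z1: "nsub ?Z1"
  proof (rule nsub_centralizer_mod [OF nsub_Q CG])
    fix g c assume g: "g \<in> G" and "c \<in> C"
    then obtain h where h: "h \<in> G" "h [0] = [0]" "E s = 0 \<or> sec (vtx s) h = \<one>" and c: "c = sec [0] h"
      by (auto simp: C_def)
    obtain t where t: "t \<in> G" "t [0] = [0]" "sec [0] t = g"
      using fractal_zero g by blast
    have tv: "t (vtx s) = vtx s" "h (vtx s) = vtx s"
      using fixes_first_level t h by auto
    have A: "t \<in> carrier A" "h \<in> carrier A"
      using t h mem_carrier by auto
    let ?h = "t \<otimes> h \<otimes> inv t"
    have "?h \<in> G" "?h [0] = [0]" "sec [0] ?h = g \<otimes> c \<otimes> inv g"
      using t h A c by (simp_all add: inv_fixes sec_inv_fixed)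
    moreover have "E s = 0 \<or> sec (vtx s) ?h = \<one>"
      using h(3) A tv by (auto simp: inv_fixes sec_inv_fixed)
    ultimately show "g \<otimes> c \<otimes> inv g \<in> C"
      unfolding C_def by (intro CollectI exI [of _ ?h] conjI) (simp_all only: simp_thms)
  qed
  have "commutator m c \<in> Q" if "c \<in> C" for c
    using that key commutator_swap_mem [OF nsub_Q _ _ mG] CG unfolding C_def by blast
  then have "m \<in> ?Z1"
    using mG by blast
  then have "commutator (a [^] E (- s)) b \<in> ?Z1"
    using commutator_swap_mem [OF Z1, of b "a [^] E (- s)"] by (simp add: m_def)
  then have pow: "a [^] E (- s) \<in> {x \<in> G. \<forall>y\<in>{b}. commutator x y \<in> ?Z1}"
    by simp
  have "\<not> int p dvd E (- s)"
    using s E_dvd_iff by simp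
  moreover have "subgroup {x \<in> G. \<forall>y\<in>{b}. commutator x y \<in> ?Z1} A"
    by (rule subgroup_centralizer_mod [OF Z1]) simp
  ultimately have "a \<in> {x \<in> G. \<forall>y\<in>{b}. commutator x y \<in> ?Z1}"
    using pow by (intro a_mem_of_pow)
  then have "lcs 1 \<subseteq> ?Z1"
    by (intro lcs_1_subset [OF Z1]) simp
  moreover have "sec [0] h \<in> C"
    using h by (auto simp: C_def)
  ultimately have "commutator x (sec [0] h) \<in> Q" if "x \<in> lcs 1" for x
    using that by blast
  then have "commutator (sec [0] h) x \<in> Q" if "x \<in> lcs 1" for x
    using commutator_swap_mem [OF nsub_Q _ lcs_in_G [OF that]] that CG \<open>sec [0] h \<in> C\<close> by blast
  then show ?thesis
    using CG \<open>sec [0] h \<in> C\<close> by (auto simp: Z_def)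
qed

text \<open>The exponents make the sections of \<open>B 0 [^] E (s - k)\<close> and
  \<open>B k [^] (- E s)\<close> at \<open>s\<close>, both powers of \<open>a\<close>, cancel;
  \<open>sec_mem_Z\<close> then applies to the product.\<close>

lemma pair_mem_Z:
  assumes s: "E (- s) \<noteq> 0" and k: "\<not> int p dvd k" "\<not> int p dvd (s - k)"
  shows "b [^] E (s - k) \<otimes> a [^] (- (E s * E (- k))) \<in> Z"
proof -
  have ns: "\<not> int p dvd (s - 0)"
    using s E_zero_of_dvd [of "- s"] by auto
  let ?h = "B 0 [^] E (s - k) \<otimes> B k [^] (- E s)"
  have pow: "(B i [^] n) (vtx j) = vtx j" "sec (vtx j) (B i [^] n) = sec (vtx j) (B i) [^] n" for i j n :: int
    using sec_int_pow_fixed [of "B i" "vtx j" n] by (simp_all add: B_vtx)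
  have "sec (vtx s) ?h = a [^] (E s * E (s - k)) \<otimes> a [^] (E (s - k) * (- E s))"
    using B_sec(2) [OF ns] B_sec(2) [OF k(2)] by (simp add: pow int_pow_pow)
  also have "\<dots> = a [^] (E s * E (s - k) + E (s - k) * (- E s))"
    by (simp only: int_pow_mult closed)
  finally have "sec (vtx s) ?h = \<one>"
    by simp
  moreover have "?h \<in> G" "?h [0] = [0]"
    using pow(1) [of _ _ 0] by (simp_all add: vtx_0)
  ultimately have "sec [0] ?h \<in> Z"
    by (intro sec_mem_Z [OF s]) auto
  moreover have "sec [0] ?h = b [^] E (s - k) \<otimes> a [^] (E (- k) * (- E s))"
    using B_sec(1) [of 0 0] B_sec(2) [of 0 k] k(1) pow [where j = 0] by (simp add: vtx_0 int_pow_pow)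
  ultimately show ?thesis
    by (simp add: mult.commute)
qed

text \<open>With \<open>k = s - j\<close> the exponent of \<open>b\<close> in
  \<open>pair_mem_Z\<close> is \<open>E j\<close>, invertible modulo \<open>p\<close>. Commuting
  with \<open>a\<close> removes the power of \<open>a\<close>, so \<open>[b, a]\<close> lies in
  \<open>Z\<close> and \<open>G / Z\<close> is abelian.\<close>

lemma commutators_in_Z:
  assumes "g \<in> G" "h \<in> G"
  shows "commutator g h \<in> Z"
proof -
  obtain s where s: "E (- s) \<noteq> 0"
    using E_nonzero by (metis minus_minus)
  obtain j where j: "E j \<noteq> 0" "\<not> int p dvd (j - s)"
    using exists_other s by blast
  have nj: "\<not> int p dvd j"
    using j E_zero_of_dvd by blast
  define y where "y = - (E s * E (- (s - j)))"
  have "b [^] E j \<otimes> a [^] y \<in> Z"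
    unfolding y_def using pair_mem_Z [OF s, of "s - j"] nj j(2) by (simp add: dvd_diff_commute)
  then have "commutator (b [^] E j \<otimes> a [^] y) a \<in> Z"
    using commutator_in_nsub(2) [OF nsub_Z] by simp
  moreover have "commutator (b [^] E j \<otimes> a [^] y) a = commutator (b [^] E j) a"
  proof -
    have "a [^] y \<otimes> a = a \<otimes> a [^] y"
      using a_pow_commute [of y 1] by (simp add: int_pow_1)
    then have "commutator (a [^] y) a = \<one>"
      by (intro commutator_trivial) simp_all
    then show ?thesis
      by (simp add: commutator_mult_left)
  qed
  ultimately have "b [^] E j \<in> {x \<in> G. \<forall>y\<in>{a}. commutator x y \<in> Z}"
    by simp
  moreover have "subgroup {x \<in> G. \<forall>y\<in>{a}. commutator x y \<in> Z} A"
    by (rule subgroup_centralizer_mod [OF nsub_Z]) simp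
  moreover have "\<not> int p dvd E j"
    using j E_dvd_iff by simp
  ultimately have "b \<in> {x \<in> G. \<forall>y\<in>{a}. commutator x y \<in> Z}"
    by (intro b_mem_of_pow)
  then have "commutator a b \<in> Z"
    using commutator_swap_mem [OF nsub_Z, of b a] by simp
  then have "lcs 1 \<subseteq> Z"
    by (rule lcs_1_subset [OF nsub_Z])
  moreover have "commutator g h \<in> lcs (Suc 0)"
    using assms by (intro commutator_in_lcs) simp_all
  ultimately show ?thesis
    by (simp del: lcs.simps) blast
qed

text \<open>The linear relations modulo \<open>p\<close> between the images of \<open>b\<close> and
  \<open>a\<close> in \<open>G / Z\<close>; they are additive because that quotient is abelian by
  \<open>commutators_in_Z\<close>.\<close>

definition rel :: "int \<Rightarrow> int \<Rightarrow> bool" where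
  "rel x y \<longleftrightarrow> b [^] x \<otimes> a [^] y \<in> Z"

lemma rel_add:
  assumes "rel x y" "rel x' y'"
  shows "rel (x + x') (y + y')"
proof -
  let ?c = "commutator (a [^] y) (b [^] x')"
  have c: "?c \<in> Z" "?c \<in> carrier A"
    using commutators_in_Z by simp_all
  let ?d = "b [^] x \<otimes> ?c \<otimes> inv (b [^] x)"
  have d: "?d \<in> Z"
    using c nsub_simps(7) [OF nsub_Z] by simp
  have dA: "?d \<in> carrier A"
    using c by simp
  have "(b [^] x \<otimes> a [^] y) \<otimes> (b [^] x' \<otimes> a [^] y') =
        b [^] x \<otimes> (a [^] y \<otimes> b [^] x') \<otimes> a [^] y'"
    by (simp add: m_assoc)
  also have "a [^] y \<otimes> b [^] x' = ?c \<otimes> b [^] x' \<otimes> a [^] y"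
    by (simp add: commutator_mult_swap)
  also have "b [^] x \<otimes> (?c \<otimes> b [^] x' \<otimes> a [^] y) \<otimes> a [^] y' =
        ?d \<otimes> ((b [^] x \<otimes> b [^] x') \<otimes> (a [^] y \<otimes> a [^] y'))"
    using c(2) by (simp add: m_assoc)
  also have "\<dots> = ?d \<otimes> (b [^] (x + x') \<otimes> a [^] (y + y'))"
    by (simp add: int_pow_mult)
  finally have eq: "(b [^] x \<otimes> a [^] y) \<otimes> (b [^] x' \<otimes> a [^] y') = ?d \<otimes> (b [^] (x + x') \<otimes> a [^] (y + y'))" .
  then have "?d \<otimes> (b [^] (x + x') \<otimes> a [^] (y + y')) \<in> Z"
    using assms nsub_simps(5) [OF nsub_Z] unfolding rel_def by metis
  then have "inv ?d \<otimes> (?d \<otimes> (b [^] (x + x') \<otimes> a [^] (y + y'))) \<in> Z"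
    using nsub_simps(5) [OF nsub_Z nsub_simps(6) [OF nsub_Z d]] by blast
  then show ?thesis
    using dA by (simp add: rel_def del: inv_mult_group)
qed

lemma rel_0: "rel 0 0"
  using nsub_simps(4) [OF nsub_Z] by (simp add: rel_def)

lemma rel_sum:
  assumes "finite I" "\<And>i. i \<in> I \<Longrightarrow> rel (f i) (g i)"
  shows "rel (sum f I) (sum g I)"
  using assms by (induction I) (auto simp: rel_0 rel_add)

lemma rel_scale: "rel x y \<Longrightarrow> rel (int n * x) (int n * y)"
  by (induction n) (auto simp: rel_0 rel_add algebra_simps)

lemma rel_cong: "int p dvd (x - x') \<Longrightarrow> int p dvd (y - y') \<Longrightarrow> rel x y \<longleftrightarrow> rel x' y'"
  by (simp only: rel_def pow_cong(1) [of y y'] pow_cong(2) [of x x'])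

text \<open>Sum the relations of \<open>pair_mem_Z\<close> over \<open>k\<close>; the values of \<open>E\<close> sum to \<open>0\<close> modulo \<open>p\<close>.\<close>

lemma rel_support:
  assumes s: "E (- s) \<noteq> 0" "E s \<noteq> 0"
  shows "rel (- 1) (E (- s))"
proof -
  \<comment> \<open>\<open>pair_mem_Z\<close> excludes \<open>k = 0\<close> and
    \<open>k = s\<close>. Among the values \<open>E (s - k)\<close> and \<open>E (- k)\<close>
    thereby omitted only \<open>E s\<close> and \<open>E (- s)\<close> are nonzero, and these are
    what the sums leave modulo \<open>p\<close>.\<close>
  let ?I = "{0..<int p} - {0, s mod int p}"
  have ns: "\<not> int p dvd s"
    using s E_zero_of_dvd by blast
  have sm: "s mod int p \<in> {0..<int p}" "s mod int p \<noteq> 0" "0 \<in> {0..<int p}"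
    using ns by (auto simp: dvd_eq_mod_eq_0)
  have "rel (E (s - k)) (- (E s * E (- k)))" if k: "k \<in> ?I" for k
  proof -
    have "k mod int p \<noteq> 0" "s mod int p \<noteq> k mod int p"
      using k by auto
    then show ?thesis
      unfolding rel_def using pair_mem_Z [OF s(1), of k] by (simp add: dvd_eq_mod_eq_0 mod_eq_dvd_iff)
  qed
  then have "rel (\<Sum>k\<in>?I. E (s - k)) (\<Sum>k\<in>?I. - (E s * E (- k)))"
    by (intro rel_sum) auto
  moreover have "(\<Sum>k\<in>?I. E (s - k)) = (\<Sum>k\<in>{0..<int p}. E (s - k)) - E s"
  proof -
    have "E (s - s mod int p) = 0"
      by (intro E_zero_of_dvd) simp
    moreover have "(\<Sum>k\<in>{0..<int p}. E (s - k)) = (\<Sum>k\<in>?I. E (s - k)) + (\<Sum>k\<in>{0, s mod int p}. E (s - k))"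
      using sm by (intro sum.subset_diff) auto
    ultimately show ?thesis
      using sm(2) by simp
  qed
  moreover have "(\<Sum>k\<in>?I. - (E s * E (- k))) = - E s * (\<Sum>k\<in>{0..<int p}. E (0 - k)) + E s * E (- s)"
  proof -
    have "E (- (s mod int p)) = E (- s)"
      by (rule E_cong) (simp add: mod_eq_dvd_iff [symmetric] mod_simps)
    moreover have "(\<Sum>k\<in>{0..<int p}. E (0 - k)) = (\<Sum>k\<in>?I. E (0 - k)) + (\<Sum>k\<in>{0, s mod int p}. E (0 - k))"
      using sm by (intro sum.subset_diff) auto
    ultimately have "(\<Sum>k\<in>{0..<int p}. E (0 - k)) = (\<Sum>k\<in>?I. E (0 - k)) + E (- s)"
      using sm(2) by simp
    moreover have "(\<Sum>k\<in>?I. - (E s * E (- k))) = - E s * (\<Sum>k\<in>?I. E (0 - k))"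
      by (simp add: sum_distrib_left sum_negf)
    ultimately show ?thesis
      by (simp add: algebra_simps)
  qed
  ultimately have "rel ((\<Sum>k\<in>{0..<int p}. E (s - k)) - E s)
      (- E s * (\<Sum>k\<in>{0..<int p}. E (0 - k)) + E s * E (- s))"
    by simp
  moreover have "int p dvd (((\<Sum>k\<in>{0..<int p}. E (s - k)) - E s) - (- E s))"
    using sum_E_reflect [of s] by simp
  moreover have "int p dvd ((- E s * (\<Sum>k\<in>{0..<int p}. E (0 - k)) + E s * E (- s)) - E s * E (- s))"
    using dvd_mult [OF sum_E_reflect [of 0], of "- E s"] by simp
  ultimately have base: "rel (- E s) (E s * E (- s))"
    using rel_cong by blast
  have "\<not> int p dvd E s"
    using s E_dvd_iff by simp
  then obtain u v where uv: "u * E s + v * int p = 1"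
    using unit_mod_p by blast
  define n where "n = nat (u mod int p)"
  have n: "int n = u mod int p"
    by (simp add: n_def)
  have "int p dvd (int n - u)"
    unfolding n by (simp add: mod_eq_dvd_iff [symmetric])
  then have "int p dvd (int n - u) * E s - v * int p"
    by (rule dvd_diff [OF dvd_mult2]) simp
  also have "(int n - u) * E s - v * int p = int n * E s - 1"
    using uv by (simp add: algebra_simps)
  finally have 1: "int p dvd (int n * E s - 1)" .
  have "rel (int n * (- E s)) (int n * (E s * E (- s)))"
    by (rule rel_scale [OF base])
  moreover have "int p dvd (int n * (- E s) - (- 1))"
    using 1 by (simp add: dvd_diff_commute algebra_simps)
  moreover have "int p dvd (int n * (E s * E (- s)) - E (- s))"
    using dvd_mult2 [OF 1, of "E (- s)"] by (simp add: algebra_simps)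
  ultimately show ?thesis
    using rel_cong by blast
qed

text \<open>Otherwise \<open>E\<close> is constant on its support, whose size lies strictly between \<open>0\<close> and \<open>p\<close>, so that
  the sum of \<open>E\<close> is nonzero modulo \<open>p\<close>.\<close>

lemma G_subset_Z: "G \<subseteq> Z"
proof -
  have "a \<in> Z \<and> b \<in> Z"
  proof (cases "\<exists>s. E (- s) \<noteq> 0 \<and> E s = 0")
    case True
    \<comment> \<open>When the support of \<open>E\<close> is not symmetric,
      \<open>sec_mem_Z\<close> puts no condition on sections at \<open>s\<close> and reaches
      \<open>b\<close> and a power of \<open>a\<close> directly.\<close>
    then obtain s where s: "E (- s) \<noteq> 0" "E s = 0"
      by blast
    have B0: "B i [0] = [0]" for i
      using B_vtx(1) [of i 0] by (simp add: vtx_0)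
    have sec: "sec [0] (B i) \<in> Z" for i
      by (rule sec_mem_Z [OF s(1)]) (simp_all add: B0 s)
    have "b \<in> Z"
      using sec [of 0] B_sec(1) [of 0 0] by (simp add: vtx_0)
    moreover have "sec [0] (B s) = a [^] E (- s)"
      using B_sec(2) [of 0 s] s E_zero_of_dvd [of "- s"] by (auto simp: vtx_0)
    then have "a [^] E (- s) \<in> Z"
      using sec [of s] by simp
    then have "a \<in> Z"
      using a_mem_of_pow [OF nsub_simps(1) [OF nsub_Z]] s(1) E_dvd_iff by blast
    ultimately show ?thesis
      by simp
  next
    case False
    \<comment> \<open>For symmetric support, \<open>b\<close> equals \<open>a ^ E j\<close> modulo
      \<open>Z\<close> for every \<open>j\<close> in the support, so two different values of
      \<open>E\<close> put a nontrivial power of \<open>a\<close> into \<open>Z\<close>.\<close>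
    have rel: "rel (- 1) (E j)" if "E j \<noteq> 0" for j
      using rel_support [of "- j"] that False by (metis minus_minus)
    have "\<exists>i j. E i \<noteq> 0 \<and> E j \<noteq> 0 \<and> E i \<noteq> E j"
    proof (rule ccontr)
      assume const: "\<not> ?thesis"
      obtain k where k: "E k \<noteq> 0"
        using E_nonzero .
      let ?S = "{j \<in> {0..<int p}. E j \<noteq> 0}"
      have "(\<Sum>j\<in>{0..<int p}. E j) = (\<Sum>j\<in>?S. E j)"
        by (rule sum.mono_neutral_right) auto
      also have "\<dots> = (\<Sum>j\<in>?S. E k)"
        using const k by (intro sum.cong) auto
      finally have "int p dvd int (card ?S) * E k"
        using sum_E by simp
      then have "int p dvd int (card ?S)"
        using prime_dvd_multD [OF prime_int_p] k E_dvd_iff by blast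
      then have dvd: "p dvd card ?S"
        by simp
      have less: "card ?S < p"
      proof -
        have "?S \<subseteq> {0..<int p} - {0}"
          by auto
        then have "card ?S \<le> card ({0..<int p} - {0})"
          by (intro card_mono) auto
        then show ?thesis
          using p_ge_2 by simp
      qed
      have "E (k mod int p) = E k"
        by (rule E_cong) (simp add: mod_eq_dvd_iff [symmetric])
      then have "k mod int p \<in> ?S"
        using k by simp
      moreover have "finite ?S"
        by (rule finite_subset [of _ "{0..<int p}"]) auto
      ultimately have "card ?S > 0"
        unfolding card_gt_0_iff by blast
      then show False
        using nat_dvd_not_less [OF _ less] dvd by blast
    qed
    then obtain i j where ij: "E i \<noteq> 0" "E j \<noteq> 0" "E i \<noteq> E j"
      by blast
    have "inv (b [^] (- 1 :: int) \<otimes> a [^] E i) \<otimes> (b [^] (- 1 :: int) \<otimes> a [^] E j) \<in> Z"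
      using rel [OF ij(1)] rel [OF ij(2)] nsub_simps(5,6) [OF nsub_Z] unfolding rel_def by blast
    moreover have "inv (b [^] (- 1 :: int) \<otimes> a [^] E i) \<otimes> (b [^] (- 1 :: int) \<otimes> a [^] E j) = inv (a [^] E i) \<otimes> a [^] E j"
      by (simp add: inv_mult_group m_assoc)
    moreover have "inv (a [^] E i) \<otimes> a [^] E j = a [^] (- E i + E j)"
      by (simp only: int_pow_mult int_pow_neg closed)
    ultimately have "a [^] (- E i + E j) \<in> Z"
      by simp
    moreover have "\<not> int p dvd (- E i + E j)"
    proof
      assume "int p dvd (- E i + E j)"
      then have "E j mod int p = E i mod int p"
        by (simp add: mod_eq_dvd_iff)
      then show False
        using ij(3) E_bounds by simp
    qed
    ultimately have aZ: "a \<in> Z"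
      using a_mem_of_pow [OF nsub_simps(1) [OF nsub_Z]] by blast
    then have "a [^] E i \<in> Z"
      by (rule subgroup_int_pow_closed [OF nsub_simps(1) [OF nsub_Z]])
    then have "(b [^] (- 1 :: int) \<otimes> a [^] E i) \<otimes> inv (a [^] E i) \<in> Z"
      using rel [OF ij(1)] nsub_simps(5,6) [OF nsub_Z] unfolding rel_def by blast
    then have "b [^] (- 1 :: int) \<in> Z"
      by (simp add: m_assoc)
    then have "b \<in> Z"
      by (rule b_mem_of_pow [OF nsub_simps(1) [OF nsub_Z], rotated]) (use p_ge_2 in auto)
    then show ?thesis
      using aZ by simp
  qed
  then have "generate A {a, b} \<subseteq> Z"
    by (intro generate_subgroup_incl nsub_simps(1) [OF nsub_Z]) simp
  then show ?thesis
    by (simp add: G_def)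
qed

lemma ins_lcs:
  assumes "k \<in> lcs 2"
  shows "inj_at [0] k \<in> lcs 2"
proof -
  have "gcomm (lcs 1) \<subseteq> Q"
    by (rule gcomm_least [OF nsub_simps(1) [OF nsub_Q]]) (use G_subset_Z in \<open>auto simp: Z_def\<close>)
  moreover have "lcs 2 = gcomm (lcs 1)"
    by (simp add: numeral_2_eq_2)
  ultimately show ?thesis
    using assms by (auto simp: Q_def)
qed

text \<open>For \<open>p = 2\<close> the defining vector is a single nonzero entry, so its sum is
  not zero modulo 2.\<close>

lemma p_ge_3: "3 \<le> p"
proof (rule ccontr)
  assume "\<not> 3 \<le> p"
  then have "p = 2"
    using p_ge_2 by simp
  moreover have "\<epsilon> 0 < p" "p dvd \<epsilon> 0" "\<epsilon> 0 \<noteq> 0"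
    using \<epsilon> sum_\<epsilon> \<open>p = 2\<close> by (auto simp: defining_vector_def)
  ultimately show False
    using nat_dvd_not_less by blast
qed

lemma commutator_a_B: "commutator a (B i) = B (i + 1) \<otimes> inv (B i)"
  using B_conj [of i] by (simp add: commutator_def)

text \<open>The double commutator \<open>z\<close> starts from \<open>B (- 2)\<close> so that its
  leading term is \<open>B 0\<close>, with section \<open>b\<close> at \<open>[0]\<close>; since
  \<open>p \<ge> 3\<close>, the other terms contribute powers of \<open>a\<close> only. Commuting
  with \<open>a\<close> discards these, and normality gives all conjugates of \<open>[a, b]\<close>
  by powers of \<open>a\<close>.\<close>

lemma commutator_a_B_in_sections: "commutator a (B i) \<in> sections [0]"
proof -
  note N = nsub_simps [OF nsub_sections [of "[0]"]]
  define z where "z = commutator a (commutator a (B (- 2)))"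
  have "B (- 2) \<in> lcs 0"
    by simp
  then have "commutator a (B (- 2)) \<in> lcs (Suc 0)"
    by (intro commutator_in_lcs) simp_all
  then have z: "z \<in> lcs 2"
    unfolding z_def numeral_2_eq_2 by (intro commutator_in_lcs) simp_all
  have "a \<otimes> commutator a (B (- 2)) \<otimes> inv a = commutator a (B (- 1))"
  proof -
    have "a \<otimes> (B (- 1) \<otimes> inv (B (- 2))) \<otimes> inv a = (a \<otimes> B (- 1) \<otimes> inv a) \<otimes> inv (a \<otimes> B (- 2) \<otimes> inv a)"
      by (simp add: m_assoc inv_mult_group)
    then show ?thesis
      unfolding B_conj commutator_a_B by simp
  qed
  then have z_eq: "z = B 0 \<otimes> inv (B (- 1)) \<otimes> inv (B (- 1) \<otimes> inv (B (- 2)))"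
    unfolding z_def commutator_def [of a "commutator a (B (- 2))"] by (simp add: commutator_a_B)
  have nd: "\<not> int p dvd 1" "\<not> int p dvd 2"
    using p_ge_3 zdvd_not_zless [of 1 "int p"] zdvd_not_zless [of 2 "int p"] by auto
  have B0: "B i [0] = [0]" for i
    using B_vtx(1) [of i 0] by (simp add: vtx_0)
  have secs: "sec [0] (B 0) = b" "sec [0] (B (- 1)) = a [^] E 1" "sec [0] (B (- 2)) = a [^] E 2"
    using B_sec(1) [of 0 0] B_sec(2) [of 0 "- 1"] B_sec(2) [of 0 "- 2"] nd by (simp_all add: vtx_0)
  define x where "x = - E 1 + E 2 + - E 1"
  have "sec [0] z = b \<otimes> inv (a [^] E 1) \<otimes> inv (a [^] E 1 \<otimes> inv (a [^] E 2))"
    unfolding z_eq using B0 secs by (simp add: inv_fixes sec_inv_fixed)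
  also have "\<dots> = b \<otimes> a [^] x"
    unfolding x_def by (simp only: int_pow_mult int_pow_neg closed)
      (simp add: m_assoc inv_mult_group)
  finally have "sec [0] z = b \<otimes> a [^] x" .
  moreover have "z [0] = [0]"
    unfolding z_eq using B0 by (simp add: inv_fixes)
  ultimately have "b \<otimes> a [^] x \<in> sections [0]"
    unfolding sections_def using z by (metis (mono_tags, lifting) mem_Collect_eq)
  then have "commutator a (b \<otimes> a [^] x) \<in> sections [0]"
    by (intro commutator_in_nsub(1) nsub_sections) simp_all
  moreover have "commutator a (b \<otimes> a [^] x) = commutator a b"
  proof -
    have "a \<otimes> a [^] x = a [^] x \<otimes> a"
      using a_pow_commute [of 1 x] by (simp add: int_pow_1)
    then have "commutator a (a [^] x) = \<one>"
      by (intro commutator_trivial) simp_all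
    then show ?thesis
      by (simp add: commutator_mult_right)
  qed
  ultimately have "commutator a b \<in> sections [0]"
    by simp
  then have "a [^] (i + 1) \<otimes> commutator a b \<otimes> inv (a [^] (i + 1)) \<in> sections [0]"
    by (intro N(7)) simp_all
  moreover have "a [^] (i + 1) \<otimes> commutator a b \<otimes> inv (a [^] (i + 1)) = commutator a (B i)"
  proof -
    let ?t = "a [^] (i + 1)"
    have t: "a \<otimes> ?t = ?t \<otimes> a" "?t \<in> carrier A"
      using a_pow_commute [of 1 "i + 1"] by (simp_all add: int_pow_1)
    then have it: "inv ?t \<otimes> inv a = inv a \<otimes> inv ?t"
      using inv_mult_group [of a ?t] inv_mult_group [of ?t a] by simp
    have "commutator a (B i) = (a \<otimes> ?t) \<otimes> b \<otimes> (inv ?t \<otimes> inv a) \<otimes> ?t \<otimes> inv b \<otimes> inv ?t"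
      unfolding commutator_def B_def using t(2) by (simp add: m_assoc inv_mult_group)
    also have "\<dots> = (?t \<otimes> a) \<otimes> b \<otimes> (inv a \<otimes> inv ?t) \<otimes> ?t \<otimes> inv b \<otimes> inv ?t"
      unfolding t(1) it ..
    also have "\<dots> = ?t \<otimes> commutator a b \<otimes> inv ?t"
      unfolding commutator_def using t(2) by (simp add: m_assoc)
    finally show ?thesis
      by simp
  qed
  ultimately show ?thesis
    by simp
qed

text \<open>Sections of \<open>[a, B i]\<close> at \<open>[0]\<close> are quotients of powers of
  \<open>a\<close> with consecutive entries of \<open>E\<close> as exponents. They yield
  \<open>a\<close> where two consecutive entries differ, and \<open>i = -1\<close> yields
  \<open>b\<close> up to a power of \<open>a\<close>.\<close>

lemma sections_gens: "{a, b} \<subseteq> sections [0, 0]"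
proof -
  have T0: "[0] \<in> T" "[0, 0] \<in> T"
    by simp_all
  note sub = nsub_simps(1) [OF nsub_sections [OF T0(2)]]
  have B0: "B i [0] = [0]" for i
    using B_vtx(1) [of i 0] by (simp add: vtx_0)
  have step: "sec [0] (B (i + 1)) \<otimes> inv (sec [0] (B i)) \<in> sections [0, 0]" for i
  proof -
    have "commutator a (B i) [0] = [0]"
      unfolding commutator_a_B using B0 by (simp add: inv_fixes)
    then have "sec [0] (commutator a (B i)) \<in> sections ([0] @ [0])"
      using commutator_a_B_in_sections [of i] by (intro sections_append) simp_all
    then show ?thesis
      unfolding commutator_a_B using B0 by (simp add: inv_fixes sec_inv_fixed)
  qed
  have sec0: "sec [0] (B i) = a [^] E (- i)" if "\<not> int p dvd i" for i
    using B_sec(2) [of 0 i] that by (simp add: vtx_0)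
  \<comment> \<open>A constant vector would have sum \<open>(p - 1) E 1\<close>, that is
    \<open>- E 1\<close> modulo \<open>p\<close>, and sum zero would make it vanish.\<close>
  have "\<exists>n. 1 \<le> n \<and> n < int p - 1 \<and> E n \<noteq> E (n + 1)"
  proof (rule ccontr)
    assume "\<not> ?thesis"
    then have eq: "E n = E (n + 1)" if "1 \<le> n" "n < int p - 1" for n
      using that by blast
    have const: "int m < int p - 1 \<Longrightarrow> E (int m + 1) = E 1" for m
    proof (induction m)
      case (Suc m)
      then show ?case
        using eq [of "int m + 1"] by (simp add: algebra_simps)
    qed simp
    have const': "E j = E 1" if "1 \<le> j" "j < int p" for j
      using const [of "nat (j - 1)"] that by simp
    have "(\<Sum>j\<in>{0..<int p}. E j) = E 0 + (\<Sum>j\<in>{0..<int p} - {0}. E j)"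
      by (rule sum.remove) simp_all
    also have "(\<Sum>j\<in>{0..<int p} - {0}. E j) = (\<Sum>j\<in>{0..<int p} - {0}. E 1)"
      by (rule sum.cong [OF refl], rule const') auto
    also have "\<dots> = (int p - 1) * E 1"
      using p_ge_2 by (simp add: of_nat_diff)
    finally have "int p dvd (int p - 1) * E 1"
      using sum_E by simp
    then have "int p dvd int p * E 1 - (int p - 1) * E 1"
      by (intro dvd_diff) simp_all
    then have "E 1 = 0"
      using E_dvd_iff by (simp add: algebra_simps)
    obtain k where k: "E k \<noteq> 0"
      using E_nonzero .
    have "E (k mod int p) = E k"
      by (rule E_cong) (simp add: mod_eq_dvd_iff [symmetric])
    moreover have "k mod int p \<noteq> 0"
      using k E_zero_of_dvd [of k] by (auto simp: dvd_eq_mod_eq_0)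
    then have "1 \<le> k mod int p" "k mod int p < int p"
      using pos_mod_sign [of "int p" k] p_pos by (auto simp del: pos_mod_sign)
    ultimately show False
      using const' k \<open>E 1 = 0\<close> by metis
  qed
  then obtain n where n: "1 \<le> n" "n < int p - 1" "E n \<noteq> E (n + 1)"
    by blast
  have nd: "\<not> int p dvd n" "\<not> int p dvd n + 1"
    using n zdvd_not_zless [of n "int p"] zdvd_not_zless [of "n + 1" "int p"] by auto
  have nd': "\<not> int p dvd - n" "\<not> int p dvd - n - 1"
    using nd dvd_minus_iff [of "int p" n] dvd_minus_iff [of "int p" "n + 1"] by auto
  have "a [^] E n \<otimes> inv (a [^] E (n + 1)) \<in> sections [0, 0]"
    using step [of "- n - 1"] sec0 [OF nd'(1)] sec0 [OF nd'(2)] by (simp add: add.commute)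
  moreover have "a [^] E n \<otimes> inv (a [^] E (n + 1)) = a [^] (E n + - E (n + 1))"
    by (simp only: int_pow_mult int_pow_neg closed)
  ultimately have "a [^] (E n + - E (n + 1)) \<in> sections [0, 0]"
    by simp
  moreover have "\<not> int p dvd (E n + - E (n + 1))"
  proof
    assume "int p dvd (E n + - E (n + 1))"
    then have "E n mod int p = E (n + 1) mod int p"
      by (simp add: mod_eq_dvd_iff)
    then show False
      using n(3) E_bounds by simp
  qed
  ultimately have a: "a \<in> sections [0, 0]"
    using a_mem_of_pow [OF sub] by blast
  have "\<not> int p dvd - 1"
    using p_ge_2 zdvd_not_zless [of 1 "int p"] by auto
  then have "b \<otimes> inv (a [^] E 1) \<in> sections [0, 0]"
    using step [of "- 1"] sec0 [of "- 1"] B_sec(1) [of 0 0] by (simp add: vtx_0)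
  then have "(b \<otimes> inv (a [^] E 1)) \<otimes> a [^] E 1 \<in> sections [0, 0]"
    using subgroup_int_pow_closed [OF sub a] subgroup.m_closed [OF sub] by blast
  then have "b \<in> sections [0, 0]"
    by (simp add: m_assoc)
  then show ?thesis
    using a by simp
qed

lemma branch_setup_ggs: "branch_setup p A (GGS_group p \<epsilon>) (lcs 2) [0, 0]"
  unfolding G_eq by (rule branch) (use ins_lcs sections_gens in auto)

end

theorem proposition1p10:
  fixes d :: nat and G :: "(nat list \<Rightarrow> nat list) set"
  assumes "(d = 2 \<and> G = grigorchuk_group) \<or>
           (prime d \<and> (\<exists>e. defining_vector d e \<and> G = GGS_group d e) \<and> torsion d G)"
  shows "infinite {C \<in> {W. weakly_maximal d G W} // tree_equivalence d G.
                     infinite {W \<in> C. has_block_structure d G W}}"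
  using assms
proof (elim disjE conjE exE)
  assume d: "d = 2" and G: "G = grigorchuk_group"
  interpret grigorchuk "AutT 2"
    by unfold_locales (rule refl)
  show ?thesis
    unfolding d G by (rule branch_setup.infinitely_many_classes [OF branch_setup_grigorchuk])
next
  fix e assume e: "prime d" "defining_vector d e" "torsion d G" and G: "G = GGS_group d e"
  interpret ggs d "AutT d" e
    by unfold_locales (use e in auto)
  have "d dvd (\<Sum>i<d - 1. e i)"
    using sum_dvd_of_torsion e(3) by (simp only: G G_eq)
  then interpret torsion_ggs d "AutT d" e
    by unfold_locales
  show ?thesis
    unfolding G by (rule branch_setup.infinitely_many_classes [OF branch_setup_ggs])
qed

end
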